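(* Let $K\colon\mathbb{R}^{2}\to\mathbb{R}$ be a continuous function of the form $K(x,y)=K_0+K_1(x,y)$ with $K_0\in\mathbb{R}\setminus\{0\}$ and $K_1(x,y)\to 0$ as $|(x,y)|\to\infty$. Let $[\alpha,\beta]\subset\mathbb{R}\setminus\{0\}$, $\alpha<\beta$, be an arbitrary compact interval and, for $\lambda\in[\alpha,\beta]$, let $E_\lambda$ be the energy functional and $c_\lambda$ the mountain pass level defined in the context. Then $$c_{\lambda}\le\frac{\pi}{\left|\lambda K_0\right|}\quad\text{for every }\lambda\in[\alpha,\beta],$$ and, for almost every $\lambda\in[\alpha,\beta]$ such that $c_{\lambda}<\frac{\pi}{\left|\lambda K_0\right|}$, $c_\lambda$ is a critical value of $E_\lambda$ (i.e. there is $u\in H^1\setminus\mathbb{R}^2$ with $E_\lambda(u)=c_\lambda$ and $E'_\lambda(u)=0$), and hence a $\lambda K$-loop exists. (Since $[\alpha,\beta]$ is arbitrary, this covers all, respectively almost all, such $\lambda\in\mathbb{R}\setminus\{0\}$.)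
   Context: Let $i$ be the rotation of $\mathbb{R}^2$ by $\frac\pi2$; identify $\mathbb{R}^2$ with $\mathbb{C}$ when convenient. $H^{1}:=H^{1}(\mathbb{R}/\mathbb{Z},\mathbb{R}^{2})$ with norm $\|u\|^2=\int_0^1|\dot u|^2dt+|\int_0^1u\,dt|^2$; $\mathbb{R}^2\subset H^1$ denotes the constant maps. Set $L(u)=\left(\int_0^1|\dot u|^2dt\right)^{1/2}$, $Q(x,y)=\frac12\left(\int_0^xK(s,y)\,ds,\int_0^yK(x,s)\,ds\right)$, $G(u)=\int_0^1Q(u)\cdot i\dot u\,dt$, and $E_\lambda(u)=L(u)+\lambda G(u)$ for $u\in H^1$. $E_\lambda$ is continuous on $H^1$ and $C^1$ on $H^1\setminus\mathbb{R}^2$ with $E'_\lambda(u)[h]=L(u)^{-1}\int_0^1\dot u\cdot\dot h\,dt+\lambda\int_0^1K(u)h\cdot i\dot u\,dt$. Put $\|K\|_\infty=\sup_{\mathbb{R}^2}|K|$. Mountain pass level, case $0<\alpha<\beta$: there exist $r_0,R>0$ such that, with $u_0(t)=r_0e^{2\pi it}$ if $K_0>0$ and $u_0(t)=r_0e^{-2\pi it}$ if $K_0<0$, one has $L(u_0+z)>\frac{2\pi}{\lambda\|K\|_\infty}$ and $E_\lambda(u_0+z)<0$ for all $z\in\mathbb{R}^2$ with $|z|\ge R$ and all $\lambda\in[\alpha,\beta]$. Fix such $r_0,R$, fix $z_0\in\mathbb{R}^2$ with $|z_0|\ge R$, set $\overline u=u_0+z_0$, $\Gamma=\{\gamma\in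 C([0,1],H^1)\colon\gamma(0)=0,\ \gamma(1)=\overline u\}$ and $c_\lambda=\inf_{\gamma\in\Gamma}\max_{s\in[0,1]}E_\lambda(\gamma(s))$ for $\lambda\in[\alpha,\beta]$. Case $\alpha<\beta<0$: replace $K$ by $-K$ and $\lambda$ by $-\lambda$ (the functional $E_\lambda$ for $K$ coincides with the functional $E_{-\lambda}$ for $-K$), i.e. $c_\lambda$ is the level defined as in the positive case for the curvature function $-K$, the interval $[-\beta,-\alpha]$ and the parameter $-\lambda$. For a continuous $F\colon\mathbb{R}^2\to\mathbb{R}$, an $F$-loop is a closed planar curve (image of a nonconstant periodic map) admitting a periodic parametrization $u\colon\mathbb{R}\to\mathbb{R}^2$ of class $C^2$ with $\dot u(t)\ne0$ and $\frac{\ddot u(t)\cdot i\dot u(t)}{|\dot u(t)|^3}=F(u(t))$ for every $t$; a $\lambda K$-loop is the case $F=\lambda K$. *)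

theory Defs
  imports "HOL-Analysis.Analysis"
begin

text \<open>The plane is identified with \<^typ>\<open>complex\<close>: the scalar product is \<^const>\<open>inner\<close>, and the
  rotation by a right angle is multiplication by \<^const>\<open>imaginary_unit\<close>.\<close>

section \<open>The Sobolev space of 1-periodic planar maps\<close>

text \<open>In one dimension every class in \<open>H\<^sup>1(\<real>/\<int>, \<real>\<^sup>2)\<close> has exactly one continuous representative, and
  the continuous representatives are the 1-periodic maps that are the primitive of a
  square-integrable function. The type below consists of these representatives, so that no
  quotient is needed.\<close>

definition l2_deriv :: "(real \<Rightarrow> complex) \<Rightarrow> (real \<Rightarrow> complex) \<Rightarrow> bool" where
  "l2_deriv u v \<longleftrightarrow>
     v \<in> borel_measurable borel \<and>
     set_integrable lborel {0..1} (\<lambda>t. (norm (v t))\<^sup>2) \<and>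
     (\<forall>t\<in>{0..1}. u t = u 0 + (LINT s:{0..t}|lborel. v s))"

lemma l2_deriv_square_integrable:
  "l2_deriv u v \<Longrightarrow> set_integrable lborel {0..1} (\<lambda>t. (norm (v t))\<^sup>2)"
  by (simp add: l2_deriv_def)

lemma l2_deriv_measurable [measurable_dest]: "l2_deriv u v \<Longrightarrow> v \<in> borel_measurable borel"
  by (simp add: l2_deriv_def)

lemma l2_deriv_inner_integrable:
  assumes "l2_deriv u v" "l2_deriv u' w"
  shows "set_integrable lborel {0..1} (\<lambda>t. v t \<bullet> w t)"
proof -
  note [measurable] = l2_deriv_measurable[OF assms(1)] l2_deriv_measurable[OF assms(2)]
  have i: "set_integrable lborel {0..1} (\<lambda>t. (norm (v t))\<^sup>2 + (norm (w t))\<^sup>2)"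
    using assms by (intro set_integral_add) (auto simp: l2_deriv_def)
  have b: "\<bar>v t \<bullet> w t\<bar> \<le> (norm (v t))\<^sup>2 + (norm (w t))\<^sup>2" for t
  proof -
    have "\<bar>v t \<bullet> w t\<bar> \<le> norm (v t) * norm (w t)" by (rule Cauchy_Schwarz_ineq2)
    also have "\<dots> \<le> (norm (v t))\<^sup>2 + (norm (w t))\<^sup>2"
      using sum_squares_bound[of "norm (v t)" "norm (w t)"]
        mult_nonneg_nonneg[OF norm_ge_zero[of "v t"] norm_ge_zero[of "w t"]] by linarith
    finally show ?thesis .
  qed
  show ?thesis
    using i unfolding set_integrable_def
    by (rule Bochner_Integration.integrable_bound) (auto simp: indicator_def b)
qed

lemma l2_deriv_integrable:
  assumes "l2_deriv u v"
  shows "set_integrable lborel {0..1} v"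
proof -
  note [measurable] = l2_deriv_measurable[OF assms(1)]
  have i: "set_integrable lborel {0..1::real} (\<lambda>t. 1 + (norm (v t))\<^sup>2)"
    by (rule set_integral_add(1)[OF borel_integrable_atLeastAtMost' l2_deriv_square_integrable[OF assms]]) simp
  have b: "norm (v t) \<le> 1 + (norm (v t))\<^sup>2" for t
  proof -
    have "2 * 1 * norm (v t) \<le> 1\<^sup>2 + (norm (v t))\<^sup>2" by (rule sum_squares_bound)
    with norm_ge_zero[of "v t"] show ?thesis unfolding mult_1_right power_one by linarith
  qed
  show ?thesis
    using i unfolding set_integrable_def
    by (rule Bochner_Integration.integrable_bound) (auto simp: indicator_def b)
qed

lemma l2_deriv_integrable':
  assumes "l2_deriv u v" "t \<le> 1"
  shows "set_integrable lborel {0..t} v"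
  by (rule set_integrable_subset[OF l2_deriv_integrable[OF assms(1)]]) (use assms in auto)

lemma l2_deriv_add:
  assumes "l2_deriv u v" "l2_deriv u' w"
  shows "l2_deriv (\<lambda>t. u t + u' t) (\<lambda>t. v t + w t)"
proof -
  note [measurable] = l2_deriv_measurable[OF assms(1)] l2_deriv_measurable[OF assms(2)]
  have "set_integrable lborel {0..1} (\<lambda>t. (v t \<bullet> v t + w t \<bullet> w t) + (v t \<bullet> w t + w t \<bullet> v t))"
    by (intro set_integral_add(1) l2_deriv_inner_integrable[OF assms(1) assms(1)]
        l2_deriv_inner_integrable[OF assms(2) assms(2)]
        l2_deriv_inner_integrable[OF assms(1) assms(2)]
        l2_deriv_inner_integrable[OF assms(2) assms(1)])
  then have "set_integrable lborel {0..1} (\<lambda>t. (norm (v t + w t))\<^sup>2)"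
    by (simp add: power2_norm_eq_inner inner_add_left inner_add_right add_ac)
  moreover have "u t + u' t = u 0 + u' 0 + (LINT s:{0..t}|lborel. v s + w s)" if "t \<in> {0..1}" for t
  proof -
    have "(LINT s:{0..t}|lborel. v s + w s) = (LINT s:{0..t}|lborel. v s) + (LINT s:{0..t}|lborel. w s)"
      using that by (intro set_integral_add(2) l2_deriv_integrable'[OF assms(1)]
          l2_deriv_integrable'[OF assms(2)]) auto
    moreover have "u t = u 0 + (LINT s:{0..t}|lborel. v s)" "u' t = u' 0 + (LINT s:{0..t}|lborel. w s)"
      using that assms unfolding l2_deriv_def by blast+
    ultimately show ?thesis by simp
  qed
  moreover have "(\<lambda>t. v t + w t) \<in> borel_measurable borel" by measurable
  ultimately show ?thesis unfolding l2_deriv_def by blast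
qed

lemma l2_deriv_scaleR:
  assumes "l2_deriv u v"
  shows "l2_deriv (\<lambda>t. c *\<^sub>R u t) (\<lambda>t. c *\<^sub>R v t)"
proof -
  note [measurable] = l2_deriv_measurable[OF assms(1)]
  have "set_integrable lborel {0..1} (\<lambda>t. c\<^sup>2 * (norm (v t))\<^sup>2)"
    using assms by (intro set_integrable_mult_right) (auto simp: l2_deriv_def)
  then have "set_integrable lborel {0..1} (\<lambda>t. (norm (c *\<^sub>R v t))\<^sup>2)"
    by (simp add: power_mult_distrib)
  moreover have "c *\<^sub>R u t = c *\<^sub>R u 0 + (LINT s:{0..t}|lborel. c *\<^sub>R v s)" if "t \<in> {0..1}" for t
  proof -
    have "u t = u 0 + (LINT s:{0..t}|lborel. v s)"
      using that assms unfolding l2_deriv_def by blast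
    then show ?thesis by (simp only: set_integral_scaleR_right scaleR_add_right)
  qed
  moreover have "(\<lambda>t. c *\<^sub>R v t) \<in> borel_measurable borel" by measurable
  ultimately show ?thesis unfolding l2_deriv_def by blast
qed

lemma l2_deriv_C1:
  assumes u: "\<And>t. (u has_vector_derivative v t) (at t)" and v: "continuous_on UNIV v"
  shows "l2_deriv u v"
proof -
  have c: "continuous_on A v" for A using v continuous_on_subset by blast
  have "u t = u 0 + (LINT s:{0..t}|lborel. v s)" if "t \<in> {0..1}" for t
  proof -
    have "(v has_integral u t - u 0) {0..t}"
      using that u by (intro fundamental_theorem_of_calculus)
        (auto intro: has_vector_derivative_at_within)
    then have "integral {0..t} v = u t - u 0" by blast
    moreover have "(LINT s:{0..t}|lborel. v s) = integral {0..t} v"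
      by (rule set_borel_integral_eq_integral) (intro borel_integrable_atLeastAtMost' c)
    ultimately show ?thesis by simp
  qed
  then show ?thesis
    unfolding l2_deriv_def
    by (intro conjI borel_measurable_continuous_onI v borel_integrable_atLeastAtMost'
        continuous_intros c ballI)
qed

lemma l2_deriv_const: "l2_deriv (\<lambda>_. z) (\<lambda>_. 0)"
  by (rule l2_deriv_C1) auto

lemma l2_deriv_continuous_on:
  assumes "l2_deriv u v"
  shows "continuous_on {0..1} u"
proof -
  have "continuous_on {0..1} (\<lambda>t. u 0 + integral {0..t} v)"
    using set_borel_integral_eq_integral(1)[OF l2_deriv_integrable[OF assms]]
    by (intro continuous_intros indefinite_integral_continuous_1)
  moreover have "u 0 + integral {0..t} v = u t" if "t \<in> {0..1}" for t
  proof -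
    have "u t = u 0 + (LINT s:{0..t}|lborel. v s)"
      using that assms unfolding l2_deriv_def by blast
    also have "(LINT s:{0..t}|lborel. v s) = integral {0..t} v"
      using that by (intro set_borel_integral_eq_integral(2) l2_deriv_integrable'[OF assms]) simp
    finally show ?thesis by (rule sym)
  qed
  ultimately show ?thesis by (rule continuous_on_eq)
qed

lemma AE_zero_if_initial_integrals_zero:
  fixes f :: "real \<Rightarrow> complex"
  assumes f: "integrable lborel f" and z: "\<And>a. (LINT s:{..a}|lborel. f s) = 0"
    and tot: "(LINT s|lborel. f s) = 0"
  shows "AE t in lborel. f t = 0"
proof (rule sigma_finite_measure.density_zero[OF sigma_finite_lborel f])
  have fs: "set_integrable lborel B f" if "B \<in> sets borel" for B
    using f that unfolding set_integrable_def by (intro integrable_mult_indicator) auto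
  fix A assume "A \<in> sets (lborel :: real measure)"
  then have A: "A \<in> sigma_sets UNIV (range (\<lambda>a::real. {..a}))"
    by (metis borel_eq_atMost sets_lborel sets_measure_of subset_UNIV Pow_UNIV)
  have S: "sigma_sets UNIV (range (\<lambda>a::real. {..a})) = sets borel"
    by (metis borel_eq_atMost sets_measure_of subset_UNIV Pow_UNIV)
  show "(LINT s:A|lborel. f s) = 0"
  proof (rule sigma_sets_induct_disjoint[OF _ _ A])
    show "Int_stable (range (\<lambda>a::real. {..a}))"
      by (auto simp: Int_stable_def)
    fix B :: "real set" assume B: "B \<in> sigma_sets UNIV (range atMost)" "(LINT s:B|lborel. f s) = 0"
    have "(LINT s:B \<union> (UNIV - B)|lborel. f s) = (LINT s:B|lborel. f s) + (LINT s:UNIV - B|lborel. f s)"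
      using B S by (intro set_integral_Un fs) auto
    moreover have "(LINT s:B \<union> (UNIV - B)|lborel. f s) = 0"
      using tot by (simp add: set_lebesgue_integral_def)
    ultimately show "(LINT s:UNIV - B|lborel. f s) = 0" using B by simp
  next
    fix B :: "nat \<Rightarrow> real set"
    assume B: "disjoint_family B" "range B \<subseteq> sigma_sets UNIV (range atMost)"
      "\<And>i. (LINT s:B i|lborel. f s) = 0"
    have "(LINT s:(\<Union>i. B i)|lborel. f s) = (\<Sum>i. LINT s:B i|lborel. f s)"
      using B S by (intro lebesgue_integral_countable_add fs)
        (auto simp: disjoint_family_on_def intro!: sets.countable_UN)
    then show "(LINT s:\<Union>(range B)|lborel. f s) = 0" using B by simp
  qed (use z in \<open>auto simp: set_lebesgue_integral_def\<close>)
qed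

lemma l2_deriv_unique:
  assumes v: "l2_deriv u v" and w: "l2_deriv u w"
  shows "AE t\<in>{0..1} in lborel. v t = w t"
proof -
  let ?f = "\<lambda>t. indicator {0..1} t *\<^sub>R (v t - w t)"
  have d: "(LINT s:{0..t}|lborel. v s - w s) = 0" if "t \<in> {0..1}" for t
  proof -
    have "(LINT s:{0..t}|lborel. v s - w s) = (LINT s:{0..t}|lborel. v s) - (LINT s:{0..t}|lborel. w s)"
      using that by (intro set_integral_diff(2) l2_deriv_integrable'[OF v]
          l2_deriv_integrable'[OF w]) auto
    moreover have "u t = u 0 + (LINT s:{0..t}|lborel. v s)" "u t = u 0 + (LINT s:{0..t}|lborel. w s)"
      using that v w unfolding l2_deriv_def by blast+
    ultimately show ?thesis by simp
  qed
  have f: "integrable lborel ?f"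
    using set_integral_diff(1)[OF l2_deriv_integrable[OF v] l2_deriv_integrable[OF w]]
    by (simp add: set_integrable_def)
  have "AE t in lborel. ?f t = 0"
  proof (rule AE_zero_if_initial_integrals_zero[OF f])
    show "(LINT s|lborel. ?f s) = 0"
      using d[of 1] by (simp add: set_lebesgue_integral_def)
    fix a :: real
    show "(LINT s:{..a}|lborel. ?f s) = 0"
    proof (cases "a < 0")
      case True
      then have "(LINT s:{..a}|lborel. ?f s) = (LINT s:{..a}|lborel. 0)"
        by (intro set_lebesgue_integral_cong) auto
      then show ?thesis by simp
    next
      case False
      then have "(LINT s:{..a}|lborel. ?f s) = (LINT s:{0..min a 1}|lborel. v s - w s)"
        unfolding set_lebesgue_integral_def
        by (intro Bochner_Integration.integral_cong) (auto simp: indicator_def)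
      then show ?thesis using False d[of "min a 1"] by simp
    qed
  qed
  then show ?thesis by (auto simp: indicator_def elim!: eventually_mono)
qed

lemma periodic_floor:
  fixes u :: "real \<Rightarrow> 'a"
  assumes "\<And>t. u (t + 1) = u t"
  shows "u t = u (frac t)"
proof -
  have n: "u (s + real n) = u s" for s n
  proof (induction n)
    case (Suc n)
    have "s + real (Suc n) = (s + real n) + 1" by simp
    then show ?case using assms[of "s + real n"] Suc by presburger
  qed simp
  have "u (s + of_int k) = u s" for s k
  proof (cases "k \<ge> 0")
    case True
    then show ?thesis using n[of s "nat k"] by simp
  next
    case False
    then show ?thesis using n[of "s + of_int k" "nat (-k)"] by simp
  qed
  from this[of "frac t" "\<lfloor>t\<rfloor>"] show ?thesis by (simp add: frac_def)
qed

typedef h1 = "{u :: real \<Rightarrow> complex. (\<forall>t. u (t + 1) = u t) \<and> (\<exists>v. l2_deriv u v)}"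
  morphisms h1_fun Abs_h1
proof
  show "(\<lambda>_. 0) \<in> {u :: real \<Rightarrow> complex. (\<forall>t. u (t + 1) = u t) \<and> (\<exists>v. l2_deriv u v)}"
    by (intro CollectI conjI allI refl exI[where x = "\<lambda>_. 0"] l2_deriv_const)
qed

setup_lifting type_definition_h1

text \<open>The derivative is determined almost everywhere on the period interval
  (lemma \<open>l2_deriv_unique\<close>); it only enters through integrals over that interval.\<close>

definition h1_deriv :: "h1 \<Rightarrow> real \<Rightarrow> complex" where
  "h1_deriv u = (SOME v. l2_deriv (h1_fun u) v)"

lemma h1_deriv: "l2_deriv (h1_fun u) (h1_deriv u)"
proof -
  have "\<exists>v. l2_deriv (h1_fun u) v" using h1_fun[of u] by blast
  then show ?thesis unfolding h1_deriv_def by (rule someI_ex)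
qed

lemma h1_periodic: "h1_fun u (t + 1) = h1_fun u t"
  using h1_fun[of u] by auto

lemma h1_set_integrable: "set_integrable lborel {0..1} (h1_fun u)"
  by (rule borel_integrable_atLeastAtMost'[OF l2_deriv_continuous_on[OF h1_deriv]])

instantiation h1 :: real_inner
begin

lift_definition zero_h1 :: h1 is "\<lambda>_. 0"
  by (intro conjI allI refl exI[where x = "\<lambda>_. 0"] l2_deriv_const)

lift_definition plus_h1 :: "h1 \<Rightarrow> h1 \<Rightarrow> h1" is "\<lambda>u w t. u t + w t"
  by (elim conjE exE, intro conjI allI exI, simp, erule l2_deriv_add, assumption)

lift_definition scaleR_h1 :: "real \<Rightarrow> h1 \<Rightarrow> h1" is "\<lambda>c u t. c *\<^sub>R u t"
  by (elim conjE exE, intro conjI allI exI, simp, erule l2_deriv_scaleR)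

definition uminus_h1 :: "h1 \<Rightarrow> h1" where "- u = (-1) *\<^sub>R (u :: h1)"

definition minus_h1 :: "h1 \<Rightarrow> h1 \<Rightarrow> h1" where "u - w = u + (- w :: h1)"

definition inner_h1 :: "h1 \<Rightarrow> h1 \<Rightarrow> real" where
  "inner_h1 u w = (LINT t:{0..1}|lborel. h1_deriv u t \<bullet> h1_deriv w t)
     + (LINT t:{0..1}|lborel. h1_fun u t) \<bullet> (LINT t:{0..1}|lborel. h1_fun w t)"

definition norm_h1 :: "h1 \<Rightarrow> real" where
  "norm_h1 u = sqrt ((LINT t:{0..1}|lborel. (norm (h1_deriv u t))\<^sup>2)
     + (norm (LINT t:{0..1}|lborel. h1_fun u t))\<^sup>2)"

definition dist_h1 :: "h1 \<Rightarrow> h1 \<Rightarrow> real" where "dist_h1 u w = norm (u - w)"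

definition sgn_h1 :: "h1 \<Rightarrow> h1" where "sgn_h1 u = inverse (norm u) *\<^sub>R u"

definition uniformity_h1 :: "(h1 \<times> h1) filter" where
  "uniformity_h1 = (INF e\<in>{0<..}. principal {(x, y). dist x y < e})"

definition open_h1 :: "h1 set \<Rightarrow> bool" where
  "open_h1 S = (\<forall>x\<in>S. \<forall>\<^sub>F (x', y) in uniformity. x' = x \<longrightarrow> y \<in> S)"

lemma inner_h1_eq:
  assumes "l2_deriv (h1_fun u) v" "l2_deriv (h1_fun w) v'"
  shows "inner u w = (LINT t:{0..1}|lborel. v t \<bullet> v' t)
     + (LINT t:{0..1}|lborel. h1_fun u t) \<bullet> (LINT t:{0..1}|lborel. h1_fun w t)"
proof -
  note [measurable] = l2_deriv_measurable[OF assms(1)] l2_deriv_measurable[OF assms(2)]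
    l2_deriv_measurable[OF h1_deriv]
  have "AE t\<in>{0..1} in lborel. h1_deriv u t \<bullet> h1_deriv w t = v t \<bullet> v' t"
    using l2_deriv_unique[OF h1_deriv assms(1)] l2_deriv_unique[OF h1_deriv assms(2)] by eventually_elim auto
  then have "(LINT t:{0..1}|lborel. h1_deriv u t \<bullet> h1_deriv w t) = (LINT t:{0..1}|lborel. v t \<bullet> v' t)"
    by (intro set_lebesgue_integral_cong_AE) auto
  then show ?thesis by (simp add: inner_h1_def)
qed

instance
proof
  fix u v w :: h1 and a b :: real
  show "u + v + w = u + (v + w)" by transfer (simp add: add.assoc)
  show "u + v = v + u" by transfer (simp add: add.commute)
  show "0 + u = u" by transfer simp
  show "- u + u = 0" unfolding uminus_h1_def by transfer simp
  show "u - v = u + - v" by (simp add: minus_h1_def)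
  show "a *\<^sub>R (u + v) = a *\<^sub>R u + a *\<^sub>R v" by transfer (simp add: scaleR_add_right)
  show "(a + b) *\<^sub>R u = a *\<^sub>R u + b *\<^sub>R u" by transfer (simp add: scaleR_add_left)
  show "a *\<^sub>R b *\<^sub>R u = (a * b) *\<^sub>R u" by transfer simp
  show "1 *\<^sub>R u = u" by transfer simp
  show "dist u v = norm (u - v)" by (rule dist_h1_def)
  show "sgn u = inverse (norm u) *\<^sub>R u" by (rule sgn_h1_def)
  show "(uniformity :: (h1 \<times> h1) filter) = (INF e\<in>{0<..}. principal {(x, y). dist x y < e})"
    by (rule uniformity_h1_def)
  show "open S = (\<forall>x\<in>S. \<forall>\<^sub>F (x', y) in uniformity. x' = x \<longrightarrow> y \<in> S)" for S :: "h1 set"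
    by (rule open_h1_def)
  show "inner u v = inner v u" by (simp add: inner_h1_def inner_commute)
  show "inner (u + v) w = inner u w + inner v w"
  proof -
    have d: "l2_deriv (h1_fun (u + v)) (\<lambda>t. h1_deriv u t + h1_deriv v t)"
      using l2_deriv_add[OF h1_deriv h1_deriv] by (simp add: plus_h1.rep_eq)
    show ?thesis
      unfolding inner_h1_eq[OF d h1_deriv] inner_h1_def[of u w] inner_h1_def[of v w]
        plus_h1.rep_eq inner_add_left
        set_integral_add(2)[OF h1_set_integrable h1_set_integrable]
        set_integral_add(2)[OF l2_deriv_inner_integrable[OF h1_deriv h1_deriv]
          l2_deriv_inner_integrable[OF h1_deriv h1_deriv]]
      by linarith
  qed
  show "inner (a *\<^sub>R u) v = a * inner u v"
  proof -
    have d: "l2_deriv (h1_fun (a *\<^sub>R u)) (\<lambda>t. a *\<^sub>R h1_deriv u t)"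
      using l2_deriv_scaleR[OF h1_deriv] by (simp add: scaleR_h1.rep_eq)
    show ?thesis
      unfolding inner_h1_eq[OF d h1_deriv] inner_h1_def[of u v] scaleR_h1.rep_eq
        inner_scaleR_left set_integral_scaleR_right set_integral_mult_right distrib_left ..
  qed
  have nn: "0 \<le> (LINT t:{0..1}|lborel. h1_deriv u t \<bullet> h1_deriv u t)"
    unfolding set_lebesgue_integral_def by (intro Bochner_Integration.integral_nonneg) auto
  show "0 \<le> inner u u" using nn by (simp add: inner_h1_def)
  show "norm u = sqrt (inner u u)" by (simp add: norm_h1_def inner_h1_def power2_norm_eq_inner)
  show "inner u u = 0 \<longleftrightarrow> u = 0"
  proof
    assume "u = 0"
    then have "l2_deriv (h1_fun u) (\<lambda>_. 0)"
      by (simp add: zero_h1.rep_eq l2_deriv_const)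
    from inner_h1_eq[OF this this] \<open>u = 0\<close> show "inner u u = 0"
      by (simp add: zero_h1.rep_eq)
  next
    assume "inner u u = 0"
    then have 1: "(LINT t:{0..1}|lborel. h1_deriv u t \<bullet> h1_deriv u t) = 0"
      and 2: "(LINT t:{0..1}|lborel. h1_fun u t) = 0"
      unfolding inner_h1_def add_nonneg_eq_0_iff[OF nn inner_ge_zero] inner_eq_zero_iff by blast+
    have "AE t in lborel. indicator {0..1} t *\<^sub>R (h1_deriv u t \<bullet> h1_deriv u t) = 0"
      using 1 l2_deriv_inner_integrable[OF h1_deriv h1_deriv, of u u]
      unfolding set_lebesgue_integral_def set_integrable_def
      by (subst integral_nonneg_eq_0_iff_AE[symmetric]) auto
    then have ae: "AE t in lborel. t \<in> {0..1} \<longrightarrow> h1_deriv u t = 0"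
      by eventually_elim (auto simp: indicator_def)
    have c: "h1_fun u t = h1_fun u 0" if "t \<in> {0..1}" for t
    proof -
      note [measurable] = l2_deriv_measurable[OF h1_deriv]
      have "(LINT s:{0..t}|lborel. h1_deriv u s) = (LINT s:{0..t}|lborel. 0)"
        using ae that by (intro set_lebesgue_integral_cong_AE) (auto elim!: eventually_mono)
      moreover have "h1_fun u t = h1_fun u 0 + (LINT s:{0..t}|lborel. h1_deriv u s)"
        using h1_deriv[of u] that unfolding l2_deriv_def by blast
      ultimately show ?thesis by simp
    qed
    have "(LINT t:{0..1}|lborel. h1_fun u t) = (LINT t:{0..1::real}|lborel. h1_fun u 0)"
      by (rule set_lebesgue_integral_cong) (simp, intro allI impI, erule c)
    then have z: "h1_fun u 0 = 0" using 2 by (simp add: set_lebesgue_integral_def)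
    have "h1_fun u t = 0" for t
    proof -
      have "frac t \<in> {0..1}" using frac_lt_1[of t] by simp
      with c z have "h1_fun u (frac t) = 0" by metis
      then show ?thesis using periodic_floor[of "h1_fun u" t, OF h1_periodic] by simp
    qed
    then show "u = 0" by (simp add: zero_h1.rep_eq fun_eq_iff flip: h1_fun_inject)
  qed
qed

end

lift_definition h1_const :: "complex \<Rightarrow> h1" is "\<lambda>z _. z"
  by (intro conjI allI refl exI[where x = "\<lambda>_. 0"] l2_deriv_const)

text \<open>The circle of radius \<open>r\<close> about the origin, run through counterclockwise if \<open>k > 0\<close> and
  clockwise otherwise.\<close>

lift_definition h1_circle :: "real \<Rightarrow> real \<Rightarrow> h1" is
  "\<lambda>r k t. of_real r * cis (if 0 < k then 2 * pi * t else - (2 * pi * t))"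
proof -
  fix r k :: real
  define c where "c = (if 0 < k then 2 * pi else - (2 * pi))"
  have e: "(if 0 < k then 2 * pi * t else - (2 * pi * t)) = c * t" for t by (simp add: c_def)
  have "cis (c * (t + 1)) = cis (c * t)" for t
  proof -
    have "cis c = 1" by (auto simp: c_def complex_eq_iff)
    then show ?thesis by (simp add: distrib_left flip: cis_mult)
  qed
  moreover have "l2_deriv (\<lambda>t. of_real r * cis (c * t)) (\<lambda>t. of_real r * (c *\<^sub>R (\<i> * cis (c * t))))"
  proof (rule l2_deriv_C1)
    fix t
    have "((\<lambda>t. c * t) has_derivative (\<lambda>h. c * h)) (at t)"
      by (rule has_derivative_mult_right[OF has_derivative_ident])
    from has_derivative_cis[OF this]
    have "((\<lambda>t. cis (c * t)) has_vector_derivative c *\<^sub>R (\<i> * cis (c * t))) (at t)"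
      unfolding has_vector_derivative_def scaleR_scaleR by (simp only: mult.commute)
    then show "((\<lambda>t. of_real r * cis (c * t)) has_vector_derivative
        of_real r * (c *\<^sub>R (\<i> * cis (c * t)))) (at t)"
      by (rule has_vector_derivative_mult_right)
  qed (intro continuous_intros)
  ultimately show "?thesis r k" unfolding e by (intro conjI exI allI) simp_all
qed

section \<open>The energy functional\<close>

definition length_h1 :: "h1 \<Rightarrow> real" where
  "length_h1 u = sqrt (LINT t:{0..1}|lborel. (norm (h1_deriv u t))\<^sup>2)"

definition Q_field :: "(complex \<Rightarrow> real) \<Rightarrow> complex \<Rightarrow> complex" where
  "Q_field K z = (1 / 2) *\<^sub>R Complex (LBINT s=0..Re z. K (Complex s (Im z)))
                                   (LBINT s=0..Im z. K (Complex (Re z) s))"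

definition G_h1 :: "(complex \<Rightarrow> real) \<Rightarrow> h1 \<Rightarrow> real" where
  "G_h1 K u = (LINT t:{0..1}|lborel. Q_field K (h1_fun u t) \<bullet> (\<i> * h1_deriv u t))"

definition energy :: "(complex \<Rightarrow> real) \<Rightarrow> real \<Rightarrow> h1 \<Rightarrow> real" where
  "energy K lam u = length_h1 u + lam * G_h1 K u"

text \<open>The derivative of the functional is its Frechet derivative with respect to the \<open>H\<^sup>1\<close> norm;
  the constant maps, at which the functional need not be differentiable, are excluded.\<close>

definition critical_value_off_constants :: "(h1 \<Rightarrow> real) \<Rightarrow> real \<Rightarrow> bool" where
  "critical_value_off_constants E c \<longleftrightarrow>
     (\<exists>u. u \<notin> range h1_const \<and> E u = c \<and> (E has_derivative (\<lambda>h. 0)) (at u))"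

section \<open>The mountain pass level\<close>

definition mp_paths :: "h1 \<Rightarrow> (real \<Rightarrow> h1) set" where
  "mp_paths w = {\<gamma>. continuous_on {0..1} \<gamma> \<and> \<gamma> 0 = 0 \<and> \<gamma> 1 = w}"

text \<open>For the energy functionals, which are continuous, the inner supremum is a maximum.\<close>

definition mp_inf_max :: "(h1 \<Rightarrow> real) \<Rightarrow> h1 \<Rightarrow> real" where
  "mp_inf_max E w = (INF \<gamma>\<in>mp_paths w. SUP s\<in>{0..1}. E (\<gamma> s))"

definition admissible_pos :: "(complex \<Rightarrow> real) \<Rightarrow> real \<Rightarrow> real \<Rightarrow> real \<Rightarrow> real \<Rightarrow> real \<Rightarrow> bool" where
  "admissible_pos K K0 a b r0 R \<longleftrightarrow>
     r0 > 0 \<and> R > 0 \<and>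
     (\<forall>z lam. R \<le> norm z \<longrightarrow> lam \<in> {a..b} \<longrightarrow>
        length_h1 (h1_circle r0 K0 + h1_const z) > 2 * pi / (lam * (SUP x. \<bar>K x\<bar>)) \<and>
        energy K lam (h1_circle r0 K0 + h1_const z) < 0)"

text \<open>For a negative parameter interval, everything is read off from the curvature function
  \<open>-K\<close> (whose limit at infinity is \<open>-K0\<close>), the interval \<open>[-b, -a]\<close> and the parameter \<open>-lam\<close>.\<close>

definition admissible :: "(complex \<Rightarrow> real) \<Rightarrow> real \<Rightarrow> real \<Rightarrow> real \<Rightarrow> real \<Rightarrow> real \<Rightarrow> bool" where
  "admissible K K0 a b r0 R \<longleftrightarrow>
     (if 0 < a then admissible_pos K K0 a b r0 R
      else admissible_pos (\<lambda>x. - K x) (- K0) (- b) (- a) r0 R)"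

definition mp_level :: "(complex \<Rightarrow> real) \<Rightarrow> real \<Rightarrow> real \<Rightarrow> complex \<Rightarrow> real \<Rightarrow> real" where
  "mp_level K K0 r0 z0 lam =
     (if 0 < lam then mp_inf_max (energy K lam) (h1_circle r0 K0 + h1_const z0)
      else mp_inf_max (energy (\<lambda>x. - K x) (- lam)) (h1_circle r0 (- K0) + h1_const z0))"

section \<open>Loops of prescribed curvature\<close>

definition F_loop :: "(complex \<Rightarrow> real) \<Rightarrow> complex set \<Rightarrow> bool" where
  "F_loop F C \<longleftrightarrow>
     (\<exists>u u' u'' T. 0 < T \<and> (\<forall>t. u (t + T) = u t) \<and>
        (\<forall>t. (u has_vector_derivative u' t) (at t)) \<and>
        (\<forall>t. (u' has_vector_derivative u'' t) (at t)) \<and>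
        continuous_on UNIV u'' \<and>
        (\<forall>t. u' t \<noteq> 0 \<and> (u'' t \<bullet> (\<i> * u' t)) / norm (u' t) ^ 3 = F (u t)) \<and>
        C = range u)"

end

theory Submission
  imports Defs "HOL-Complex_Analysis.Great_Picard"
begin

text \<open>
  The energy is the same for \<open>(K, \<lambda>)\<close> and \<open>(-K, -\<lambda>)\<close>, so let \<open>\<lambda> > 0\<close>.

  The bound \<open>c\<^sub>\<lambda> \<le> \<pi> / (\<lambda> \<bar>K\<^sub>0\<bar>)\<close> comes from a path that moves a constant map far away, blows it up to a
  circle of radius \<open>r\<^sub>0\<close> and carries this circle back to its place. Far away \<open>K\<close> is nearly \<open>K\<^sub>0\<close>, and for
  the constant curvature function \<open>K\<^sub>0\<close> a circle of radius \<open>r\<close> has energy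
  \<open>2 \<pi> r - \<lambda> \<pi> \<bar>K\<^sub>0\<bar> r\<^sup>2 \<le> \<pi> / (\<lambda> \<bar>K\<^sub>0\<bar>)\<close> (lemma \<open>mp_level_le_circle_level\<close>).

  Below this level, critical points are found by Struwe's monotonicity trick. The quotient \<open>c\<^sub>\<lambda> / \<lambda>\<close> is
  antitone, because \<open>E\<^sub>\<lambda>(u) / \<lambda> = L(u) / \<lambda> + G(u)\<close> is antitone in \<open>\<lambda>\<close> for each \<open>u\<close>. By Fatou's lemma the
  difference quotients of \<open>c\<^sub>\<lambda> / \<lambda>\<close> to the left of almost every \<open>\<lambda>\<close> have a bounded subsequence (lemma
  \<open>antimono_difference_quotients\<close>). At such \<open>\<lambda>\<close>, a path that is nearly optimal for a slightly smaller
  parameter is nearly optimal for \<open>\<lambda>\<close>, and its points of nearly maximal energy have bounded length. If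
  the gradient were bounded away from zero at maps of bounded length and energy near \<open>c\<^sub>\<lambda>\<close>, one step
  along the gradient would push the path below \<open>c\<^sub>\<lambda>\<close>; a single step suffices because the gradient
  is uniformly continuous there. This gives a Palais-Smale sequence of bounded length (lemma
  \<open>bounded_palais_smale_sequence\<close>).

  A subsequence converges, up to translations of the plane, because the gradient is a multiple of
  the centred map plus a compact term (lemma \<open>h1_riesz_compact\<close>). If the translations stay bounded, the limit
  is a critical point. If they run off to infinity, the limit is a critical point for the constant
  curvature \<open>K\<^sub>0\<close>, that is, a circle run through finitely many times; its energy is
  at least \<open>\<pi> / (\<lambda> \<bar>K\<^sub>0\<bar>)\<close>, against the assumption on \<open>c\<^sub>\<lambda>\<close> (lemma \<open>palais_smale\<close>). Critical points satisfy
  \<open>u'' = L \<lambda> K(u) i u'\<close> with \<open>\<bar>u'\<bar> = L\<close>, and so are loops of curvature \<open>\<lambda> K\<close>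
  (lemma \<open>critical_point_F_loop\<close>).

  As \<open>K\<close> is only continuous, the field \<open>Q\<close> need not be differentiable. The differentiability of the
  area functional \<open>G\<close> is proved for polynomial curvature functions, where it reduces to the calculus of
  bounded bilinear maps on the algebra \<open>H\<^sup>1\<close>, and carried over by uniform approximation
  (lemma \<open>G_h1_increment\<close>).
\<close>

section \<open>Square-integrable maps on the unit interval\<close>

abbreviation I01 :: "(real \<Rightarrow> 'a::{banach,second_countable_topology}) \<Rightarrow> 'a" where
  "I01 f \<equiv> LINT t:{0..1}|lborel. f t"

abbreviation int01 :: "(real \<Rightarrow> 'a::{banach,second_countable_topology}) \<Rightarrow> bool" where
  "int01 f \<equiv> set_integrable lborel {0..1} f"

definition sq_int :: "(real \<Rightarrow> complex) \<Rightarrow> bool" where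
  "sq_int v \<longleftrightarrow> v \<in> borel_measurable borel \<and> int01 (\<lambda>t. (norm (v t))\<^sup>2)"

definition L2n :: "(real \<Rightarrow> complex) \<Rightarrow> real" where
  "L2n v = sqrt (I01 (\<lambda>t. (norm (v t))\<^sup>2))"

lemma sq_int_measurable [measurable_dest]: "sq_int v \<Longrightarrow> v \<in> borel_measurable borel"
  by (simp add: sq_int_def)

lemma l2_deriv_sq_int: "l2_deriv u v \<Longrightarrow> sq_int v"
  by (simp add: sq_int_def l2_deriv_def)

lemma I01_nonneg:
  fixes f :: "real \<Rightarrow> real"
  assumes "\<And>t. t \<in> {0..1} \<Longrightarrow> 0 \<le> f t" shows "0 \<le> I01 f"
  unfolding set_lebesgue_integral_def
  by (rule Bochner_Integration.integral_nonneg) (use assms in \<open>auto simp: indicator_def\<close>)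

lemma L2n_nonneg [simp]: "0 \<le> L2n v"
  unfolding L2n_def by (auto intro!: I01_nonneg)

lemma L2n_sq: "(L2n v)\<^sup>2 = I01 (\<lambda>t. (norm (v t))\<^sup>2)"
  unfolding L2n_def by (rule real_sqrt_pow2) (auto intro!: I01_nonneg)

lemma I01_mono:
  fixes f g :: "real \<Rightarrow> real"
  assumes "int01 f" "int01 g" "\<And>t. t \<in> {0..1} \<Longrightarrow> f t \<le> g t"
  shows "I01 f \<le> I01 g"
  by (rule set_integral_mono) (use assms in auto)

lemma I01_norm_le:
  assumes "int01 f" "int01 g" "\<And>t. t \<in> {0..1} \<Longrightarrow> norm (f t) \<le> g t"
  shows "norm (I01 f) \<le> I01 g"
proof -
  have "norm (I01 f) \<le> I01 (\<lambda>t. norm (f t))"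
    using assms(1) by (rule set_integral_norm_bound)
  also have "\<dots> \<le> I01 g"
    using assms by (intro I01_mono set_integrable_norm) auto
  finally show ?thesis .
qed

lemma I01_const [simp]: "I01 (\<lambda>_. c) = c"
  by (simp add: set_lebesgue_integral_def)

lemma int01_const [simp]: "int01 (\<lambda>_. c)"
  by (rule borel_integrable_atLeastAtMost') simp

lemma int01_bound:
  assumes "int01 g" "f \<in> borel_measurable borel" "\<And>t. t \<in> {0..1} \<Longrightarrow> norm (f t) \<le> g t"
  shows "int01 f"
  using assms(1) unfolding set_integrable_def
proof (rule Bochner_Integration.integrable_bound)
  show "(\<lambda>t. indicat_real {0..1} t *\<^sub>R f t) \<in> borel_measurable lborel"
    using assms(2) by measurable
  show "AE t in lborel. norm (indicat_real {0..1} t *\<^sub>R f t) \<le> norm (indicat_real {0..1} t *\<^sub>R g t)"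
  proof (rule AE_I2)
    fix t
    show "norm (indicat_real {0..1} t *\<^sub>R f t) \<le> norm (indicat_real {0..1} t *\<^sub>R g t)"
    proof (cases "t \<in> {0..1}")
      case True
      from assms(3)[OF this] abs_ge_self[of "g t"] True show ?thesis by simp
    qed simp
  qed
qed

lemma norm_mult_le_squares:
  fixes a b :: complex shows "norm a * norm b \<le> (norm a)\<^sup>2 + (norm b)\<^sup>2"
  using sum_squares_bound[of "norm a" "norm b"]
    mult_nonneg_nonneg[OF norm_ge_zero[of a] norm_ge_zero[of b]] by linarith

lemma sq_int_product_int01:
  assumes "sq_int v" "sq_int w" shows "int01 (\<lambda>t. norm (v t) * norm (w t))"
proof -
  note [measurable] = sq_int_measurable[OF assms(1)] sq_int_measurable[OF assms(2)]
  show ?thesis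
    by (rule int01_bound[where g = "\<lambda>t. (norm (v t))\<^sup>2 + (norm (w t))\<^sup>2"])
      (use assms in \<open>auto simp: sq_int_def norm_mult_le_squares intro!: set_integral_add(1)\<close>)
qed

lemma sq_int_inner_int01:
  assumes "sq_int v" "sq_int w" shows "int01 (\<lambda>t. v t \<bullet> w t)"
proof -
  note [measurable] = sq_int_measurable[OF assms(1)] sq_int_measurable[OF assms(2)]
  show ?thesis
    by (rule int01_bound[OF sq_int_product_int01[OF assms]]) (auto simp: Cauchy_Schwarz_ineq2)
qed

lemma sq_int_mult_int01:
  assumes "sq_int v" "sq_int w" shows "int01 (\<lambda>t. v t * w t)"
proof -
  note [measurable] = sq_int_measurable[OF assms(1)] sq_int_measurable[OF assms(2)]
  show ?thesis
    by (rule int01_bound[OF sq_int_product_int01[OF assms]]) (auto simp: norm_mult)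
qed

lemma sq_int_bounded:
  assumes "v \<in> borel_measurable borel" "\<And>t. t \<in> {0..1} \<Longrightarrow> norm (v t) \<le> C"
  shows "sq_int v"
proof -
  note [measurable] = assms(1)
  have "int01 (\<lambda>t. (norm (v t))\<^sup>2)"
    by (rule int01_bound[where g = "\<lambda>_. C\<^sup>2"]) (use assms(2) in \<open>auto intro!: power_mono\<close>)
  then show ?thesis using assms(1) by (simp add: sq_int_def)
qed

lemma sq_int_one: "sq_int (\<lambda>_. 1)"
  by (rule sq_int_bounded[of _ 1]) simp_all

lemma sq_int_int01: assumes "sq_int v" shows "int01 v"
  using sq_int_mult_int01[OF assms sq_int_one] by simp

lemma sq_int_mult_bounded:
  assumes "sq_int v" "f \<in> borel_measurable borel" "\<And>t. t \<in> {0..1} \<Longrightarrow> norm (f t :: complex) \<le> C"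
  shows "sq_int (\<lambda>t. f t * v t)"
proof -
  note [measurable] = sq_int_measurable[OF assms(1)] assms(2)
  have "int01 (\<lambda>t. (norm (f t * v t))\<^sup>2)"
  proof (rule int01_bound[where g = "\<lambda>t. C\<^sup>2 * (norm (v t))\<^sup>2"])
    show "int01 (\<lambda>t. C\<^sup>2 * (norm (v t))\<^sup>2)"
      using assms(1) by (auto simp: sq_int_def)
    show "norm ((norm (f t * v t))\<^sup>2) \<le> C\<^sup>2 * (norm (v t))\<^sup>2" if "t \<in> {0..1}" for t
      using assms(3)[OF that] by (auto simp: norm_mult power_mult_distrib intro!: mult_right_mono power_mono)
  qed measurable
  then show ?thesis by (auto simp: sq_int_def)
qed

lemma sq_int_add:
  assumes "sq_int v" "sq_int w" shows "sq_int (\<lambda>t. v t + w t)"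
proof -
  note [measurable] = sq_int_measurable[OF assms(1)] sq_int_measurable[OF assms(2)]
  have "int01 (\<lambda>t. ((norm (v t))\<^sup>2 + (norm (w t))\<^sup>2) + 2 * (v t \<bullet> w t))"
    using assms sq_int_inner_int01[OF assms]
    by (intro set_integral_add(1) set_integrable_mult_right) (auto simp: sq_int_def)
  moreover have "(norm (v t + w t))\<^sup>2 = ((norm (v t))\<^sup>2 + (norm (w t))\<^sup>2) + 2 * (v t \<bullet> w t)" for t
    by (simp add: power2_norm_eq_inner inner_add_left inner_add_right inner_commute)
  ultimately show ?thesis by (auto simp: sq_int_def)
qed

lemma sq_int_cmult:
  assumes "sq_int v" shows "sq_int (\<lambda>t. c * v t)"
  by (rule sq_int_mult_bounded[OF assms, of _ "norm c"]) auto

lemma sq_int_diff: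
  assumes "sq_int v" "sq_int w" shows "sq_int (\<lambda>t. v t - w t)"
  using sq_int_add[OF assms(1) sq_int_cmult[OF assms(2), of "-1"]] by simp

lemma sq_int_linear:
  fixes T :: "complex \<Rightarrow> complex"
  assumes T: "bounded_linear T" and v: "sq_int v" shows "sq_int (\<lambda>t. T (v t))"
proof -
  interpret bounded_linear T by fact
  obtain C where C: "\<And>x. norm (T x) \<le> norm x * C" using nonneg_bounded by blast
  note [measurable] = sq_int_measurable[OF v] borel_measurable_continuous_onI[OF continuous_on[OF continuous_on_id]]
  have "int01 (\<lambda>t. (norm (T (v t)))\<^sup>2)"
  proof (rule int01_bound[where g = "\<lambda>t. C\<^sup>2 * (norm (v t))\<^sup>2"])
    show "int01 (\<lambda>t. C\<^sup>2 * (norm (v t))\<^sup>2)" using v by (simp add: sq_int_def)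
    show "norm ((norm (T (v t)))\<^sup>2) \<le> C\<^sup>2 * (norm (v t))\<^sup>2" for t
      using power_mono[OF C[of "v t"] norm_ge_zero, of 2] by (simp add: power_mult_distrib mult.commute)
  qed measurable
  moreover have "(\<lambda>t. T (v t)) \<in> borel_measurable borel" by measurable
  ultimately show ?thesis by (simp add: sq_int_def)
qed

lemma L2_Cauchy_Schwarz:
  assumes "sq_int v" "sq_int w"
  shows "I01 (\<lambda>t. norm (v t) * norm (w t)) \<le> L2n v * L2n w"
proof -
  define p where "p = I01 (\<lambda>t. norm (v t) * norm (w t))"
  have i: "int01 (\<lambda>t. (norm (v t))\<^sup>2)" "int01 (\<lambda>t. (norm (w t))\<^sup>2)"
    "int01 (\<lambda>t. norm (v t) * norm (w t))"
    using assms sq_int_product_int01 by (auto simp: sq_int_def)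
  have q: "0 \<le> x\<^sup>2 * (L2n v)\<^sup>2 - 2 * x * y * p + y\<^sup>2 * (L2n w)\<^sup>2" for x y
  proof -
    have "0 \<le> I01 (\<lambda>t. (x * norm (v t) - y * norm (w t))\<^sup>2)"
      by (rule I01_nonneg) simp
    also have "(\<lambda>t. (x * norm (v t) - y * norm (w t))\<^sup>2) =
      (\<lambda>t. (x\<^sup>2 * (norm (v t))\<^sup>2 - (2*x*y) * (norm (v t) * norm (w t))) + y\<^sup>2 * (norm (w t))\<^sup>2)"
      by (auto simp: fun_eq_iff power2_eq_square algebra_simps)
    also have "I01 \<dots> = I01 (\<lambda>t. x\<^sup>2 * (norm (v t))\<^sup>2 - (2*x*y) * (norm (v t) * norm (w t)))
        + I01 (\<lambda>t. y\<^sup>2 * (norm (w t))\<^sup>2)"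
      by (intro set_integral_add(2) set_integral_diff(1) set_integrable_mult_right i)
    also have "I01 (\<lambda>t. x\<^sup>2 * (norm (v t))\<^sup>2 - (2*x*y) * (norm (v t) * norm (w t))) =
        I01 (\<lambda>t. x\<^sup>2 * (norm (v t))\<^sup>2) - I01 (\<lambda>t. (2*x*y) * (norm (v t) * norm (w t)))"
      by (intro set_integral_diff(2) set_integrable_mult_right i)
    finally have "0 \<le> x\<^sup>2 * (L2n v)\<^sup>2 - 2 * x * y * p + y\<^sup>2 * (L2n w)\<^sup>2"
      unfolding set_integral_mult_right L2n_sq p_def .
    then show ?thesis .
  qed
  have p0: "0 \<le> p" unfolding p_def by (rule I01_nonneg) simp
  show ?thesis
  proof (cases "L2n v = 0 \<or> L2n w = 0")
    case True
    then show ?thesis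
    proof
      assume z: "L2n v = 0"
      show ?thesis
      proof (rule ccontr)
        assume "\<not> ?thesis"
        then have "p > 0" using z by (simp add: p_def)
        have "0 \<le> (L2n w)\<^sup>2 - 2 * ((1 + (L2n w)\<^sup>2) / p) * p"
          using q[of "(1 + (L2n w)\<^sup>2) / p" 1] z by simp
        also have "\<dots> = (L2n w)\<^sup>2 - 2 * (1 + (L2n w)\<^sup>2)" using \<open>p > 0\<close> by simp
        finally show False using zero_le_power2[of "L2n w"] by (simp add: algebra_simps)
      qed
    next
      assume z: "L2n w = 0"
      show ?thesis
      proof (rule ccontr)
        assume "\<not> ?thesis"
        then have "p > 0" using z by (simp add: p_def)
        have "0 \<le> (L2n v)\<^sup>2 - 2 * ((1 + (L2n v)\<^sup>2) / p) * p"
          using q[of 1 "(1 + (L2n v)\<^sup>2) / p"] z by simp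
        also have "\<dots> = (L2n v)\<^sup>2 - 2 * (1 + (L2n v)\<^sup>2)" using \<open>p > 0\<close> by simp
        finally show False using zero_le_power2[of "L2n v"] by (simp add: algebra_simps)
      qed
    qed
  next
    case False
    then have pos: "L2n v > 0" "L2n w > 0" using L2n_nonneg by (metis less_eq_real_def)+
    \<comment> \<open>the arguments at which nonnegativity of the quadratic form becomes the claim\<close>
    from q[of "L2n w" "L2n v"] have "0 \<le> 2 * ((L2n v * L2n w) * (L2n v * L2n w - p))"
      by (simp add: power2_eq_square algebra_simps)
    moreover have "0 < L2n v * L2n w" using pos by simp
    ultimately have "p \<le> L2n v * L2n w" by (auto simp: zero_le_mult_iff)
    then show ?thesis by (simp add: p_def)
  qed
qed

lemma L2_Cauchy_Schwarz_inner:
  assumes "sq_int v" "sq_int w" shows "\<bar>I01 (\<lambda>t. v t \<bullet> w t)\<bar> \<le> L2n v * L2n w"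
proof -
  have "norm (I01 (\<lambda>t. v t \<bullet> w t)) \<le> I01 (\<lambda>t. norm (v t) * norm (w t))"
    using assms by (intro I01_norm_le sq_int_inner_int01 sq_int_product_int01) (auto simp: Cauchy_Schwarz_ineq2)
  then show ?thesis using L2_Cauchy_Schwarz[OF assms] by simp
qed

lemma L1_le_L2n:
  assumes "sq_int v" shows "I01 (\<lambda>t. norm (v t)) \<le> L2n v"
proof -
  have "L2n (\<lambda>_. 1) = 1" by (simp add: L2n_def)
  then show ?thesis using L2_Cauchy_Schwarz[OF assms sq_int_one] by simp
qed

lemma L2n_le_bound:
  assumes "sq_int v" "0 \<le> C" "\<And>t. t \<in> {0..1} \<Longrightarrow> norm (v t) \<le> C"
  shows "L2n v \<le> C"
proof -
  have "I01 (\<lambda>t. (norm (v t))\<^sup>2) \<le> I01 (\<lambda>_. C\<^sup>2)"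
    using assms by (intro I01_mono) (auto simp: sq_int_def intro!: power_mono)
  then have "(L2n v)\<^sup>2 \<le> C\<^sup>2" by (simp add: L2n_sq)
  then show ?thesis using assms(2) by (rule power2_le_imp_le)
qed

lemma I01_cong_AE:
  assumes "f \<in> borel_measurable borel" "g \<in> borel_measurable borel"
    "AE t\<in>{0..1} in lborel. f t = g t"
  shows "I01 f = I01 g"
  by (rule set_lebesgue_integral_cong_AE) (use assms in auto)

lemma I01_cong: "(\<And>t. t \<in> {0..1} \<Longrightarrow> f t = g t) \<Longrightarrow> I01 f = I01 g"
  by (rule set_lebesgue_integral_cong) auto

section \<open>Products of primitives\<close>

text \<open>The factors are only primitives of integrable maps, so that pointwise differentiation is not an
  argument. Instead, the product of the increments of \<open>u\<close> and \<open>w\<close> is the integral of \<open>v(s) z(r)\<close> over a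
  square; the diagonal cuts the square into two triangles, and Fubini's theorem turns these into the
  two terms of the rule.\<close>

lemma product_of_primitives:
  fixes u w v z :: "real \<Rightarrow> complex"
  assumes v: "int01 v" "v \<in> borel_measurable borel" and z: "int01 z" "z \<in> borel_measurable borel"
    and u: "\<And>t. t \<in> {0..1} \<Longrightarrow> u t = u 0 + (LINT s:{0..t}|lborel. v s)"
    and w: "\<And>t. t \<in> {0..1} \<Longrightarrow> w t = w 0 + (LINT s:{0..t}|lborel. z s)"
    and t: "t \<in> {0..1}" and uw: "int01 (\<lambda>s. v s * w s)" "int01 (\<lambda>s. u s * z s)"
  shows "u t * w t = u 0 * w 0 + (LINT s:{0..t}|lborel. v s * w s + u s * z s)"
proof -
  note [measurable] = v(2) z(2)
  define V where "V = (\<lambda>s. indicat_real {0..t} s *\<^sub>R v s)"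
  define Z where "Z = (\<lambda>s. indicat_real {0..t} s *\<^sub>R z s)"
  have sub: "set_integrable lborel {0..t} f" if "int01 f" for f :: "real \<Rightarrow> complex"
    by (rule set_integrable_subset[OF that]) (use t in auto)
  have V: "integrable lborel V" and Z: "integrable lborel Z"
    using sub[OF v(1)] sub[OF z(1)] by (simp_all add: V_def Z_def set_integrable_def)
  have [measurable]: "V \<in> borel_measurable borel" "Z \<in> borel_measurable borel"
    by (simp_all add: V_def Z_def)
  have VZ: "integrable (lborel \<Otimes>\<^sub>M lborel) (\<lambda>(s, r). V s * Z r)"
  proof (rule lborel_pair.Fubini_integrable)
    show "integrable lborel (\<lambda>x. \<integral> y. norm (case (x, y) of (s, r) \<Rightarrow> V s * Z r) \<partial>lborel)"
      using V by (simp add: norm_mult)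
    show "AE x in lborel. integrable lborel (\<lambda>y. case (x, y) of (s, r) \<Rightarrow> V s * Z r)"
      using Z by simp
  qed measurable
  \<comment> \<open>the product on one of the two triangles; the diagonal belongs to the other one\<close>
  define P where "P = (\<lambda>s r. if s < r then V s * Z r else 0)"
  have P: "integrable (lborel \<Otimes>\<^sub>M lborel) (case_prod P)"
    by (rule Bochner_Integration.integrable_bound[OF VZ]) (auto simp: P_def)
  have sw: "(\<integral>r. (\<integral>s. P s r \<partial>lborel) \<partial>lborel) = (\<integral>s. (\<integral>r. P s r \<partial>lborel) \<partial>lborel)"
    by (rule lborel_pair.Fubini_integral[OF P])
  have wint: "V s * w s = V s * w 0 + (\<integral>r. (if r \<le> s then V s * Z r else 0) \<partial>lborel)" for s
  proof (cases "s \<in> {0..t}")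
    case True
    then have "w s = w 0 + (LINT r:{0..s}|lborel. z r)" using t by (intro w) auto
    also have "(LINT r:{0..s}|lborel. z r) = (\<integral>r. (if r \<le> s then Z r else 0) \<partial>lborel)"
      unfolding set_lebesgue_integral_def using True
      by (intro Bochner_Integration.integral_cong) (auto simp: Z_def indicator_def)
    finally have "V s * w s = V s * w 0 + V s * (\<integral>r. (if r \<le> s then Z r else 0) \<partial>lborel)"
      by (simp add: distrib_left)
    also have "V s * (\<integral>r. (if r \<le> s then Z r else 0) \<partial>lborel) =
        (\<integral>r. V s * (if r \<le> s then Z r else 0) \<partial>lborel)" by simp
    also have "\<dots> = (\<integral>r. (if r \<le> s then V s * Z r else 0) \<partial>lborel)"
      by (intro Bochner_Integration.integral_cong) auto
    finally show ?thesis .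
  next
    case False
    then have "V s = 0" by (auto simp: V_def)
    then show ?thesis by (simp cong: if_cong)
  qed
  have uint: "u s * Z s = u 0 * Z s + (\<integral>r. P r s \<partial>lborel)" for s
  proof (cases "s \<in> {0..t}")
    case True
    then have "u s = u 0 + (LINT r:{0..s}|lborel. v r)" using t by (intro u) auto
    also have "(LINT r:{0..s}|lborel. v r) = (\<integral>r. (if r < s then V r else 0) \<partial>lborel)"
      unfolding set_lebesgue_integral_def
    proof (rule integral_cong_AE)
      have "AE r in lborel. r \<noteq> s" by (rule AE_lborel_singleton)
      then show "AE r in lborel. indicat_real {0..s} r *\<^sub>R v r = (if r < s then V r else 0)"
        by eventually_elim (use True in \<open>auto simp: V_def indicator_def\<close>)
    qed auto
    finally have "u s * Z s = u 0 * Z s + (\<integral>r. (if r < s then V r else 0) \<partial>lborel) * Z s"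
      by (simp add: distrib_right)
    also have "(\<integral>r. (if r < s then V r else 0) \<partial>lborel) * Z s =
        (\<integral>r. (if r < s then V r else 0) * Z s \<partial>lborel)" by simp
    also have "\<dots> = (\<integral>r. P r s \<partial>lborel)"
      by (intro Bochner_Integration.integral_cong) (auto simp: P_def)
    finally show ?thesis .
  next
    case False
    then have "Z s = 0" by (auto simp: Z_def)
    then show ?thesis by (simp add: P_def cong: if_cong)
  qed
  have I1: "(LINT s:{0..t}|lborel. v s * w s) = (\<integral>s. V s * w s \<partial>lborel)"
    and I2: "(LINT s:{0..t}|lborel. u s * z s) = (\<integral>s. u s * Z s \<partial>lborel)"
    unfolding set_lebesgue_integral_def V_def Z_def by simp_all
  have i1: "integrable lborel (\<lambda>s. V s * w s)" and i2: "integrable lborel (\<lambda>s. u s * Z s)"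
    using sub[OF uw(1)] sub[OF uw(2)] by (simp_all add: V_def Z_def set_integrable_def)
  have j1: "integrable lborel (\<lambda>s. (\<integral>r. (if r \<le> s then V s * Z r else 0) \<partial>lborel))"
    using Bochner_Integration.integrable_diff[OF i1 integrable_mult_left[OF V, of "w 0"]]
    by (simp add: wint)
  have j2: "integrable lborel (\<lambda>s. (\<integral>r. P r s \<partial>lborel))"
    using Bochner_Integration.integrable_diff[OF i2 integrable_mult_right[OF Z, of "u 0"]]
    by (simp add: uint)
  have j3: "integrable lborel (\<lambda>s. (\<integral>r. P s r \<partial>lborel))"
    by (rule lborel_pair.integrable_fst[OF P])
  have k: "(\<integral>r. (if r \<le> s then V s * Z r else 0) \<partial>lborel) + (\<integral>r. P s r \<partial>lborel)
     = V s * (\<integral>r. Z r \<partial>lborel)" for s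
  proof -
    have a: "integrable lborel (\<lambda>r. V s * Z r)" using Z by simp
    have b: "integrable lborel (\<lambda>r. if r \<le> s then V s * Z r else 0)" "integrable lborel (\<lambda>r. P s r)"
      by (rule Bochner_Integration.integrable_bound[OF a], auto simp: P_def)+
    have "(\<integral>r. (if r \<le> s then V s * Z r else 0) \<partial>lborel) + (\<integral>r. P s r \<partial>lborel) =
      (\<integral>r. (if r \<le> s then V s * Z r else 0) + P s r \<partial>lborel)"
      using b by simp
    also have "\<dots> = (\<integral>r. V s * Z r \<partial>lborel)"
      by (intro Bochner_Integration.integral_cong) (auto simp: P_def)
    finally show ?thesis by simp
  qed
  have uv: "(LINT s:{0..t}|lborel. v s) = (\<integral>s. V s \<partial>lborel)" "(LINT s:{0..t}|lborel. z s) = (\<integral>s. Z s \<partial>lborel)"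
    by (simp_all add: set_lebesgue_integral_def V_def Z_def)
  have "(LINT s:{0..t}|lborel. v s * w s + u s * z s) = (\<integral>s. V s * w s \<partial>lborel) + (\<integral>s. u s * Z s \<partial>lborel)"
    using sub uw by (subst set_integral_add(2)) (auto simp: I1 I2)
  also have "(\<integral>s. V s * w s \<partial>lborel) = (\<integral>s. V s \<partial>lborel) * w 0 + (\<integral>s. (\<integral>r. (if r \<le> s then V s * Z r else 0) \<partial>lborel) \<partial>lborel)"
    unfolding wint using V j1 by simp
  also have "(\<integral>s. u s * Z s \<partial>lborel) = u 0 * (\<integral>s. Z s \<partial>lborel) + (\<integral>s. (\<integral>r. P r s \<partial>lborel) \<partial>lborel)"
    unfolding uint using Z j2 by simp
  also have "(\<integral>s. (\<integral>r. P r s \<partial>lborel) \<partial>lborel) = (\<integral>s. (\<integral>r. P s r \<partial>lborel) \<partial>lborel)"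
    by (rule sw)
  finally have "(LINT s:{0..t}|lborel. v s * w s + u s * z s) =
     (\<integral>s. V s \<partial>lborel) * w 0 + u 0 * (\<integral>s. Z s \<partial>lborel) +
     ((\<integral>s. (\<integral>r. (if r \<le> s then V s * Z r else 0) \<partial>lborel) \<partial>lborel) + (\<integral>s. (\<integral>r. P s r \<partial>lborel) \<partial>lborel))"
    by simp
  also have "((\<integral>s. (\<integral>r. (if r \<le> s then V s * Z r else 0) \<partial>lborel) \<partial>lborel) + (\<integral>s. (\<integral>r. P s r \<partial>lborel) \<partial>lborel))
     = (\<integral>s. V s * (\<integral>r. Z r \<partial>lborel) \<partial>lborel)"
    using j1 j3 by (subst Bochner_Integration.integral_add[symmetric]) (auto simp: k)
  also have "\<dots> = (\<integral>s. V s \<partial>lborel) * (\<integral>r. Z r \<partial>lborel)" using V by simp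
  finally have e: "(LINT s:{0..t}|lborel. v s * w s + u s * z s) =
     (\<integral>s. V s \<partial>lborel) * w 0 + u 0 * (\<integral>s. Z s \<partial>lborel) + (\<integral>s. V s \<partial>lborel) * (\<integral>r. Z r \<partial>lborel)" .
  show ?thesis unfolding u[OF t] w[OF t] e uv by (simp add: algebra_simps)
qed

section \<open>Geometry of the Sobolev space\<close>

lemma h1_fun_frac: "h1_fun u t = h1_fun u (frac t)"
  by (rule periodic_floor) (rule h1_periodic)

lemma h1_sq_int [simp]: "sq_int (h1_deriv u)"
  by (rule l2_deriv_sq_int[OF h1_deriv])

lemma h1_deriv_measurable [measurable]: "h1_deriv u \<in> borel_measurable borel"
  by (rule sq_int_measurable[OF h1_sq_int])

lemma h1_continuous: "continuous_on {0..1} (h1_fun u)"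
  by (rule l2_deriv_continuous_on[OF h1_deriv])

lemma h1_fun_measurable [measurable]: "h1_fun u \<in> borel_measurable borel"
proof -
  define f where "f t = indicat_real {0..1} t *\<^sub>R h1_fun u t" for t
  have [measurable]: "f \<in> borel_measurable borel"
    unfolding f_def by (rule borel_measurable_continuous_on_indicator[OF _ h1_continuous]) simp
  have "h1_fun u = (\<lambda>t. f (t - of_int \<lfloor>t\<rfloor>))"
  proof
    fix t show "h1_fun u t = f (t - of_int \<lfloor>t\<rfloor>)"
      using h1_fun_frac[of u t] frac_ge_0[of t] frac_lt_1[of t] by (simp add: f_def frac_def)
  qed
  also have "\<dots> \<in> borel_measurable borel" by measurable
  finally show ?thesis .
qed

lemma h1_eqI:
  assumes "\<And>t. t \<in> {0..1} \<Longrightarrow> h1_fun u t = h1_fun w t" shows "u = w"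
proof -
  have "h1_fun u t = h1_fun w t" for t
    using assms[of "frac t"] h1_fun_frac[of u t] h1_fun_frac[of w t] frac_ge_0[of t] frac_lt_1[of t] by auto
  then show ?thesis by (simp add: fun_eq_iff flip: h1_fun_inject)
qed

lemma h1_fun_add [simp]: "h1_fun (u + w) t = h1_fun u t + h1_fun w t"
  by (simp add: plus_h1.rep_eq)

lemma h1_fun_scaleR [simp]: "h1_fun (c *\<^sub>R u) t = c *\<^sub>R h1_fun u t"
  by (simp add: scaleR_h1.rep_eq)

lemma h1_fun_diff [simp]: "h1_fun (u - w) t = h1_fun u t - h1_fun w t"
  using h1_fun_add[of "u - w" w t] by (simp del: h1_fun_add)

lemma h1_fun_zero [simp]: "h1_fun 0 t = 0"
  by (simp add: zero_h1.rep_eq)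

lemma h1_fun_const [simp]: "h1_fun (h1_const z) t = z"
  by (simp add: h1_const.rep_eq)

lemma h1_fun_primitive:
  "t \<in> {0..1} \<Longrightarrow> h1_fun u t = h1_fun u 0 + (LINT s:{0..t}|lborel. h1_deriv u s)"
  using h1_deriv[of u] unfolding l2_deriv_def by blast

lemma h1_fun_1: "h1_fun u 1 = h1_fun u 0"
  using h1_periodic[of u 0] by simp

lemma h1_deriv_AE: "l2_deriv (h1_fun u) v \<Longrightarrow> AE t\<in>{0..1} in lborel. h1_deriv u t = v t"
  by (rule l2_deriv_unique[OF h1_deriv])

lemma h1_l2_deriv_add: "l2_deriv (h1_fun u) v \<Longrightarrow> l2_deriv (h1_fun w) v' \<Longrightarrow>
   l2_deriv (h1_fun (u + w)) (\<lambda>t. v t + v' t)"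
  using l2_deriv_add by (simp add: plus_h1.rep_eq)

lemma h1_l2_deriv_scaleR: "l2_deriv (h1_fun u) v \<Longrightarrow> l2_deriv (h1_fun (c *\<^sub>R u)) (\<lambda>t. c *\<^sub>R v t)"
  using l2_deriv_scaleR by (simp add: scaleR_h1.rep_eq)

lemma h1_l2_deriv_diff: "l2_deriv (h1_fun u) v \<Longrightarrow> l2_deriv (h1_fun w) v' \<Longrightarrow>
   l2_deriv (h1_fun (u - w)) (\<lambda>t. v t - v' t)"
  using h1_l2_deriv_add[of u v "(-1) *\<^sub>R w" "\<lambda>t. (-1) *\<^sub>R v' t"] h1_l2_deriv_scaleR[of w v' "-1"]
  by simp

lemma h1_deriv_diff: "AE t\<in>{0..1} in lborel. h1_deriv (u - w) t = h1_deriv u t - h1_deriv w t"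
  by (intro h1_deriv_AE h1_l2_deriv_diff h1_deriv)

lemma h1_deriv_const: "AE t\<in>{0..1} in lborel. h1_deriv (h1_const z) t = 0"
  by (intro h1_deriv_AE) (simp add: h1_const.rep_eq l2_deriv_const)

lemma I01_h1_deriv: "I01 (h1_deriv u) = 0"
  using h1_fun_primitive[of 1 u] h1_fun_1[of u] by simp

definition h1_mean :: "h1 \<Rightarrow> complex" where "h1_mean u = I01 (h1_fun u)"

lemma h1_mean_add [simp]: "h1_mean (u + w) = h1_mean u + h1_mean w"
  by (simp add: h1_mean_def set_integral_add(2)[OF h1_set_integrable h1_set_integrable])

lemma h1_mean_scaleR [simp]: "h1_mean (c *\<^sub>R u) = c *\<^sub>R h1_mean u"
  by (simp add: h1_mean_def)

lemma h1_mean_diff [simp]: "h1_mean (u - w) = h1_mean u - h1_mean w"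
  using h1_mean_add[of "u - w" w] by (simp del: h1_mean_add)

lemma h1_mean_const [simp]: "h1_mean (h1_const z) = z"
  by (simp add: h1_mean_def)

lemma h1_const_add: "h1_const (x + y) = h1_const x + h1_const y"
  by (rule h1_eqI) simp

lemma h1_const_diff: "h1_const (x - y) = h1_const x - h1_const y"
  by (rule h1_eqI) simp

lemma h1_const_scaleR: "h1_const (c *\<^sub>R x) = c *\<^sub>R h1_const x"
  by (rule h1_eqI) simp

lemma h1_const_0 [simp]: "h1_const 0 = 0"
  by (rule h1_eqI) simp

lemma length_h1_L2n: "length_h1 u = L2n (h1_deriv u)"
  by (simp add: length_h1_def L2n_def)

lemma length_h1_nonneg [simp]: "0 \<le> length_h1 u"
  by (simp add: length_h1_L2n)

lemma norm_h1_sq: "(norm (u :: h1))\<^sup>2 = (length_h1 u)\<^sup>2 + (norm (h1_mean u))\<^sup>2"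
  unfolding norm_h1_def length_h1_L2n L2n_sq h1_mean_def
  by (rule real_sqrt_pow2) (intro add_nonneg_nonneg I01_nonneg zero_le_power2)

lemma length_h1_eq_L2n:
  assumes "l2_deriv (h1_fun u) v" shows "length_h1 u = L2n v"
proof -
  note [measurable] = l2_deriv_measurable[OF assms]
  have "I01 (\<lambda>t. (norm (h1_deriv u t))\<^sup>2) = I01 (\<lambda>t. (norm (v t))\<^sup>2)"
    by (rule I01_cong_AE) (use h1_deriv_AE[OF assms] in auto)
  then show ?thesis by (simp add: length_h1_def L2n_def)
qed

lemma length_h1_const [simp]: "length_h1 (h1_const z) = 0"
proof -
  have "l2_deriv (h1_fun (h1_const z)) (\<lambda>_. 0)" by (simp add: h1_const.rep_eq l2_deriv_const)
  from length_h1_eq_L2n[OF this] show ?thesis by (simp add: L2n_def)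
qed

lemma length_h1_zero [simp]: "length_h1 0 = 0"
  using length_h1_const[of 0] by simp

lemma norm_h1_const [simp]: "norm (h1_const z) = norm z"
  using norm_h1_sq[of "h1_const z"] by simp

lemma length_le_norm: "length_h1 u \<le> norm u"
  by (rule power2_le_imp_le) (simp_all only: norm_h1_sq norm_ge_zero le_add_same_cancel1 zero_le_power2)

lemma mean_le_norm: "norm (h1_mean u) \<le> norm u"
  by (rule power2_le_imp_le) (simp_all only: norm_h1_sq norm_ge_zero le_add_same_cancel2 zero_le_power2)

text \<open>The orthogonal projection to the maps of mean zero. Its norm is the length functional, which is
  why the length is a seminorm.\<close>

definition h1_centre :: "h1 \<Rightarrow> h1" where "h1_centre u = u - h1_const (h1_mean u)"

lemma length_h1_add_const [simp]: "length_h1 (u + h1_const z) = length_h1 u"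
proof -
  have "l2_deriv (h1_fun (u + h1_const z)) (\<lambda>t. h1_deriv u t + 0)"
    by (intro h1_l2_deriv_add h1_deriv) (simp add: h1_const.rep_eq l2_deriv_const)
  from length_h1_eq_L2n[OF this] show ?thesis by (simp add: length_h1_L2n)
qed

lemma h1_mean_centre [simp]: "h1_mean (h1_centre u) = 0"
  by (simp add: h1_centre_def)

lemma length_h1_centre [simp]: "length_h1 (h1_centre u) = length_h1 u"
  using length_h1_add_const[of "u - h1_const (h1_mean u)" "h1_mean u"]
  by (simp add: h1_centre_def del: length_h1_add_const)

lemma norm_h1_centre [simp]: "norm (h1_centre u) = length_h1 u"
  using norm_h1_sq[of "h1_centre u"] by simp

lemma h1_centre_add: "h1_centre (u + w) = h1_centre u + h1_centre w"
  by (simp add: h1_centre_def h1_const_add)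

lemma h1_centre_diff: "h1_centre (u - w) = h1_centre u - h1_centre w"
  by (simp add: h1_centre_def h1_const_diff)

lemma h1_centre_scaleR: "h1_centre (c *\<^sub>R u) = c *\<^sub>R h1_centre u"
  by (simp add: h1_centre_def h1_const_scaleR scaleR_diff_right)

lemma h1_centre_const [simp]: "h1_centre (h1_const z) = 0"
  by (simp add: h1_centre_def)

lemma h1_centre_plus_mean: "u = h1_const (h1_mean u) + h1_centre u"
  by (simp add: h1_centre_def)

lemma length_h1_triangle: "length_h1 (u + w) \<le> length_h1 u + length_h1 w"
  unfolding norm_h1_centre[symmetric] h1_centre_add by (rule norm_triangle_ineq)

lemma length_h1_scaleR [simp]: "length_h1 (c *\<^sub>R u) = \<bar>c\<bar> * length_h1 u"
  unfolding norm_h1_centre[symmetric] h1_centre_scaleR by simp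

lemma length_h1_diff_le: "\<bar>length_h1 u - length_h1 w\<bar> \<le> length_h1 (u - w)"
  unfolding norm_h1_centre[symmetric] h1_centre_diff by (rule norm_triangle_ineq3)

lemma length_h1_lipschitz: "\<bar>length_h1 u - length_h1 w\<bar> \<le> norm (u - w)"
  using length_h1_diff_le[of u w] length_le_norm[of "u - w"] by linarith

lemma tendsto_length_h1 [tendsto_intros]:
  assumes "(f \<longlongrightarrow> u) F" shows "((\<lambda>x. length_h1 (f x)) \<longlongrightarrow> length_h1 u) F"
proof (rule metric_tendsto_imp_tendsto[OF assms])
  show "\<forall>\<^sub>F x in F. dist (length_h1 (f x)) (length_h1 u) \<le> dist (f x) u"
    by (intro always_eventually allI) (simp add: dist_norm length_h1_lipschitz)
qed

lemma tendsto_h1_mean [tendsto_intros]: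
  assumes "(f \<longlongrightarrow> u) F" shows "((\<lambda>x. h1_mean (f x)) \<longlongrightarrow> h1_mean u) F"
proof (rule metric_tendsto_imp_tendsto[OF assms])
  show "\<forall>\<^sub>F x in F. dist (h1_mean (f x)) (h1_mean u) \<le> dist (f x) u"
    using mean_le_norm[of "f x - u" for x] by (intro always_eventually allI) (simp add: dist_norm)
qed

lemma length_h1_eq_0: "length_h1 u = 0 \<longleftrightarrow> u \<in> range h1_const"
proof
  assume "length_h1 u = 0"
  then have "h1_centre u = 0" by (metis norm_h1_centre norm_eq_zero)
  then show "u \<in> range h1_const" using h1_centre_plus_mean[of u] by (metis add.right_neutral rangeI)
qed auto

lemma L2_interval_bound:
  assumes v: "sq_int v" and "0 \<le> s" "s \<le> t" "t \<le> 1"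
  shows "norm (LINT r:{s..t}|lborel. v r) \<le> sqrt (t - s) * L2n v"
proof -
  note [measurable] = sq_int_measurable[OF v]
  define J where "J = (\<lambda>r. complex_of_real (indicat_real {s..t} r))"
  have J: "sq_int J" by (rule sq_int_bounded[of _ 1]) (auto simp: J_def indicator_def)
  have "(LINT r:{s..t}|lborel. v r) = I01 (\<lambda>r. J r * v r)"
    unfolding set_lebesgue_integral_def
    by (rule Bochner_Integration.integral_cong) (use assms in \<open>auto simp: J_def indicator_def\<close>)
  also have "norm \<dots> \<le> I01 (\<lambda>r. norm (J r) * norm (v r))"
    by (intro I01_norm_le sq_int_mult_int01 sq_int_product_int01 J v) (simp add: norm_mult)
  also have "\<dots> \<le> L2n J * L2n v" by (rule L2_Cauchy_Schwarz[OF J v])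
  also have "L2n J = sqrt (t - s)"
  proof -
    have "I01 (\<lambda>r. (norm (J r))\<^sup>2) = (\<integral>r. indicat_real {s..t} r \<partial>lborel)"
      unfolding set_lebesgue_integral_def
      by (rule Bochner_Integration.integral_cong) (use assms in \<open>auto simp: J_def indicator_def\<close>)
    then show ?thesis using assms by (simp add: L2n_def)
  qed
  finally show ?thesis .
qed

lemma primitive_0: "sq_int v \<Longrightarrow> (LINT r:{0..0}|lborel. v r) = 0"
  using L2_interval_bound[of v 0 0] by simp

lemma primitive_difference:
  assumes v: "sq_int v" and "0 \<le> s" "s \<le> t" "t \<le> 1"
  shows "(LINT r:{0..t}|lborel. v r) - (LINT r:{0..s}|lborel. v r) = (LINT r:{s..t}|lborel. v r)"
proof -
  note [measurable] = sq_int_measurable[OF v]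
  have i: "set_integrable lborel A v" if "A \<subseteq> {0..1}" "A \<in> sets borel" for A
    by (rule set_integrable_subset[OF sq_int_int01[OF v]]) (use that in auto)
  have "{0..t} = {0..s} \<union> {s<..t}" using assms by auto
  then have "(LINT r:{0..t}|lborel. v r) = (LINT r:{0..s}|lborel. v r) + (LINT r:{s<..t}|lborel. v r)"
    using assms by (auto intro!: set_integral_Un i)
  moreover have "(LINT r:{s<..t}|lborel. v r) = (LINT r:{s..t}|lborel. v r)"
    unfolding set_lebesgue_integral_def
  proof (rule integral_cong_AE)
    have "AE r in lborel. r \<noteq> s" by (rule AE_lborel_singleton)
    then show "AE r in lborel. indicat_real {s<..t} r *\<^sub>R v r = indicat_real {s..t} r *\<^sub>R v r"
      by eventually_elim (auto simp: indicator_def)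
  qed auto
  ultimately show ?thesis by simp
qed

lemma h1_hoelder:
  assumes "s \<in> {0..1}" "t \<in> {0..1}"
  shows "norm (h1_fun u t - h1_fun u s) \<le> sqrt \<bar>t - s\<bar> * length_h1 u"
proof -
  have *: "norm (h1_fun u t - h1_fun u s) \<le> sqrt \<bar>t - s\<bar> * length_h1 u" if "0 \<le> s" "s \<le> t" "t \<le> 1" for s t
  proof -
    have "h1_fun u t - h1_fun u s = (LINT r:{s..t}|lborel. h1_deriv u r)"
      using that h1_fun_primitive[of t u] h1_fun_primitive[of s u]
        primitive_difference[OF h1_sq_int that, of u] by simp
    then show ?thesis using L2_interval_bound[OF h1_sq_int that, of u] that by (simp add: length_h1_L2n)
  qed
  show ?thesis
    using *[of s t] *[of t s] assms by (cases "s \<le> t") (auto simp: norm_minus_commute abs_minus_commute)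
qed

lemma h1_oscillation:
  assumes "s \<in> {0..1}" "t \<in> {0..1}" shows "norm (h1_fun u t - h1_fun u s) \<le> length_h1 u"
proof -
  have "sqrt \<bar>t - s\<bar> * length_h1 u \<le> 1 * length_h1 u"
    using assms by (intro mult_right_mono) (auto simp: abs_le_iff)
  then show ?thesis using h1_hoelder[OF assms, of u] by simp
qed

lemma h1_near_mean: "norm (h1_fun u t - h1_mean u) \<le> length_h1 u"
proof -
  have *: "norm (h1_fun u t - h1_mean u) \<le> length_h1 u" if "t \<in> {0..1}" for t
  proof -
    have "h1_fun u t - h1_mean u = I01 (\<lambda>s. h1_fun u t - h1_fun u s)"
      by (subst set_integral_diff(2)[OF int01_const h1_set_integrable]) (simp add: h1_mean_def)
    also have "norm \<dots> \<le> I01 (\<lambda>s. length_h1 u)"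
      using that by (intro I01_norm_le set_integral_diff(1) int01_const h1_set_integrable h1_oscillation)
    finally show ?thesis by simp
  qed
  have "frac t \<in> {0..1}" using frac_ge_0[of t] frac_lt_1[of t] by auto
  from *[OF this] show ?thesis by (simp add: h1_fun_frac[of u t])
qed

lemma h1_sup_norm: "norm (h1_fun u t) \<le> 2 * norm u"
  using h1_near_mean[of u t] norm_triangle_sub[of "h1_fun u t" "h1_mean u"]
    mean_le_norm[of u] length_le_norm[of u] by linarith

lemma h1_sup_norm_mean_zero: "h1_mean u = 0 \<Longrightarrow> norm (h1_fun u t) \<le> length_h1 u"
  using h1_near_mean[of u t] by simp

lemma h1_fun_sq_int [simp]: "sq_int (h1_fun u)"
  by (rule sq_int_bounded[OF h1_fun_measurable h1_sup_norm])

text \<open>Elements of \<open>H\<^sup>1\<close> are built by prescribing the derivative and the mean.\<close>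

lemma h1_exists_primitive:
  assumes v: "sq_int v" and z: "I01 v = 0"
  obtains g where "l2_deriv (h1_fun g) v" "h1_mean g = m"
    "\<And>t. t \<in> {0..1} \<Longrightarrow> h1_fun g t = h1_fun g 0 + (LINT s:{0..t}|lborel. v s)"
proof -
  define f where "f t = (LINT s:{0..frac t}|lborel. v s)" for t
  have f: "f t = (LINT s:{0..t}|lborel. v s)" if "t \<in> {0..1}" for t
  proof (cases "t = 1")
    case True
    then show ?thesis unfolding f_def using z primitive_0[OF v] by simp
  next
    case False
    then have "frac t = t" using that by (simp add: frac_eq)
    then show ?thesis by (simp add: f_def)
  qed
  have f0: "f 0 = 0" unfolding f_def using primitive_0[OF v] by simp
  have "l2_deriv f v"
    using v f f0 unfolding l2_deriv_def sq_int_def by simp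
  moreover have "f (t + 1) = f t" for t
    by (simp add: f_def frac_def)
  ultimately have rep: "h1_fun (Abs_h1 f) = f"
    by (intro Abs_h1_inverse) blast
  define g where "g = Abs_h1 f + h1_const (m - h1_mean (Abs_h1 f))"
  have "l2_deriv (h1_fun g) (\<lambda>t. v t + 0)"
    unfolding g_def using \<open>l2_deriv f v\<close>
    by (intro h1_l2_deriv_add) (simp_all add: rep h1_const.rep_eq l2_deriv_const)
  then have d: "l2_deriv (h1_fun g) v" by simp
  show ?thesis
  proof (rule that[OF d])
    show "h1_mean g = m" by (simp add: g_def)
    show "h1_fun g t = h1_fun g 0 + (LINT s:{0..t}|lborel. v s)" if "t \<in> {0..1}" for t
      using d that unfolding l2_deriv_def by blast
  qed
qed

section \<open>The Sobolev space as an algebra\<close>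

lemma L2n_add:
  assumes "sq_int v" "sq_int w" shows "L2n (\<lambda>t. v t + w t) \<le> L2n v + L2n w"
proof (rule power2_le_imp_le)
  have i: "int01 (\<lambda>t. (norm (v t))\<^sup>2)" "int01 (\<lambda>t. (norm (w t))\<^sup>2)" "int01 (\<lambda>t. v t \<bullet> w t)"
    using assms sq_int_inner_int01 by (auto simp: sq_int_def)
  have "(\<lambda>t. (norm (v t + w t))\<^sup>2) = (\<lambda>t. ((norm (v t))\<^sup>2 + (norm (w t))\<^sup>2) + 2 * (v t \<bullet> w t))"
    by (simp add: fun_eq_iff power2_norm_eq_inner inner_add_left inner_add_right inner_commute)
  then have "(L2n (\<lambda>t. v t + w t))\<^sup>2 = I01 (\<lambda>t. ((norm (v t))\<^sup>2 + (norm (w t))\<^sup>2) + 2 * (v t \<bullet> w t))"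
    by (simp add: L2n_sq)
  also have "\<dots> = I01 (\<lambda>t. (norm (v t))\<^sup>2 + (norm (w t))\<^sup>2) + I01 (\<lambda>t. 2 * (v t \<bullet> w t))"
    by (intro set_integral_add set_integrable_mult_right i)
  also have "I01 (\<lambda>t. (norm (v t))\<^sup>2 + (norm (w t))\<^sup>2) = (L2n v)\<^sup>2 + (L2n w)\<^sup>2"
    unfolding L2n_sq by (intro set_integral_add i)
  also have "I01 (\<lambda>t. 2 * (v t \<bullet> w t)) = 2 * I01 (\<lambda>t. v t \<bullet> w t)" by (rule set_integral_mult_right)
  finally show "(L2n (\<lambda>t. v t + w t))\<^sup>2 \<le> (L2n v + L2n w)\<^sup>2"
    using L2_Cauchy_Schwarz_inner[OF assms] by (simp add: power2_sum abs_le_iff)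
  show "0 \<le> L2n v + L2n w" by (intro add_nonneg_nonneg L2n_nonneg)
qed

lemma L2n_mono:
  assumes "sq_int v" "sq_int w" "\<And>t. t \<in> {0..1} \<Longrightarrow> norm (v t) \<le> norm (w t)"
  shows "L2n v \<le> L2n w"
  unfolding L2n_def
  by (intro real_sqrt_le_mono I01_mono) (use assms in \<open>auto simp: sq_int_def intro!: power_mono\<close>)

lemma L2n_mult_le:
  assumes "sq_int v" "f \<in> borel_measurable borel" "0 \<le> C" "\<And>t. t \<in> {0..1} \<Longrightarrow> norm (f t :: complex) \<le> C"
  shows "L2n (\<lambda>t. f t * v t) \<le> C * L2n v"
proof (rule power2_le_imp_le)
  have "I01 (\<lambda>t. (norm (f t * v t))\<^sup>2) \<le> I01 (\<lambda>t. C\<^sup>2 * (norm (v t))\<^sup>2)"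
    using sq_int_mult_bounded[OF assms(1,2,4)] assms
    by (intro I01_mono) (auto simp: sq_int_def norm_mult power_mult_distrib intro!: mult_right_mono power_mono)
  also have "\<dots> = C\<^sup>2 * I01 (\<lambda>t. (norm (v t))\<^sup>2)" by (rule set_integral_mult_right)
  finally show "(L2n (\<lambda>t. f t * v t))\<^sup>2 \<le> (C * L2n v)\<^sup>2"
    by (simp only: L2n_sq power_mult_distrib)
  show "0 \<le> C * L2n v" using assms(3) by simp
qed

text \<open>In one dimension \<open>H\<^sup>1\<close> is an algebra under the pointwise product, because the \<open>H\<^sup>1\<close> norm controls the
  supremum norm. Polynomial expressions in \<open>u\<close> are then differentiable on \<open>H\<^sup>1\<close> by the product rule for
  bounded bilinear maps.\<close>

definition h1_mult :: "h1 \<Rightarrow> h1 \<Rightarrow> h1" where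
  "h1_mult u w = Abs_h1 (\<lambda>t. h1_fun u t * h1_fun w t)"

lemma h1_prod_sq_int: "sq_int (\<lambda>t. h1_deriv u t * h1_fun w t)" "sq_int (\<lambda>t. h1_fun u t * h1_deriv w t)"
proof -
  show "sq_int (\<lambda>t. h1_fun u t * h1_deriv w t)" for u w
    by (rule sq_int_mult_bounded[OF h1_sq_int h1_fun_measurable h1_sup_norm])
  from this[of w u] show "sq_int (\<lambda>t. h1_deriv u t * h1_fun w t)" by (simp add: mult.commute)
qed

lemma h1_prod_l2_deriv:
  "l2_deriv (\<lambda>t. h1_fun u t * h1_fun w t) (\<lambda>t. h1_deriv u t * h1_fun w t + h1_fun u t * h1_deriv w t)"
proof -
  have "sq_int (\<lambda>t. h1_deriv u t * h1_fun w t + h1_fun u t * h1_deriv w t)"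
    by (intro sq_int_add h1_prod_sq_int)
  moreover have "h1_fun u t * h1_fun w t = h1_fun u 0 * h1_fun w 0 +
      (LINT s:{0..t}|lborel. h1_deriv u s * h1_fun w s + h1_fun u s * h1_deriv w s)" if "t \<in> {0..1}" for t
    by (rule product_of_primitives) (use that in \<open>auto intro: sq_int_int01 h1_prod_sq_int h1_fun_primitive\<close>)
  ultimately show ?thesis unfolding l2_deriv_def sq_int_def by blast
qed

lemma h1_fun_mult [simp]: "h1_fun (h1_mult u w) t = h1_fun u t * h1_fun w t"
proof -
  have "h1_fun (h1_mult u w) = (\<lambda>t. h1_fun u t * h1_fun w t)"
    unfolding h1_mult_def by (rule Abs_h1_inverse) (use h1_prod_l2_deriv h1_periodic in auto)
  then show ?thesis by simp
qed

lemma h1_mult_l2_deriv: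
  "l2_deriv (h1_fun (h1_mult u w)) (\<lambda>t. h1_deriv u t * h1_fun w t + h1_fun u t * h1_deriv w t)"
proof -
  have "h1_fun (h1_mult u w) = (\<lambda>t. h1_fun u t * h1_fun w t)" by (simp add: fun_eq_iff)
  then show ?thesis using h1_prod_l2_deriv by simp
qed

lemma norm_h1_le: "norm (u :: h1) \<le> length_h1 u + norm (h1_mean u)"
  by (rule power2_le_imp_le) (simp_all add: norm_h1_sq power2_sum)

lemma length_h1_mult_le: "length_h1 (h1_mult u w) \<le> 4 * norm u * norm w"
proof -
  have "length_h1 (h1_mult u w) \<le> L2n (\<lambda>t. h1_deriv u t * h1_fun w t) + L2n (\<lambda>t. h1_fun u t * h1_deriv w t)"
    unfolding length_h1_eq_L2n[OF h1_mult_l2_deriv] by (intro L2n_add h1_prod_sq_int)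
  moreover have "L2n (\<lambda>t. h1_fun u t * h1_deriv w t) \<le> 2 * norm u * norm w" for u w
  proof -
    have "L2n (\<lambda>t. h1_fun u t * h1_deriv w t) \<le> (2 * norm u) * L2n (h1_deriv w)"
      by (rule L2n_mult_le[OF h1_sq_int h1_fun_measurable]) (auto simp: h1_sup_norm)
    also have "\<dots> \<le> (2 * norm u) * norm w"
      using length_le_norm[of w] by (intro mult_left_mono) (auto simp: length_h1_L2n)
    finally show ?thesis .
  qed
  from this[of u w] this[of w u] have "L2n (\<lambda>t. h1_fun u t * h1_deriv w t) \<le> 2 * norm u * norm w"
     "L2n (\<lambda>t. h1_deriv u t * h1_fun w t) \<le> 2 * norm u * norm w"
    by (simp_all add: mult.commute mult.left_commute)
  ultimately show ?thesis by linarith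
qed

lemma h1_fun_int01 [simp]: "int01 (h1_fun u)"
  by (rule h1_set_integrable)

lemma norm_h1_mult_le: "norm (h1_mult u w) \<le> norm u * norm w * 8"
proof -
  have "norm (h1_mean (h1_mult u w)) \<le> I01 (\<lambda>t. (2 * norm u) * (2 * norm w))"
    unfolding h1_mean_def
  proof (rule I01_norm_le[OF h1_fun_int01 int01_const])
    fix t show "norm (h1_fun (h1_mult u w) t) \<le> (2 * norm u) * (2 * norm w)"
      unfolding h1_fun_mult norm_mult by (intro mult_mono h1_sup_norm) auto
  qed
  then show ?thesis
    using norm_h1_le[of "h1_mult u w"] length_h1_mult_le[of u w] by simp
qed

lemma bounded_bilinear_h1_mult: "bounded_bilinear h1_mult"
proof
  show "\<exists>K. \<forall>a b. norm (h1_mult a b) \<le> norm a * norm b * K"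
    using norm_h1_mult_le by blast
qed (auto intro!: h1_eqI simp: algebra_simps)

definition h1_map :: "(complex \<Rightarrow> complex) \<Rightarrow> h1 \<Rightarrow> h1" where
  "h1_map T u = Abs_h1 (\<lambda>t. T (h1_fun u t))"

lemma set_integral_bounded_linear:
  fixes T :: "complex \<Rightarrow> complex"
  assumes "bounded_linear T" "set_integrable lborel A f"
  shows "(LINT t:A|lborel. T (f t)) = T (LINT t:A|lborel. f t)"
proof -
  interpret bounded_linear T by fact
  have "(LINT t:A|lborel. T (f t)) = (\<integral>t. T (indicat_real A t *\<^sub>R f t) \<partial>lborel)"
    by (simp add: set_lebesgue_integral_def scaleR)
  also have "\<dots> = T (LINT t:A|lborel. f t)"
    unfolding set_lebesgue_integral_def
    by (rule integral_bounded_linear[OF assms(1)]) (use assms(2) in \<open>simp add: set_integrable_def\<close>)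
  finally show ?thesis .
qed

lemma l2_deriv_bounded_linear:
  fixes T :: "complex \<Rightarrow> complex"
  assumes T: "bounded_linear T" and uv: "l2_deriv u v"
  shows "l2_deriv (\<lambda>t. T (u t)) (\<lambda>t. T (v t))"
proof -
  interpret bounded_linear T by fact
  have "T (u t) = T (u 0) + (LINT s:{0..t}|lborel. T (v s))" if "t \<in> {0..1}" for t
  proof -
    have "u t = u 0 + (LINT s:{0..t}|lborel. v s)" using uv that unfolding l2_deriv_def by blast
    then show ?thesis
      using set_integral_bounded_linear[OF T l2_deriv_integrable'[OF uv]] that by (simp add: add)
  qed
  then show ?thesis
    using sq_int_linear[OF T l2_deriv_sq_int[OF uv]] unfolding l2_deriv_def sq_int_def by metis
qed

lemma h1_fun_map: "bounded_linear T \<Longrightarrow> h1_fun (h1_map T u) = (\<lambda>t. T (h1_fun u t))"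
  unfolding h1_map_def
  by (rule Abs_h1_inverse) (use l2_deriv_bounded_linear[OF _ h1_deriv] h1_periodic in auto)

lemma h1_map_l2_deriv:
  "bounded_linear T \<Longrightarrow> l2_deriv (h1_fun u) v \<Longrightarrow> l2_deriv (h1_fun (h1_map T u)) (\<lambda>t. T (v t))"
  by (simp add: h1_fun_map l2_deriv_bounded_linear)

lemma bounded_linear_h1_map:
  assumes T: "bounded_linear T" shows "bounded_linear (h1_map T)"
proof -
  interpret T: bounded_linear T by fact
  obtain C where C: "\<And>x. norm (T x) \<le> norm x * C" "0 \<le> C" using T.nonneg_bounded by blast
  show ?thesis
  proof (rule bounded_linear_intro[where K = "2 * C"])
    show "norm (h1_map T u) \<le> norm u * (2 * C)" for u
    proof -
      have "length_h1 (h1_map T u) = L2n (\<lambda>t. T (h1_deriv u t))"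
        by (rule length_h1_eq_L2n[OF h1_map_l2_deriv[OF T h1_deriv]])
      also have "\<dots> \<le> L2n (\<lambda>t. of_real C * h1_deriv u t)"
        by (rule L2n_mono) (use C in \<open>auto simp: norm_mult mult.commute intro: sq_int_linear[OF T] sq_int_cmult\<close>)
      also have "\<dots> \<le> C * L2n (h1_deriv u)" by (rule L2n_mult_le) (use C in auto)
      also have "\<dots> \<le> C * norm u"
        using length_le_norm[of u] C(2) by (intro mult_left_mono) (auto simp: length_h1_L2n)
      finally have "length_h1 (h1_map T u) \<le> C * norm u" .
      moreover have "h1_mean (h1_map T u) = T (h1_mean u)"
        unfolding h1_mean_def h1_fun_map[OF T] by (rule set_integral_bounded_linear[OF T h1_set_integrable])
      then have "norm (h1_mean (h1_map T u)) \<le> C * norm u"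
        using order_trans[OF C(1) mult_right_mono[OF mean_le_norm C(2)], of u] by (simp add: mult.commute)
      ultimately show ?thesis using norm_h1_le[of "h1_map T u"] by (simp add: mult_ac)
    qed
  qed (auto intro!: h1_eqI simp: h1_fun_map[OF T] T.add T.scaleR)
qed

abbreviation cRe :: "complex \<Rightarrow> complex" where "cRe z \<equiv> complex_of_real (Re z)"
abbreviation cIm :: "complex \<Rightarrow> complex" where "cIm z \<equiv> complex_of_real (Im z)"

lemma bounded_linear_cRe: "bounded_linear cRe" and bounded_linear_cIm: "bounded_linear cIm"
  by (intro bounded_linear_compose[OF bounded_linear_of_real bounded_linear_Re]
      bounded_linear_compose[OF bounded_linear_of_real bounded_linear_Im])+

text \<open>The integral of the one-form \<open>u dw\<close> along the closed curve. It is antisymmetric because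
  \<open>d(u w)\<close> integrates to zero.\<close>

definition h1_form :: "h1 \<Rightarrow> h1 \<Rightarrow> complex" where
  "h1_form u w = I01 (\<lambda>t. h1_fun u t * h1_deriv w t)"

lemma h1_form_eq:
  assumes "l2_deriv (h1_fun w) v" shows "h1_form u w = I01 (\<lambda>t. h1_fun u t * v t)"
proof -
  note [measurable] = l2_deriv_measurable[OF assms]
  show ?thesis unfolding h1_form_def
    by (rule I01_cong_AE) (use h1_deriv_AE[OF assms] in auto)
qed

lemma h1_form_antisym: "h1_form u w = - h1_form w u"
proof -
  have "0 = I01 (h1_deriv (h1_mult u w))" by (simp add: I01_h1_deriv)
  also have "\<dots> = I01 (\<lambda>t. h1_deriv u t * h1_fun w t + h1_fun u t * h1_deriv w t)"
    by (rule I01_cong_AE) (use h1_deriv_AE[OF h1_mult_l2_deriv] in auto)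
  also have "\<dots> = I01 (\<lambda>t. h1_deriv u t * h1_fun w t) + I01 (\<lambda>t. h1_fun u t * h1_deriv w t)"
    by (intro set_integral_add sq_int_int01 h1_prod_sq_int)
  finally show ?thesis unfolding h1_form_def by (simp add: mult.commute add_eq_0_iff)
qed

lemma bounded_bilinear_h1_form: "bounded_bilinear h1_form"
proof
  have sc: "h1_form (r *\<^sub>R a) b = r *\<^sub>R h1_form a b" for r a b
    by (simp add: h1_form_def)
  have ad: "h1_form (a + a') b = h1_form a b + h1_form a' b" for a a' b
    using set_integral_add(2)[OF sq_int_int01[OF h1_prod_sq_int(2)] sq_int_int01[OF h1_prod_sq_int(2)]]
    by (simp add: h1_form_def distrib_right)
  show "h1_form (a + a') b = h1_form a b + h1_form a' b" for a a' b by (rule ad)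
  show "h1_form a (b + b') = h1_form a b + h1_form a b'" for a b b'
    by (simp add: h1_form_antisym[of a] ad)
  show "h1_form (r *\<^sub>R a) b = r *\<^sub>R h1_form a b" for r a b by (rule sc)
  show "h1_form a (r *\<^sub>R b) = r *\<^sub>R h1_form a b" for r a b
    by (simp add: h1_form_antisym[of a] sc)
  show "\<exists>K. \<forall>a b. norm (h1_form a b) \<le> norm a * norm b * K"
  proof (intro exI allI)
    fix a b
    have "norm (h1_form a b) \<le> I01 (\<lambda>t. (2 * norm a) * norm (h1_deriv b t))"
      unfolding h1_form_def
      by (intro I01_norm_le sq_int_int01 h1_prod_sq_int set_integrable_mult_right set_integrable_norm)
        (auto simp: norm_mult h1_sup_norm intro!: mult_right_mono)
    also have "\<dots> = (2 * norm a) * I01 (\<lambda>t. norm (h1_deriv b t))" by simp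
    also have "\<dots> \<le> (2 * norm a) * norm b"
      using L1_le_L2n[OF h1_sq_int, of b] length_le_norm[of b] by (intro mult_left_mono) (auto simp: length_h1_L2n)
    finally show "norm (h1_form a b) \<le> norm a * norm b * 2" by (simp add: mult_ac)
  qed
qed

primrec h1_power :: "h1 \<Rightarrow> nat \<Rightarrow> h1" where
  "h1_power u 0 = h1_const 1"
| "h1_power u (Suc k) = h1_mult u (h1_power u k)"

lemma h1_fun_power [simp]: "h1_fun (h1_power u k) t = h1_fun u t ^ k"
  by (induction k) auto

lemma l2_deriv_cong_AE:
  assumes "l2_deriv u v" "w \<in> borel_measurable borel" "AE t\<in>{0..1} in lborel. v t = w t"
  shows "l2_deriv u w"
proof -
  note [measurable] = l2_deriv_measurable[OF assms(1)] assms(2)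
  have "integrable lborel (\<lambda>t. indicat_real {0..1} t *\<^sub>R (norm (v t))\<^sup>2) \<longleftrightarrow>
      integrable lborel (\<lambda>t. indicat_real {0..1} t *\<^sub>R (norm (w t))\<^sup>2)"
    by (rule integrable_cong_AE) (use assms(3) in \<open>auto simp: indicator_def\<close>)
  then have "int01 (\<lambda>t. (norm (w t))\<^sup>2)"
    using l2_deriv_square_integrable[OF assms(1)] by (simp add: set_integrable_def)
  moreover have "(LINT s:{0..t}|lborel. v s) = (LINT s:{0..t}|lborel. w s)" if "t \<in> {0..1}" for t
  proof (rule set_lebesgue_integral_cong_AE)
    show "AE s\<in>{0..t} in lborel. v s = w s"
      using assms(3) by eventually_elim (use that in auto)
  qed (use assms(2) in auto)
  moreover have "u t = u 0 + (LINT s:{0..t}|lborel. v s)" if "t \<in> {0..1}" for t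
    using assms(1) that unfolding l2_deriv_def by blast
  ultimately show ?thesis using assms(2) unfolding l2_deriv_def by metis
qed

lemma h1_power_l2_deriv:
  assumes d: "l2_deriv (h1_fun u) v"
  shows "l2_deriv (h1_fun (h1_power u (Suc k))) (\<lambda>t. of_nat (Suc k) * h1_fun u t ^ k * v t)"
proof (induction k)
  case 0
  have "h1_fun (h1_power u (Suc 0)) = h1_fun u" by (simp add: fun_eq_iff)
  then show ?case using d by simp
next
  case (Suc k)
  note [measurable] = l2_deriv_measurable[OF d]
  show ?case
    by (rule l2_deriv_cong_AE[OF h1_mult_l2_deriv[of u "h1_power u (Suc k)", folded h1_power.simps(2)]], measurable)
      (use h1_deriv_AE[OF d] h1_deriv_AE[OF Suc] in eventually_elim, auto simp: algebra_simps)
qed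

lemma h1_power_has_derivative:
  assumes "(f has_derivative f') (at x)"
  shows "((\<lambda>y. h1_power (f y) (Suc k)) has_derivative
     (\<lambda>h. real (Suc k) *\<^sub>R h1_mult (h1_power (f x) k) (f' h))) (at x)"
proof (induction k)
  case 0
  have "h1_power w (Suc 0) = w" for w by (rule h1_eqI) simp
  moreover have "h1_mult (h1_const 1) w = w" for w by (rule h1_eqI) simp
  ultimately show ?case using assms by simp
next
  case (Suc k)
  show ?case
    unfolding h1_power.simps(2)[of _ "Suc k"]
    by (rule has_derivative_eq_rhs[OF bounded_bilinear.FDERIV[OF bounded_bilinear_h1_mult assms Suc]])
      (auto simp: fun_eq_iff scaleR_conv_of_real algebra_simps intro!: h1_eqI)
qed

section \<open>The area functional and its first variation\<close>

lemma isCont_segments: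
  fixes K :: "complex \<Rightarrow> real"
  assumes "continuous_on UNIV K"
  shows "isCont (\<lambda>s. K (Complex s y)) x" "isCont (\<lambda>s. K (Complex x s)) y"
proof -
  have K: "isCont K z" for z using assms by (simp add: continuous_on_eq_continuous_at)
  have "isCont (\<lambda>s. K (of_real s + \<i> * of_real y)) x" "isCont (\<lambda>s. K (of_real x + \<i> * of_real s)) y"
    by (rule isCont_o2[OF _ K], intro continuous_intros)+
  then show "isCont (\<lambda>s. K (Complex s y)) x" "isCont (\<lambda>s. K (Complex x s)) y"
    by (simp_all add: Complex_eq)
qed

lemma interval_integrable_segments:
  fixes K :: "complex \<Rightarrow> real"
  assumes "continuous_on UNIV K"
  shows "interval_lebesgue_integrable lborel (ereal a) (ereal b) (\<lambda>s. K (Complex s y))"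
    "interval_lebesgue_integrable lborel (ereal a) (ereal b) (\<lambda>s. K (Complex x s))"
  by (intro interval_integrable_isCont isCont_segments assms)+

lemma interval_integral_bound:
  fixes f :: "real \<Rightarrow> real"
  assumes c: "\<And>s. isCont f s" and B: "\<And>s. \<bar>s\<bar> \<le> \<bar>x\<bar> \<Longrightarrow> \<bar>f s\<bar> \<le> B"
  shows "\<bar>LBINT s=0..x. f s\<bar> \<le> \<bar>x\<bar> * B"
proof -
  have i: "set_integrable lborel {a..b} f" for a b
    by (rule borel_integrable_atLeastAtMost') (simp add: c continuous_at_imp_continuous_on)
  have *: "\<bar>LINT s:{a..b}|lborel. f s\<bar> \<le> (b - a) * B"
    if "a \<le> b" "\<And>s. s \<in> {a..b} \<Longrightarrow> \<bar>s\<bar> \<le> \<bar>x\<bar>" for a b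
  proof -
    have "norm (LINT s:{a..b}|lborel. f s) \<le> (LINT s:{a..b}|lborel. norm (f s))"
      by (rule set_integral_norm_bound[OF i])
    also have "\<dots> \<le> (LINT s:{a..b}|lborel. B)"
      by (rule set_integral_mono) (use that B i in \<open>auto intro: set_integrable_abs borel_integrable_atLeastAtMost'\<close>)
    also have "\<dots> = (b - a) * B" using that(1) by (simp add: set_lebesgue_integral_def)
    finally show ?thesis by simp
  qed
  show ?thesis
  proof (cases "0 \<le> x")
    case True
    then have "(LBINT s=0..x. f s) = (LINT s:{0..x}|lborel. f s)"
      unfolding zero_ereal_def by (rule interval_integral_Icc)
    then show ?thesis using *[of 0 x] True by auto
  next
    case False
    then have "(LBINT s=0..x. f s) = - (LINT s:{x..0}|lborel. f s)"
      unfolding zero_ereal_def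
      by (subst interval_integral_endpoints_reverse) (auto intro!: interval_integral_Icc)
    then show ?thesis using *[of x 0] False by auto
  qed
qed

lemma Q_field_Re: "Re (Q_field K z) = (1/2) * (LBINT s=0..Re z. K (Complex s (Im z)))"
  and Q_field_Im: "Im (Q_field K z) = (1/2) * (LBINT s=0..Im z. K (Complex (Re z) s))"
  by (simp_all add: Q_field_def)

lemma Q_field_add:
  assumes "continuous_on UNIV K" "continuous_on UNIV P"
  shows "Q_field (\<lambda>z. K z + P z) z = Q_field K z + Q_field P z"
proof (rule complex_eqI)
  show "Re (Q_field (\<lambda>z. K z + P z) z) = Re (Q_field K z + Q_field P z)"
    unfolding plus_complex.sel Q_field_Re zero_ereal_def
    by (subst interval_lebesgue_integral_add(2)[OF interval_integrable_segments(1)[OF assms(1)]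
        interval_integrable_segments(1)[OF assms(2)]]) (rule distrib_left)
  show "Im (Q_field (\<lambda>z. K z + P z) z) = Im (Q_field K z + Q_field P z)"
    unfolding plus_complex.sel Q_field_Im zero_ereal_def
    by (subst interval_lebesgue_integral_add(2)[OF interval_integrable_segments(2)[OF assms(1)]
        interval_integrable_segments(2)[OF assms(2)]]) (rule distrib_left)
qed

lemma Q_field_scale: "Q_field (\<lambda>z. c * K z) z = c *\<^sub>R Q_field K z"
  by (rule complex_eqI) (simp_all add: Q_field_Re Q_field_Im)

lemma Q_field_diff:
  assumes "continuous_on UNIV K" "continuous_on UNIV P"
  shows "Q_field (\<lambda>z. K z - P z) z = Q_field K z - Q_field P z"
  using Q_field_add[OF assms(1), of "\<lambda>z. - 1 * P z"] assms(2)
  by (simp add: Q_field_scale continuous_on_minus flip: Q_field_scale[of "-1", simplified])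

lemma Q_field_bound:
  assumes "continuous_on UNIV K" "\<And>w. norm w \<le> \<rho> \<Longrightarrow> \<bar>K w\<bar> \<le> e" "norm z \<le> \<rho>"
  shows "norm (Q_field K z) \<le> \<rho> * e"
proof -
  have e: "0 \<le> e" using assms(2,3) by (meson abs_ge_zero order_trans)
  have 1: "norm (Complex s (Im z)) \<le> norm z" if "\<bar>s\<bar> \<le> \<bar>Re z\<bar>" for s
    using that by (simp add: cmod_def abs_le_square_iff)
  have 2: "norm (Complex (Re z) s) \<le> norm z" if "\<bar>s\<bar> \<le> \<bar>Im z\<bar>" for s
    using that by (simp add: cmod_def abs_le_square_iff)
  have "\<bar>LBINT s=0..Re z. K (Complex s (Im z))\<bar> \<le> \<bar>Re z\<bar> * e"
    by (rule interval_integral_bound[OF isCont_segments(1)[OF assms(1)]])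
      (use 1 assms(2,3) order_trans in blast)
  also have "\<dots> \<le> \<rho> * e" using assms(3) abs_Re_le_cmod[of z] e by (intro mult_right_mono) auto
  finally have a: "\<bar>Re (Q_field K z)\<bar> \<le> \<rho> * e / 2" by (simp add: Q_field_Re)
  have "\<bar>LBINT s=0..Im z. K (Complex (Re z) s)\<bar> \<le> \<bar>Im z\<bar> * e"
    by (rule interval_integral_bound[OF isCont_segments(2)[OF assms(1)]])
      (use 2 assms(2,3) order_trans in blast)
  also have "\<dots> \<le> \<rho> * e" using assms(3) abs_Im_le_cmod[of z] e by (intro mult_right_mono) auto
  finally have b: "\<bar>Im (Q_field K z)\<bar> \<le> \<rho> * e / 2" by (simp add: Q_field_Im)
  from a b cmod_le[of "Q_field K z"] show ?thesis by linarith
qed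

text \<open>Polynomials in the two coordinates, generated in the form in which the field \<open>Q\<close> can be integrated
  explicitly.\<close>

inductive bipoly :: "(complex \<Rightarrow> real) \<Rightarrow> bool" where
  monomial: "bipoly (\<lambda>z. c * (Re z ^ m * Im z ^ n))"
| sum: "bipoly f \<Longrightarrow> bipoly g \<Longrightarrow> bipoly (\<lambda>z. f z + g z)"

lemma bipoly_continuous: "bipoly P \<Longrightarrow> continuous_on A P"
  by (induction rule: bipoly.induct) (auto intro!: continuous_intros)

lemma bipoly_mult:
  assumes "bipoly f" "bipoly g" shows "bipoly (\<lambda>z. f z * g z)"
  using assms(1)
proof (induction rule: bipoly.induct)
  case (monomial c m n)
  from assms(2) show ?case
  proof (induction rule: bipoly.induct)
    case (monomial d k l)
    have "(\<lambda>z. c * (Re z ^ m * Im z ^ n) * (d * (Re z ^ k * Im z ^ l))) =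
        (\<lambda>z. (c * d) * (Re z ^ (m + k) * Im z ^ (n + l)))"
      by (simp add: fun_eq_iff power_add)
    then show ?case by (simp only: bipoly.monomial)
  next
    case (sum f g)
    show ?case unfolding distrib_left by (rule bipoly.sum) (rule sum.IH)+
  qed
next
  case (sum f1 f2)
  then show ?case unfolding distrib_right by (intro bipoly.sum)
qed

lemma bipoly_dense:
  assumes "continuous_on UNIV K" "0 < e"
  obtains P where "bipoly P" "\<And>z. norm z \<le> \<rho> \<Longrightarrow> \<bar>K z - P z\<bar> < e"
proof -
  have "\<exists>g. bipoly g \<and> (\<forall>x\<in>cball 0 \<rho>. \<bar>K x - g x\<bar> < e)"
  proof (rule Stone_Weierstrass_HOL)
    show "bipoly (\<lambda>x. c)" for c using bipoly.monomial[of c 0 0] by simp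
    show "\<exists>f. bipoly f \<and> f x \<noteq> f y" if "x \<in> cball 0 \<rho> \<and> y \<in> cball 0 \<rho> \<and> x \<noteq> y" for x y
    proof (cases "Re x = Re y")
      case True
      then have "Im x \<noteq> Im y" using that complex_eqI by blast
      then show ?thesis using bipoly.monomial[of 1 0 1] by auto
    next
      case False
      then show ?thesis using bipoly.monomial[of 1 1 0] by auto
    qed
    show "continuous_on (cball 0 \<rho>) K" using assms(1) continuous_on_subset by blast
  qed (use assms in \<open>auto intro: bipoly_continuous bipoly.sum bipoly_mult\<close>)
  then show ?thesis using that by auto
qed

lemma Q_field_monomial:
  "Q_field (\<lambda>z. c * (Re z ^ m * Im z ^ n)) z =
    Complex (c / 2 * (Re z ^ Suc m / real (Suc m) * Im z ^ n)) (c / 2 * (Re z ^ m * (Im z ^ Suc n / real (Suc n))))"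
proof -
  have *: "(LBINT s=0..x. s ^ k) = x ^ Suc k / real (Suc k)" for x :: real and k
  proof -
    have "(LBINT s=ereal 0..ereal x. s ^ k) = x ^ Suc k / real (Suc k) - 0 ^ Suc k / real (Suc k)"
    proof (rule interval_integral_FTC_finite)
      show "((\<lambda>s. s ^ Suc k / real (Suc k)) has_vector_derivative s ^ k) (at s within {min 0 x..max 0 x})" for s
        by (rule has_vector_derivative_at_within, simp flip: has_real_derivative_iff_has_vector_derivative del: power_Suc of_nat_Suc)
          (rule derivative_eq_intros refl | simp del: power_Suc of_nat_Suc)+
    qed (intro continuous_intros)
    then show ?thesis by (simp add: zero_ereal_def)
  qed
  have "(LBINT s=0..Re z. c * (s ^ m * Im z ^ n)) = c * ((LBINT s=0..Re z. s ^ m) * Im z ^ n)"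
    "(LBINT s=0..Im z. c * (Re z ^ m * s ^ n)) = c * (Re z ^ m * (LBINT s=0..Im z. s ^ n))"
    by simp_all
  then show ?thesis
    unfolding Q_field_def complex.sel by (simp add: * complex_eq_iff)
qed

lemma Q_field_bipoly_continuous: "bipoly P \<Longrightarrow> continuous_on UNIV (Q_field P)"
proof (induction rule: bipoly.induct)
  case (monomial c m n)
  show ?case
    unfolding Q_field_monomial Complex_eq by (intro continuous_intros) auto
next
  case (sum f g)
  then show ?case
    by (subst Q_field_add) (auto intro!: continuous_intros bipoly_continuous)
qed

text \<open>For polynomials the field is explicit; in general it is a locally uniform limit of such fields.\<close>

lemma Q_field_continuous:
  assumes K: "continuous_on UNIV K" shows "continuous_on UNIV (Q_field K)"
proof -
  have "continuous_on (ball 0 \<rho>) (Q_field K)" if "\<rho> > 0" for \<rho>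
  proof -
    have "\<exists>P. bipoly P \<and> (\<forall>z. norm z \<le> \<rho> \<longrightarrow> \<bar>K z - P z\<bar> < 1 / real (Suc n))" for n
      using bipoly_dense[OF K, of "1 / real (Suc n)" \<rho>] by (metis of_nat_0_less_iff zero_less_Suc zero_less_divide_1_iff)
    then obtain P where P: "\<And>n. bipoly (P n)" "\<And>n z. norm z \<le> \<rho> \<Longrightarrow> \<bar>K z - P n z\<bar> < 1 / real (Suc n)"
      by metis
    have "uniform_limit (ball 0 \<rho>) (\<lambda>n. Q_field (P n)) (Q_field K) sequentially"
    proof (rule uniform_limitI)
      fix e :: real assume "e > 0"
      have "(\<lambda>n. \<rho> * (1 / real (Suc n))) \<longlonglongrightarrow> \<rho> * 0"
        by (intro tendsto_mult tendsto_const LIMSEQ_Suc[OF lim_1_over_n])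
      then have "\<forall>\<^sub>F n in sequentially. \<rho> * (1 / real (Suc n)) < e"
        using \<open>e > 0\<close> by (auto simp: order_tendsto_iff)
      then show "\<forall>\<^sub>F n in sequentially. \<forall>z\<in>ball 0 \<rho>. dist (Q_field (P n) z) (Q_field K z) < e"
      proof eventually_elim
        case (elim n)
        have "dist (Q_field (P n) z) (Q_field K z) < e" if "z \<in> ball 0 \<rho>" for z
        proof -
          have "norm (Q_field (\<lambda>z. K z - P n z) z) \<le> \<rho> * (1 / real (Suc n))"
          proof (rule Q_field_bound)
            show "continuous_on UNIV (\<lambda>z. K z - P n z)"
              by (intro continuous_intros K bipoly_continuous P)
            show "\<bar>K w - P n w\<bar> \<le> 1 / real (Suc n)" if "norm w \<le> \<rho>" for w
              using P(2)[OF that, of n] by simp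
          qed (use that in auto)
          then show ?thesis using elim
            by (simp add: Q_field_diff K P bipoly_continuous dist_norm norm_minus_commute)
        qed
        then show ?case by blast
      qed
    qed
    then show ?thesis
      by (rule uniform_limit_theorem[rotated])
        (auto intro!: always_eventually continuous_on_subset[OF Q_field_bipoly_continuous[OF P(1)]])
  qed
  then have "continuous (at z) (Q_field K)" for z
    by (metis add.commute add_pos_nonneg centre_in_ball continuous_on_eq_continuous_at dist_0_norm
        less_add_one mem_ball norm_ge_zero open_ball zero_less_one)
  then show ?thesis by (simp add: continuous_on_eq_continuous_at)
qed

text \<open>The density that the first variation of the area functional pairs with the direction \<open>h\<close>.\<close>

definition h1_force :: "(complex \<Rightarrow> real) \<Rightarrow> h1 \<Rightarrow> real \<Rightarrow> complex" where
  "h1_force K u t = of_real (K (h1_fun u t)) * (\<i> * h1_deriv u t)"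

definition h1_variation :: "(complex \<Rightarrow> real) \<Rightarrow> h1 \<Rightarrow> h1 \<Rightarrow> real" where
  "h1_variation K u h = I01 (\<lambda>t. h1_force K u t \<bullet> h1_fun h t)"

lemma continuous_on_cball_bounded:
  fixes f :: "complex \<Rightarrow> 'a::real_normed_vector"
  assumes "continuous_on UNIV f" obtains C where "0 \<le> C" "\<And>z. norm z \<le> \<rho> \<Longrightarrow> norm (f z) \<le> C"
proof -
  have "compact (f ` cball 0 \<rho>)"
    by (intro compact_continuous_image compact_cball continuous_on_subset[OF assms]) auto
  then obtain C where "\<forall>y\<in>f ` cball 0 \<rho>. norm y \<le> C" using compact_imp_bounded bounded_iff by metis
  then show ?thesis by (intro that[of "max 0 C"]) (auto simp: le_max_iff_disj)
qed

lemma sq_int_comp: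
  fixes f :: "complex \<Rightarrow> complex"
  assumes f: "continuous_on UNIV f" and v: "sq_int v"
  shows "sq_int (\<lambda>t. f (h1_fun u t) * v t)"
proof -
  obtain C where C: "\<And>z. norm z \<le> 2 * norm u \<Longrightarrow> norm (f z) \<le> C"
    by (rule continuous_on_cball_bounded[OF f, of "2 * norm u"]) blast
  have [measurable]: "f \<in> borel_measurable borel" by (rule borel_measurable_continuous_onI[OF f])
  show ?thesis by (rule sq_int_mult_bounded[OF v]) (use C h1_sup_norm in auto)
qed

lemma h1_force_sq_int:
  assumes "continuous_on UNIV K" shows "sq_int (h1_force K u)"
proof -
  have "sq_int (\<lambda>t. complex_of_real (K (h1_fun u t)) * (\<i> * h1_deriv u t))"
    by (rule sq_int_comp) (intro continuous_intros assms sq_int_cmult h1_sq_int)+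
  then show ?thesis by (simp add: h1_force_def[abs_def])
qed

lemma h1_variation_add:
  assumes "continuous_on UNIV K"
  shows "h1_variation K u (h + h') = h1_variation K u h + h1_variation K u h'"
  using set_integral_add(2)[OF sq_int_inner_int01[OF h1_force_sq_int[OF assms] h1_fun_sq_int]
    sq_int_inner_int01[OF h1_force_sq_int[OF assms] h1_fun_sq_int]]
  by (simp add: h1_variation_def inner_add_right)

lemma h1_variation_scaleR: "h1_variation K u (c *\<^sub>R h) = c * h1_variation K u h"
  by (simp add: h1_variation_def)

lemma h1_area_integrand:
  assumes "continuous_on UNIV K"
  shows "int01 (\<lambda>t. Q_field K (h1_fun u t) \<bullet> (\<i> * h1_deriv u t))"
  by (rule sq_int_inner_int01)
    (use sq_int_comp[OF Q_field_continuous[OF assms] sq_int_one] in \<open>auto intro: sq_int_cmult\<close>)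

lemma G_h1_add:
  assumes "continuous_on UNIV K" "continuous_on UNIV P"
  shows "G_h1 (\<lambda>z. K z + P z) u = G_h1 K u + G_h1 P u"
  using set_integral_add(2)[OF h1_area_integrand[OF assms(1)] h1_area_integrand[OF assms(2)]]
  by (simp add: G_h1_def Q_field_add assms inner_add_left)

lemma G_h1_scale: "G_h1 (\<lambda>z. c * K z) u = c * G_h1 K u"
  by (simp add: G_h1_def Q_field_scale)

lemma G_h1_const [simp]: "G_h1 K (h1_const z) = 0"
proof -
  have "Q_field K (h1_fun (h1_const z) t) \<bullet> (\<i> * h1_deriv (h1_const z) t) =
    Q_field K z \<bullet> (\<i> * h1_deriv (h1_const z) t)" for t by simp
  then have "G_h1 K (h1_const z) = I01 (\<lambda>t. Q_field K z \<bullet> (\<i> * h1_deriv (h1_const z) t))"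
    by (simp add: G_h1_def)
  also have "\<dots> = I01 (\<lambda>t. 0)"
    by (rule I01_cong_AE) (use h1_deriv_const[of z] in auto)
  finally show ?thesis by simp
qed

subsection \<open>Monomials\<close>

lemma monomial_integrals:
  assumes T: "bounded_linear T"
  shows "h1_form a (h1_power (h1_map T u) (Suc m)) =
      of_nat (Suc m) * I01 (\<lambda>t. h1_fun a t * (T (h1_fun u t) ^ m * T (h1_deriv u t)))"
  unfolding h1_form_eq[OF h1_power_l2_deriv[OF h1_map_l2_deriv[OF T h1_deriv]]] set_integral_mult_right[symmetric]
  by (rule I01_cong) (simp add: h1_fun_map[OF T] mult_ac)

lemma int01_monomial:
  assumes T: "bounded_linear T"
  shows "int01 (\<lambda>t. h1_fun a t * (T (h1_fun u t) ^ m * T (h1_deriv u t)))"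
proof -
  have "continuous_on UNIV T"
    by (rule bounded_linear.continuous_on[OF T continuous_on_id])
  then show ?thesis
    by (intro sq_int_mult_int01 h1_fun_sq_int sq_int_comp[where f = "\<lambda>z. T z ^ m"] continuous_on_power
        sq_int_linear[OF T] h1_sq_int)
qed

text \<open>For \<open>K = c x\<^sup>m y\<^sup>n\<close> the two components of \<open>Q\<close> contribute multiples of the forms
  \<open>x\<^sup>m\<^sup>+\<^sup>1 d(y\<^sup>n\<^sup>+\<^sup>1)\<close> and \<open>y\<^sup>n\<^sup>+\<^sup>1 d(x\<^sup>m\<^sup>+\<^sup>1)\<close>, and these agree up to sign by antisymmetry.\<close>

lemma G_h1_monomial:
  "complex_of_real (G_h1 (\<lambda>z. c * (Re z ^ m * Im z ^ n)) u) =
     - of_real (c / (real (Suc m) * real (Suc n))) *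
      h1_form (h1_power (h1_map cRe u) (Suc m)) (h1_power (h1_map cIm u) (Suc n))"
proof -
  define X where "X = h1_power (h1_map cRe u) (Suc m)"
  define Y where "Y = h1_power (h1_map cIm u) (Suc n)"
  define f where "f = (\<lambda>t. h1_fun Y t * (cRe (h1_fun u t) ^ m * cRe (h1_deriv u t)))"
  define g where "g = (\<lambda>t. h1_fun X t * (cIm (h1_fun u t) ^ n * cIm (h1_deriv u t)))"
  have i: "int01 f" "int01 g" unfolding f_def g_def by (intro int01_monomial bounded_linear_cRe bounded_linear_cIm)+
  have fX: "h1_form Y X = of_nat (Suc m) * I01 f" "h1_form X Y = of_nat (Suc n) * I01 g"
    unfolding X_def f_def Y_def g_def by (intro monomial_integrals bounded_linear_cRe bounded_linear_cIm)+
  have "complex_of_real (Q_field (\<lambda>z. c * (Re z ^ m * Im z ^ n)) (h1_fun u t) \<bullet> (\<i> * h1_deriv u t)) =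
     of_real (c / 2 / real (Suc n)) * f t - of_real (c / 2 / real (Suc m)) * g t" for t
    unfolding Q_field_monomial f_def g_def X_def Y_def
    by (simp add: inner_complex_def h1_fun_map[OF bounded_linear_cRe] h1_fun_map[OF bounded_linear_cIm] field_simps del: of_nat_Suc)
  then have "complex_of_real (G_h1 (\<lambda>z. c * (Re z ^ m * Im z ^ n)) u) =
     I01 (\<lambda>t. of_real (c / 2 / real (Suc n)) * f t - of_real (c / 2 / real (Suc m)) * g t)"
    unfolding G_h1_def set_integral_complex_of_real[symmetric] by simp
  also have "\<dots> = of_real (c / 2 / real (Suc n)) * I01 f - of_real (c / 2 / real (Suc m)) * I01 g"
    unfolding set_integral_mult_right[symmetric]
    by (intro set_integral_diff(2) set_integrable_mult_right i)
  finally have e: "complex_of_real (G_h1 (\<lambda>z. c * (Re z ^ m * Im z ^ n)) u) =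
    of_real (c / 2 / real (Suc n)) * I01 f - of_real (c / 2 / real (Suc m)) * I01 g" .
  have fg: "I01 f = h1_form Y X / of_nat (Suc m)" "I01 g = h1_form X Y / of_nat (Suc n)"
    unfolding fX by (simp_all del: of_nat_Suc)
  show ?thesis
    unfolding X_def[symmetric] Y_def[symmetric] e fg h1_form_antisym[of Y X]
    by (simp add: field_simps del: of_nat_Suc)
qed

text \<open>The right-hand side is the derivative of the expression in the preceding lemma. Antisymmetry
  removes the derivatives of the direction \<open>h\<close>.\<close>

lemma h1_variation_monomial:
  "complex_of_real (h1_variation (\<lambda>z. c * (Re z ^ m * Im z ^ n)) u h) =
   - of_real (c / (real (Suc m) * real (Suc n))) *
    (h1_form (h1_power (h1_map cRe u) (Suc m)) (real (Suc n) *\<^sub>R h1_mult (h1_power (h1_map cIm u) n) (h1_map cIm h)) +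
     h1_form (real (Suc m) *\<^sub>R h1_mult (h1_power (h1_map cRe u) m) (h1_map cRe h)) (h1_power (h1_map cIm u) (Suc n)))"
proof -
  define X where "X = h1_mult (h1_power (h1_map cRe u) m) (h1_map cRe h)"
  define Y where "Y = h1_mult (h1_power (h1_map cIm u) n) (h1_map cIm h)"
  define f where "f = (\<lambda>t. h1_fun Y t * (cRe (h1_fun u t) ^ m * cRe (h1_deriv u t)))"
  define g where "g = (\<lambda>t. h1_fun X t * (cIm (h1_fun u t) ^ n * cIm (h1_deriv u t)))"
  interpret F: bounded_bilinear h1_form by (rule bounded_bilinear_h1_form)
  have i: "int01 f" "int01 g" unfolding f_def g_def by (intro int01_monomial bounded_linear_cRe bounded_linear_cIm)+
  have fX: "h1_form Y (h1_power (h1_map cRe u) (Suc m)) = of_nat (Suc m) * I01 f"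
    "h1_form X (h1_power (h1_map cIm u) (Suc n)) = of_nat (Suc n) * I01 g"
    unfolding f_def g_def by (intro monomial_integrals bounded_linear_cRe bounded_linear_cIm)+
  have "complex_of_real (h1_force (\<lambda>z. c * (Re z ^ m * Im z ^ n)) u t \<bullet> h1_fun h t) =
     of_real c * (f t - g t)" for t
    unfolding f_def g_def X_def Y_def h1_force_def
    by (simp add: inner_complex_def h1_fun_map[OF bounded_linear_cRe] h1_fun_map[OF bounded_linear_cIm] algebra_simps)
  then have "complex_of_real (h1_variation (\<lambda>z. c * (Re z ^ m * Im z ^ n)) u h) = I01 (\<lambda>t. of_real c * (f t - g t))"
    unfolding h1_variation_def set_integral_complex_of_real[symmetric] by simp
  also have "\<dots> = of_real c * (I01 f - I01 g)"
    unfolding set_integral_mult_right using set_integral_diff(2)[OF i] by simp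
  finally have e: "complex_of_real (h1_variation (\<lambda>z. c * (Re z ^ m * Im z ^ n)) u h) = of_real c * (I01 f - I01 g)" .
  have alg: "M \<noteq> 0 \<Longrightarrow> N \<noteq> 0 \<Longrightarrow> C * (a - b) = - (C / (M * N)) * (N * - (M * a) + M * (N * b))" for C M N a b :: complex
    by (simp add: field_simps)
  show ?thesis
    unfolding X_def[symmetric] Y_def[symmetric] F.scaleR_left F.scaleR_right
      h1_form_antisym[of "h1_power (h1_map cRe u) (Suc m)" Y] fX e scaleR_conv_of_real of_real_of_nat_eq
    using alg[of "of_nat (Suc m)" "of_nat (Suc n)" "of_real c" "I01 f" "I01 g"]
    by (simp del: of_nat_Suc)
qed

lemma G_h1_bipoly_has_derivative:
  "bipoly P \<Longrightarrow> (G_h1 P has_derivative h1_variation P u) (at u)"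
proof (induction rule: bipoly.induct)
  case (monomial c m n)
  have R: "(h1_map cRe has_derivative h1_map cRe) (at u)" "(h1_map cIm has_derivative h1_map cIm) (at u)"
    by (intro bounded_linear_imp_has_derivative bounded_linear_h1_map bounded_linear_cRe bounded_linear_cIm)+
  note d = bounded_bilinear.FDERIV[OF bounded_bilinear_h1_form
      h1_power_has_derivative[OF R(1), of m] h1_power_has_derivative[OF R(2), of n]]
  have "((\<lambda>u. Re (- of_real (c / (real (Suc m) * real (Suc n))) *
      h1_form (h1_power (h1_map cRe u) (Suc m)) (h1_power (h1_map cIm u) (Suc n))))
      has_derivative (\<lambda>h. Re (complex_of_real (h1_variation (\<lambda>z. c * (Re z ^ m * Im z ^ n)) u h)))) (at u)"
    unfolding h1_variation_monomial
    by (intro has_derivative_Re has_derivative_mult_right d)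
  then show ?case unfolding G_h1_monomial[symmetric] by simp
next
  case (sum f g)
  have "G_h1 (\<lambda>z. f z + g z) = (\<lambda>u. G_h1 f u + G_h1 g u)"
    using sum.hyps by (simp add: fun_eq_iff G_h1_add bipoly_continuous)
  moreover have "h1_variation (\<lambda>z. f z + g z) u = (\<lambda>h. h1_variation f u h + h1_variation g u h)"
  proof
    fix h
    have "h1_force (\<lambda>z. f z + g z) u t \<bullet> h1_fun h t = h1_force f u t \<bullet> h1_fun h t + h1_force g u t \<bullet> h1_fun h t" for t
      by (simp add: h1_force_def distrib_right inner_add_left)
    then show "h1_variation (\<lambda>z. f z + g z) u h = h1_variation f u h + h1_variation g u h"
      unfolding h1_variation_def
      using set_integral_add(2)[OF sq_int_inner_int01[OF h1_force_sq_int[OF bipoly_continuous[OF sum.hyps(1)]] h1_fun_sq_int]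
       sq_int_inner_int01[OF h1_force_sq_int[OF bipoly_continuous[OF sum.hyps(2)]] h1_fun_sq_int]] by simp
  qed
  ultimately show ?case using sum.IH by (simp add: has_derivative_add)
qed

subsection \<open>Estimates for continuous curvature functions\<close>

lemma h1_variation_diff_curvature:
  assumes "continuous_on UNIV K" "continuous_on UNIV P"
  shows "h1_variation (\<lambda>z. K z - P z) u h = h1_variation K u h - h1_variation P u h"
proof -
  have "h1_force (\<lambda>z. K z - P z) u t \<bullet> h1_fun h t = h1_force K u t \<bullet> h1_fun h t - h1_force P u t \<bullet> h1_fun h t" for t
    by (simp add: h1_force_def left_diff_distrib inner_diff_left)
  then show ?thesis
    unfolding h1_variation_def
    using set_integral_diff(2)[OF sq_int_inner_int01[OF h1_force_sq_int[OF assms(1)] h1_fun_sq_int]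
       sq_int_inner_int01[OF h1_force_sq_int[OF assms(2)] h1_fun_sq_int]] by simp
qed

lemma L2n_h1_force_le:
  assumes "continuous_on UNIV K" "0 \<le> M" "\<And>t. t \<in> {0..1} \<Longrightarrow> \<bar>K (h1_fun u t)\<bar> \<le> M"
  shows "L2n (h1_force K u) \<le> M * length_h1 u"
proof -
  have [measurable]: "K \<in> borel_measurable borel" by (rule borel_measurable_continuous_onI[OF assms(1)])
  have "L2n (\<lambda>t. (complex_of_real (K (h1_fun u t)) * \<i>) * h1_deriv u t) \<le> M * L2n (h1_deriv u)"
    by (rule L2n_mult_le) (use assms in \<open>auto simp: norm_mult\<close>)
  then show ?thesis by (simp add: h1_force_def[abs_def] length_h1_L2n mult.assoc)
qed

lemma h1_variation_bound:
  assumes "continuous_on UNIV K" "\<And>t. t \<in> {0..1} \<Longrightarrow> \<bar>K (h1_fun u t)\<bar> \<le> M" "0 \<le> M"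
    "\<And>t. t \<in> {0..1} \<Longrightarrow> norm (h1_fun h t) \<le> H" "0 \<le> H"
  shows "\<bar>h1_variation K u h\<bar> \<le> M * length_h1 u * H"
proof -
  have "\<bar>h1_variation K u h\<bar> \<le> L2n (h1_force K u) * L2n (h1_fun h)"
    unfolding h1_variation_def by (intro L2_Cauchy_Schwarz_inner h1_force_sq_int assms h1_fun_sq_int)
  also have "\<dots> \<le> (M * length_h1 u) * H"
    by (intro mult_mono L2n_h1_force_le L2n_le_bound assms h1_fun_sq_int mult_nonneg_nonneg) auto
  finally show ?thesis .
qed

lemma G_h1_bound:
  assumes K: "continuous_on UNIV K" "\<And>z. norm z \<le> \<rho> \<Longrightarrow> \<bar>K z\<bar> \<le> e"
    and u: "\<And>t. norm (h1_fun u t) \<le> \<rho>"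
  shows "\<bar>G_h1 K u\<bar> \<le> \<rho> * e * length_h1 u"
proof -
  have "0 \<le> e" using K(2) u by (meson abs_ge_zero order_trans)
  moreover have "0 \<le> \<rho>" using u by (meson norm_ge_zero order_trans)
  ultimately have nn: "0 \<le> \<rho> * e" by simp
  have Q: "sq_int (\<lambda>t. Q_field K (h1_fun u t))"
    using sq_int_comp[OF Q_field_continuous[OF K(1)] sq_int_one] by simp
  have "\<bar>G_h1 K u\<bar> \<le> L2n (\<lambda>t. Q_field K (h1_fun u t)) * L2n (\<lambda>t. \<i> * h1_deriv u t)"
    unfolding G_h1_def by (intro L2_Cauchy_Schwarz_inner Q sq_int_cmult h1_sq_int)
  also have "\<dots> \<le> (\<rho> * e) * length_h1 u"
  proof (intro mult_mono)
    show "L2n (\<lambda>t. Q_field K (h1_fun u t)) \<le> \<rho> * e"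
      by (rule L2n_le_bound[OF Q nn]) (rule Q_field_bound[OF K u])
    show "L2n (\<lambda>t. \<i> * h1_deriv u t) \<le> length_h1 u"
      by (simp add: L2n_def length_h1_def norm_mult)
  qed (use nn in auto)
  finally show ?thesis .
qed

lemma G_h1_line_derivative:
  assumes "(G_h1 P has_derivative h1_variation P (u + s *\<^sub>R h)) (at (u + s *\<^sub>R h))"
  shows "((\<lambda>s. G_h1 P (u + s *\<^sub>R h)) has_real_derivative h1_variation P (u + s *\<^sub>R h) h) (at s)"
proof -
  have l: "((\<lambda>s. u + s *\<^sub>R h) has_derivative (\<lambda>r. r *\<^sub>R h)) (at s)"
    by (auto intro!: derivative_eq_intros)
  have "(\<lambda>r. h1_variation P (u + s *\<^sub>R h) (r *\<^sub>R h)) = (*) (h1_variation P (u + s *\<^sub>R h) h)"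
    by (simp add: fun_eq_iff h1_variation_scaleR mult.commute)
  then show ?thesis
    using has_derivative_compose[OF l assms] unfolding has_field_derivative_def by simp
qed

text \<open>For a polynomial \<open>P\<close> near \<open>K\<close>, the mean value theorem on the segment from \<open>u\<close> to \<open>u + h\<close> makes the
  increment of \<open>G\<close> equal to the variation at an intermediate point. The point depends on \<open>P\<close>, so it
  is lost in the limit \<open>P \<rightarrow> K\<close>; what survives is any bound that holds along the whole segment.\<close>

lemma G_h1_increment:
  assumes K: "continuous_on UNIV K"
    and B: "\<And>s. s \<in> {0..1} \<Longrightarrow> \<bar>h1_variation K (u + s *\<^sub>R h) h - A\<bar> \<le> B"
  shows "\<bar>G_h1 K (u + h) - G_h1 K u - A\<bar> \<le> B"
proof (rule field_le_epsilon)
  fix e :: real assume e: "0 < e"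
  define N where "N = norm u + norm h"
  \<comment> \<open>three errors arise below, each at most \<open>2 N\<^sup>2 d\<close>\<close>
  define d where "d = e / (6 * N\<^sup>2 + 1)"
  have den: "0 < 6 * N\<^sup>2 + 1" by (rule add_nonneg_pos) auto
  have d: "0 < d" using e den by (simp add: d_def)
  have N: "0 \<le> N" by (simp add: N_def)
  obtain P where P: "bipoly P" "\<And>z. norm z \<le> 2 * N \<Longrightarrow> \<bar>K z - P z\<bar> < d"
    by (rule bipoly_dense[OF K d, of "2 * N"]) blast
  have cP: "continuous_on UNIV P" by (rule bipoly_continuous[OF P(1)])
  have cD: "continuous_on UNIV (\<lambda>z. K z - P z)" by (intro continuous_intros K cP)
  have w: "norm (u + s *\<^sub>R h) \<le> N" "length_h1 (u + s *\<^sub>R h) \<le> N" if "s \<in> {0..1}" for s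
  proof -
    have "\<bar>s\<bar> * norm h \<le> 1 * norm h" using that by (intro mult_right_mono) auto
    then show "norm (u + s *\<^sub>R h) \<le> N"
      using norm_triangle_ineq[of u "s *\<^sub>R h"] by (simp add: N_def)
    then show "length_h1 (u + s *\<^sub>R h) \<le> N" using length_le_norm[of "u + s *\<^sub>R h"] by linarith
  qed
  have wt: "norm (h1_fun (u + s *\<^sub>R h) t) \<le> 2 * N" if "s \<in> {0..1}" for s t
    using h1_sup_norm[of "u + s *\<^sub>R h" t] w(1)[OF that] by linarith
  have g: "\<bar>G_h1 K (u + s *\<^sub>R h) - G_h1 P (u + s *\<^sub>R h)\<bar> \<le> 2 * N\<^sup>2 * d" if "s \<in> {0..1}" for s
  proof -
    have "G_h1 K (u + s *\<^sub>R h) = G_h1 (\<lambda>z. K z - P z) (u + s *\<^sub>R h) + G_h1 P (u + s *\<^sub>R h)"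
      using G_h1_add[OF cD cP, of "u + s *\<^sub>R h"] by simp
    moreover have "\<bar>G_h1 (\<lambda>z. K z - P z) (u + s *\<^sub>R h)\<bar> \<le> 2 * N * d * length_h1 (u + s *\<^sub>R h)"
      by (rule G_h1_bound[OF cD _ wt[OF that]]) (use P(2) less_imp_le in blast)
    moreover have "2 * N * d * length_h1 (u + s *\<^sub>R h) \<le> 2 * N * d * N"
      using w(2)[OF that] N d by (intro mult_left_mono) auto
    ultimately show ?thesis by (simp add: power2_eq_square mult_ac)
  qed
  have v: "\<bar>h1_variation K (u + s *\<^sub>R h) h - h1_variation P (u + s *\<^sub>R h) h\<bar> \<le> 2 * N\<^sup>2 * d" if "s \<in> {0..1}" for s
  proof -
    have "\<bar>h1_variation (\<lambda>z. K z - P z) (u + s *\<^sub>R h) h\<bar> \<le> d * length_h1 (u + s *\<^sub>R h) * (2 * N)"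
    proof (rule h1_variation_bound[OF cD])
      show "\<bar>K (h1_fun (u + s *\<^sub>R h) t) - P (h1_fun (u + s *\<^sub>R h) t)\<bar> \<le> d" for t
        using P(2)[OF wt[OF that]] by (rule less_imp_le)
      show "norm (h1_fun h t) \<le> 2 * N" for t
        using h1_sup_norm[of h t] norm_ge_zero[of u] unfolding N_def distrib_left by linarith
    qed (use d N in auto)
    also have "\<dots> \<le> d * N * (2 * N)"
      using w(2)[OF that] N d by (intro mult_left_mono mult_right_mono) auto
    finally show ?thesis by (simp add: h1_variation_diff_curvature[OF K cP] power2_eq_square mult_ac)
  qed
  obtain z where z: "0 < z" "z < 1" "G_h1 P (u + 1 *\<^sub>R h) - G_h1 P (u + 0 *\<^sub>R h) = (1 - 0) * h1_variation P (u + z *\<^sub>R h) h"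
    using MVT2[of 0 1 "\<lambda>s. G_h1 P (u + s *\<^sub>R h)" "\<lambda>s. h1_variation P (u + s *\<^sub>R h) h"]
      G_h1_line_derivative[OF G_h1_bipoly_has_derivative[OF P(1)]] by auto
  have "6 * N\<^sup>2 * d \<le> e"
    unfolding d_def using e den by (simp add: divide_le_eq mult_left_mono)
  moreover have "G_h1 P (u + h) - G_h1 P u = h1_variation P (u + z *\<^sub>R h) h" using z(3) by simp
  moreover have "z \<in> {0..1}" using z by auto
  note g[of 0] g[of 1] v[OF this] B[OF this]
  ultimately show "\<bar>G_h1 K (u + h) - G_h1 K u - A\<bar> \<le> B + e"
    by (simp add: abs_le_iff)
qed

text \<open>A weak isoperimetric inequality, obtained by comparing \<open>u\<close> with its mean. It only looks at \<open>K\<close> in the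
  disc that contains the curve, so that it can be applied to \<open>K - K\<^sub>0\<close> far from the origin.\<close>

lemma G_h1_isoperimetric:
  assumes K: "continuous_on UNIV K" and C: "\<And>z. norm (z - h1_mean u) \<le> length_h1 u \<Longrightarrow> \<bar>K z\<bar> \<le> C"
  shows "\<bar>G_h1 K u\<bar> \<le> C * (length_h1 u)\<^sup>2"
proof -
  define p where "p = h1_const (h1_mean u)"
  have C0: "0 \<le> C" using C[of "h1_mean u"] by (simp add: order_trans[OF abs_ge_zero])
  have cb: "norm (h1_fun (h1_centre u) t) \<le> length_h1 u" for t
    using h1_sup_norm_mean_zero[of "h1_centre u" t] by simp
  have "\<bar>G_h1 K (p + h1_centre u) - G_h1 K p - 0\<bar> \<le> C * (length_h1 u)\<^sup>2"
  proof (rule G_h1_increment[OF K])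
    fix s :: real assume s: "s \<in> {0..1}"
    have "\<bar>h1_variation K (p + s *\<^sub>R h1_centre u) (h1_centre u)\<bar> \<le>
        C * length_h1 (p + s *\<^sub>R h1_centre u) * length_h1 u"
    proof (rule h1_variation_bound[OF K _ C0 cb])
      fix t :: real
      have "\<bar>s\<bar> * norm (h1_fun (h1_centre u) t) \<le> 1 * length_h1 u"
        using s cb by (intro mult_mono) auto
      then show "\<bar>K (h1_fun (p + s *\<^sub>R h1_centre u) t)\<bar> \<le> C"
        by (intro C) (simp add: p_def)
    qed auto
    also have "length_h1 (p + s *\<^sub>R h1_centre u) = \<bar>s\<bar> * length_h1 u"
      using length_h1_add_const[of "s *\<^sub>R h1_centre u" "h1_mean u"] by (simp add: p_def add.commute)
    also have "C * (\<bar>s\<bar> * length_h1 u) * length_h1 u \<le> C * (1 * length_h1 u) * length_h1 u"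
      using s C0 by (intro mult_left_mono mult_right_mono) auto
    finally show "\<bar>h1_variation K (p + s *\<^sub>R h1_centre u) (h1_centre u) - 0\<bar> \<le> C * (length_h1 u)\<^sup>2"
      by (simp add: power2_eq_square)
  qed
  moreover have "p + h1_centre u = u" by (simp add: p_def h1_centre_def)
  ultimately show ?thesis by (simp add: p_def)
qed

lemma h1_force_diff_le:
  assumes K: "continuous_on UNIV K" and M: "\<And>z. \<bar>K z\<bar> \<le> M"
    and d: "\<And>t. t \<in> {0..1} \<Longrightarrow> \<bar>K (h1_fun u t) - K (h1_fun w t)\<bar> \<le> d"
  shows "L2n (\<lambda>t. h1_force K u t - h1_force K w t) \<le> d * length_h1 u + M * length_h1 (u - w)"
proof -
  have [measurable]: "K \<in> borel_measurable borel" by (rule borel_measurable_continuous_onI[OF K])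
  have M0: "0 \<le> M" using M[of 0] by linarith
  have d0: "0 \<le> d" using d[of 0] by simp
  have [measurable]: "h1_force K u \<in> borel_measurable borel" "h1_force K w \<in> borel_measurable borel"
    using h1_force_sq_int[OF K] sq_int_measurable by blast+
  define a where "a = (\<lambda>t. (complex_of_real (K (h1_fun u t) - K (h1_fun w t)) * \<i>) * h1_deriv u t)"
  define b where "b = (\<lambda>t. (complex_of_real (K (h1_fun w t)) * \<i>) * h1_deriv (u - w) t)"
  have sa: "sq_int a" unfolding a_def
    by (rule sq_int_mult_bounded[OF h1_sq_int, of _ d]) (use d in \<open>auto simp: norm_mult simp flip: of_real_diff\<close>)
  have sb: "sq_int b" unfolding b_def
    by (rule sq_int_mult_bounded[OF h1_sq_int, of _ M]) (use M in \<open>auto simp: norm_mult\<close>)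
  note [measurable] = sq_int_measurable[OF sa] sq_int_measurable[OF sb]
  have "I01 (\<lambda>t. (norm (h1_force K u t - h1_force K w t))\<^sup>2) = I01 (\<lambda>t. (norm (a t + b t))\<^sup>2)"
  proof (rule I01_cong_AE)
    show "AE t\<in>{0..1} in lborel. (norm (h1_force K u t - h1_force K w t))\<^sup>2 = (norm (a t + b t))\<^sup>2"
      using h1_deriv_diff[of u w]
    proof eventually_elim
      case (elim t)
      have "h1_force K u t - h1_force K w t = a t + b t" if "t \<in> {0..1}"
      proof -
        have "h1_deriv u t = h1_deriv w t + h1_deriv (u - w) t" using elim that by simp
        then show ?thesis unfolding a_def b_def h1_force_def by (simp add: algebra_simps)
      qed
      then show ?case by simp
    qed
  qed measurable
  then have "L2n (\<lambda>t. h1_force K u t - h1_force K w t) = L2n (\<lambda>t. a t + b t)" by (simp add: L2n_def)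
  also have "\<dots> \<le> L2n a + L2n b" by (rule L2n_add[OF sa sb])
  also have "L2n a \<le> d * length_h1 u"
    unfolding a_def length_h1_L2n
    by (rule L2n_mult_le) (use d d0 in \<open>auto simp: norm_mult simp flip: of_real_diff\<close>)
  also have "L2n b \<le> M * length_h1 (u - w)"
    unfolding b_def length_h1_L2n
    by (rule L2n_mult_le) (use M M0 in \<open>auto simp: norm_mult\<close>)
  finally show ?thesis by simp
qed

lemma h1_variation_diff_le:
  assumes K: "continuous_on UNIV K" and M: "\<And>z. \<bar>K z\<bar> \<le> M"
    and d: "\<And>t. t \<in> {0..1} \<Longrightarrow> \<bar>K (h1_fun u t) - K (h1_fun w t)\<bar> \<le> d"
  shows "\<bar>h1_variation K u h - h1_variation K w h\<bar> \<le> (d * length_h1 u + M * length_h1 (u - w)) * (2 * norm h)"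
proof -
  have s: "sq_int (\<lambda>t. h1_force K u t - h1_force K w t)" by (intro sq_int_diff h1_force_sq_int K)
  have "h1_variation K u h - h1_variation K w h = I01 (\<lambda>t. (h1_force K u t - h1_force K w t) \<bullet> h1_fun h t)"
    unfolding h1_variation_def inner_diff_left
    by (rule set_integral_diff(2)[symmetric]) (intro sq_int_inner_int01 h1_force_sq_int K h1_fun_sq_int)+
  also have "\<bar>\<dots>\<bar> \<le> L2n (\<lambda>t. h1_force K u t - h1_force K w t) * L2n (h1_fun h)"
    by (rule L2_Cauchy_Schwarz_inner[OF s h1_fun_sq_int])
  also have "\<dots> \<le> (d * length_h1 u + M * length_h1 (u - w)) * (2 * norm h)"
    using order_trans[OF L2n_nonneg h1_force_diff_le[OF K M d]]
    by (intro mult_mono h1_force_diff_le[OF K M d] L2n_le_bound h1_fun_sq_int) (auto simp: h1_sup_norm)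
  finally show ?thesis .
qed

lemma G_h1_has_derivative:
  assumes K: "uniformly_continuous_on UNIV K" and M: "\<And>z. \<bar>K z\<bar> \<le> M"
  shows "(G_h1 K has_derivative h1_variation K u) (at u)"
proof -
  have cK: "continuous_on UNIV K" by (rule uniformly_continuous_imp_continuous[OF K])
  have M0: "0 \<le> M" using M[of 0] by linarith
  have bl: "bounded_linear (h1_variation K u)"
  proof (rule bounded_linear_intro)
    show "h1_variation K u (x + y) = h1_variation K u x + h1_variation K u y" for x y
      by (rule h1_variation_add[OF cK])
    show "h1_variation K u (r *\<^sub>R x) = r *\<^sub>R h1_variation K u x" for r x by (simp add: h1_variation_scaleR)
    show "norm (h1_variation K u x) \<le> norm x * (M * length_h1 u * 2)" for x
      using h1_variation_bound[OF cK M M0 h1_sup_norm[of x], of u] by (simp add: mult_ac)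
  qed
  show ?thesis
    unfolding has_derivative_at_alt
  proof (intro conjI bl allI impI)
    fix e :: real assume e: "0 < e"
    define L where "L = length_h1 u"
    have L0: "0 \<le> L" by (simp add: L_def)
    define d where "d = e / (4 * (L + 1))"
    have d: "0 < d" using e L0 by (simp add: d_def)
    obtain r where r: "0 < r" "\<And>x y. dist x y < r \<Longrightarrow> dist (K x) (K y) < d"
      using K d unfolding uniformly_continuous_on_def by (metis UNIV_I)
    define \<delta> where "\<delta> = min (r / 2) (min 1 (e / (4 * (M + 1))))"
    have "0 < \<delta>" using r e M0 by (simp add: \<delta>_def)
    moreover have "norm (G_h1 K y - G_h1 K u - h1_variation K u (y - u)) \<le> e * norm (y - u)"
      if y: "norm (y - u) < \<delta>" for y
    proof -
      define h where "h = y - u"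
      have h: "norm h < r / 2" "norm h < 1" "norm h < e / (4 * (M + 1))" using y by (auto simp: h_def \<delta>_def)
      have "\<bar>G_h1 K (u + h) - G_h1 K u - h1_variation K u h\<bar> \<le> e * norm h"
      proof (rule G_h1_increment[OF cK])
        fix s :: real assume s: "s \<in> {0..1}"
        have sh: "norm (s *\<^sub>R h) \<le> norm h" using s mult_right_mono[of "\<bar>s\<bar>" 1 "norm h"] by auto
        have k: "\<bar>K (h1_fun (u + s *\<^sub>R h) t) - K (h1_fun u t)\<bar> \<le> d" for t
        proof -
          have "norm (h1_fun (s *\<^sub>R h) t) < r" using h1_sup_norm[of "s *\<^sub>R h" t] sh h by linarith
          then show ?thesis
            using r(2)[of "h1_fun (u + s *\<^sub>R h) t" "h1_fun u t"] by (simp add: dist_norm)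
        qed
        have ls: "length_h1 (s *\<^sub>R h) \<le> norm h" using length_le_norm[of "s *\<^sub>R h"] sh by linarith
        have "length_h1 (u + s *\<^sub>R h) \<le> L + 1"
          using length_h1_triangle[of u "s *\<^sub>R h"] ls h by (simp add: L_def)
        then have "d * length_h1 (u + s *\<^sub>R h) \<le> d * (L + 1)" using d by (intro mult_left_mono) auto
        also have "\<dots> = e / 4"
        proof -
          have "L + 1 \<noteq> 0" using L0 by linarith
          then show ?thesis by (simp add: d_def del: distrib_left_numeral)
        qed
        finally have 1: "d * length_h1 (u + s *\<^sub>R h) \<le> e / 4" .
        have "M * length_h1 (s *\<^sub>R h) \<le> (M + 1) * (e / (4 * (M + 1)))"
          using ls h M0 by (intro mult_mono) auto
        also have "\<dots> = e / 4"
        proof -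
          have "M + 1 \<noteq> 0" using M0 by linarith
          then show ?thesis by (simp del: distrib_left_numeral)
        qed
        finally have 2: "M * length_h1 (s *\<^sub>R h) \<le> e / 4" .
        have "\<bar>h1_variation K (u + s *\<^sub>R h) h - h1_variation K u h\<bar> \<le>
            (d * length_h1 (u + s *\<^sub>R h) + M * length_h1 (u + s *\<^sub>R h - u)) * (2 * norm h)"
          by (rule h1_variation_diff_le[OF cK M k])
        also have "\<dots> \<le> (e / 4 + e / 4) * (2 * norm h)"
          using 1 2 by (intro mult_right_mono add_mono) auto
        finally show "\<bar>h1_variation K (u + s *\<^sub>R h) h - h1_variation K u h\<bar> \<le> e * norm h" by simp
      qed
      then show ?thesis by (simp add: h_def)
    qed
    ultimately show "\<exists>d>0. \<forall>y. norm (y - u) < d \<longrightarrow>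
        norm (G_h1 K y - G_h1 K u - h1_variation K u (y - u)) \<le> e * norm (y - u)" by blast
  qed
qed

section \<open>The gradient of the energy\<close>

lemma set_integral_Re:
  "int01 f \<Longrightarrow> I01 (\<lambda>t. Re (f t)) = Re (I01 f)"
  unfolding set_lebesgue_integral_def set_integrable_def
  by (subst integral_Re[symmetric]) auto

lemma h1_integration_by_parts:
  assumes "l2_deriv (h1_fun u) v"
  shows "I01 (\<lambda>t. h1_fun u t \<bullet> h1_deriv h t) = - I01 (\<lambda>t. v t \<bullet> h1_fun h t)"
proof -
  \<comment> \<open>the scalar product is the real part of a complex product with one factor conjugated\<close>
  have d: "l2_deriv (h1_fun (h1_map cnj u)) (\<lambda>t. cnj (v t))"
    by (rule h1_map_l2_deriv[OF bounded_linear_cnj assms])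
  have ip: "x \<bullet> y = Re (cnj x * y)" for x y :: complex by (simp add: inner_complex_def)
  have "I01 (\<lambda>t. h1_fun u t \<bullet> h1_deriv h t) = Re (h1_form (h1_map cnj u) h)"
    unfolding h1_form_def ip
    using set_integral_Re[OF sq_int_int01[OF h1_prod_sq_int(2)[of "h1_map cnj u" h]]]
    by (simp add: h1_fun_map[OF bounded_linear_cnj])
  also have "h1_form (h1_map cnj u) h = - I01 (\<lambda>t. h1_fun h t * cnj (v t))"
    unfolding h1_form_antisym[of "h1_map cnj u"] h1_form_eq[OF d] ..
  also have "Re \<dots> = - I01 (\<lambda>t. Re (h1_fun h t * cnj (v t)))"
    using set_integral_Re[OF sq_int_mult_int01[OF h1_fun_sq_int l2_deriv_sq_int[OF d]], of h] by simp
  finally show ?thesis by (simp add: ip mult.commute)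
qed

text \<open>The representative solves \<open>g'' = I01 f - f\<close> with periodic boundary values: \<open>\<Phi>\<close> is the primitive of
  \<open>f - I01 f\<close> of mean zero and \<open>g\<close> a primitive of \<open>-\<Phi>\<close>. The explicit form is what yields compactness
  and regularity later on.\<close>

lemma h1_riesz_exists:
  assumes f: "sq_int f"
  obtains \<Phi> g where "l2_deriv (h1_fun \<Phi>) (\<lambda>t. f t - I01 f)" "h1_mean \<Phi> = 0"
    "l2_deriv (h1_fun g) (\<lambda>t. - h1_fun \<Phi> t)" "h1_mean g = I01 f"
    "\<And>h. inner g h = I01 (\<lambda>t. f t \<bullet> h1_fun h t)"
proof -
  have c: "sq_int (\<lambda>_. I01 f)" by (rule sq_int_bounded[of _ "norm (I01 f)"]) auto
  have "I01 (\<lambda>t. f t - I01 f) = 0"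
    using set_integral_diff(2)[OF sq_int_int01[OF f] int01_const] by simp
  then obtain \<Phi> where P: "l2_deriv (h1_fun \<Phi>) (\<lambda>t. f t - I01 f)" "h1_mean \<Phi> = 0"
    using h1_exists_primitive[OF sq_int_diff[OF f c], where m = 0] by blast
  have "I01 (\<lambda>t. - h1_fun \<Phi> t) = 0"
    using P(2) by (simp add: h1_mean_def set_lebesgue_integral_def)
  moreover have "sq_int (\<lambda>t. - h1_fun \<Phi> t)" using sq_int_cmult[OF h1_fun_sq_int, of "-1"] by simp
  ultimately obtain g where g: "l2_deriv (h1_fun g) (\<lambda>t. - h1_fun \<Phi> t)" "h1_mean g = I01 f"
    using h1_exists_primitive[where m = "I01 f"] by blast
  have "inner g h = I01 (\<lambda>t. f t \<bullet> h1_fun h t)" for h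
  proof -
    have "inner g h = I01 (\<lambda>t. - h1_fun \<Phi> t \<bullet> h1_deriv h t) + I01 f \<bullet> h1_mean h"
      using inner_h1_eq[OF g(1) h1_deriv] g(2) by (simp add: h1_mean_def)
    also have "I01 (\<lambda>t. - h1_fun \<Phi> t \<bullet> h1_deriv h t) = I01 (\<lambda>t. (f t - I01 f) \<bullet> h1_fun h t)"
      using h1_integration_by_parts[OF P(1), of h] by (simp add: set_lebesgue_integral_def)
    also have "\<dots> = I01 (\<lambda>t. f t \<bullet> h1_fun h t) - I01 (\<lambda>t. I01 f \<bullet> h1_fun h t)"
      unfolding inner_diff_left
      by (intro set_integral_diff sq_int_inner_int01 f c h1_fun_sq_int)
    also have "I01 (\<lambda>t. I01 f \<bullet> h1_fun h t) = I01 f \<bullet> h1_mean h"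
    proof -
      have "I01 f \<bullet> h1_mean h = (\<integral>t. I01 f \<bullet> (indicat_real {0..1} t *\<^sub>R h1_fun h t) \<partial>lborel)"
        unfolding h1_mean_def set_lebesgue_integral_def[of _ _ "h1_fun h"]
        by (rule integral_inner_right[symmetric]) (use h1_fun_int01[of h] in \<open>simp add: set_integrable_def\<close>)
      then show ?thesis by (simp add: set_lebesgue_integral_def)
    qed
    finally show ?thesis by simp
  qed
  then show ?thesis using that[OF P g] by blast
qed

definition h1_riesz :: "(real \<Rightarrow> complex) \<Rightarrow> h1" where
  "h1_riesz f = (SOME g. \<forall>h. inner g h = I01 (\<lambda>t. f t \<bullet> h1_fun h t))"

lemma inner_h1_riesz:
  assumes "sq_int f" shows "inner (h1_riesz f) h = I01 (\<lambda>t. f t \<bullet> h1_fun h t)"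
proof -
  have "\<exists>g. \<forall>h. inner g h = I01 (\<lambda>t. f t \<bullet> h1_fun h t)"
    by (rule h1_riesz_exists[OF assms]) blast
  then have "\<forall>h. inner (h1_riesz f) h = I01 (\<lambda>t. f t \<bullet> h1_fun h t)"
    unfolding h1_riesz_def by (rule someI_ex)
  then show ?thesis by blast
qed

lemma h1_riesz_eqI:
  assumes "sq_int f" "\<And>h. inner g h = I01 (\<lambda>t. f t \<bullet> h1_fun h t)" shows "h1_riesz f = g"
proof -
  have "inner (h1_riesz f - g) (h1_riesz f - g) = 0"
    using assms by (simp add: inner_diff_left[of "h1_riesz f" g] inner_h1_riesz)
  then show ?thesis by simp
qed

lemma h1_riesz_structure:
  assumes f: "sq_int f"
  obtains \<Phi> where "l2_deriv (h1_fun \<Phi>) (\<lambda>t. f t - I01 f)" "h1_mean \<Phi> = 0"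
    "l2_deriv (h1_fun (h1_riesz f)) (\<lambda>t. - h1_fun \<Phi> t)" "h1_mean (h1_riesz f) = I01 f"
  using h1_riesz_exists[OF f] h1_riesz_eqI[OF f] by metis

lemma h1_riesz_diff:
  assumes "sq_int f" "sq_int g" shows "h1_riesz (\<lambda>t. f t - g t) = h1_riesz f - h1_riesz g"
proof (rule h1_riesz_eqI)
  show "sq_int (\<lambda>t. f t - g t)" by (intro sq_int_diff assms)
  fix h
  show "inner (h1_riesz f - h1_riesz g) h = I01 (\<lambda>t. (f t - g t) \<bullet> h1_fun h t)"
    unfolding inner_diff_left inner_h1_riesz[OF assms(1)] inner_h1_riesz[OF assms(2)]
    by (rule set_integral_diff(2)[symmetric]) (intro sq_int_inner_int01 assms h1_fun_sq_int)+
qed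

lemma norm_h1_riesz_le:
  assumes f: "sq_int f" shows "norm (h1_riesz f) \<le> 2 * L2n f"
proof -
  have "(norm (h1_riesz f))\<^sup>2 = I01 (\<lambda>t. f t \<bullet> h1_fun (h1_riesz f) t)"
    using inner_h1_riesz[OF f, of "h1_riesz f"] by (simp add: power2_norm_eq_inner)
  also have "\<dots> \<le> L2n f * L2n (h1_fun (h1_riesz f))"
    using L2_Cauchy_Schwarz_inner[OF f h1_fun_sq_int, of "h1_riesz f"] by linarith
  also have "\<dots> \<le> L2n f * (2 * norm (h1_riesz f))"
    by (intro mult_left_mono L2n_le_bound h1_fun_sq_int h1_sup_norm) auto
  finally have *: "norm (h1_riesz f) * norm (h1_riesz f) \<le> (2 * L2n f) * norm (h1_riesz f)"
    by (simp add: power2_eq_square mult_ac)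
  show ?thesis
  proof (cases "norm (h1_riesz f) = 0")
    case False
    then have "0 < norm (h1_riesz f)" by simp
    then show ?thesis using * by (rule mult_right_le_imp_le[rotated])
  qed simp
qed

text \<open>The gradient with respect to the scalar product of \<open>H\<^sup>1\<close>; the first summand is the gradient of the
  length.\<close>

definition energy_gradient :: "(complex \<Rightarrow> real) \<Rightarrow> real \<Rightarrow> h1 \<Rightarrow> h1" where
  "energy_gradient K lam u = sgn (h1_centre u) + lam *\<^sub>R h1_riesz (h1_force K u)"

lemma inner_h1_centre_const [simp]: "inner (h1_centre u) (h1_const z) = 0"
proof -
  have "l2_deriv (h1_fun (h1_const z)) (\<lambda>_. 0)" by (simp add: h1_const.rep_eq l2_deriv_const)
  from inner_h1_eq[OF h1_deriv this, of "h1_centre u"] show ?thesis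
    by (simp add: h1_mean_def[symmetric])
qed

lemma bounded_linear_h1_centre: "bounded_linear h1_centre"
  by (rule bounded_linear_intro[where K = 1])
    (auto simp: h1_centre_add h1_centre_scaleR length_le_norm)

lemma length_h1_has_derivative:
  assumes "0 < length_h1 u"
  shows "(length_h1 has_derivative (\<lambda>h. inner (sgn (h1_centre u)) h)) (at u)"
proof -
  have nz: "h1_centre u \<noteq> 0" using assms norm_h1_centre[of u] by (metis norm_zero order_less_irrefl)
  have "((\<lambda>u. norm (h1_centre u)) has_derivative (\<lambda>h. inner (h1_centre h) (sgn (h1_centre u)))) (at u)"
    by (rule has_derivative_compose[OF bounded_linear_imp_has_derivative[OF bounded_linear_h1_centre] has_derivative_norm[OF nz]])
  moreover have "inner (h1_centre h) (sgn (h1_centre u)) = inner (sgn (h1_centre u)) h" for h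
  proof -
    have "inner (h1_centre u) (h1_centre h) = inner (h1_centre u) h"
      by (simp add: h1_centre_def[of h] inner_diff_right)
    then show ?thesis by (simp add: sgn_div_norm inner_commute)
  qed
  moreover have "(\<lambda>u. norm (h1_centre u)) = length_h1" by (simp add: fun_eq_iff)
  ultimately show ?thesis by simp
qed

lemma energy_has_derivative:
  assumes K: "uniformly_continuous_on UNIV K" and M: "\<And>z. \<bar>K z\<bar> \<le> M" and u: "0 < length_h1 u"
  shows "(energy K lam has_derivative (\<lambda>h. inner (energy_gradient K lam u) h)) (at u)"
proof -
  have "((\<lambda>u. length_h1 u + lam * G_h1 K u) has_derivative
     (\<lambda>h. inner (sgn (h1_centre u)) h + lam * h1_variation K u h)) (at u)"
    by (intro has_derivative_add length_h1_has_derivative u has_derivative_mult_right G_h1_has_derivative[OF K M])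
  moreover have "h1_variation K u h = inner (h1_riesz (h1_force K u)) h" for h
    using inner_h1_riesz[OF h1_force_sq_int[OF uniformly_continuous_imp_continuous[OF K]]]
    by (simp add: h1_variation_def)
  ultimately show ?thesis
    by (simp add: energy_gradient_def energy_def[abs_def] inner_add_left)
qed

lemma energy_continuous:
  assumes K: "uniformly_continuous_on UNIV K" and M: "\<And>z. \<bar>K z\<bar> \<le> M"
  shows "continuous_on S (energy K lam)"
proof -
  have "isCont (G_h1 K) u" for u using G_h1_has_derivative[OF K M] has_derivative_continuous by blast
  moreover have "isCont length_h1 u" for u unfolding isCont_def by (intro tendsto_intros)
  ultimately have "isCont (energy K lam) u" for u unfolding energy_def[abs_def] by (intro continuous_intros)
  then show ?thesis by (simp add: continuous_at_imp_continuous_on)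
qed

text \<open>Normalising is Lipschitz away from the origin, as
  \<open>x/\<bar>x\<bar> - y/\<bar>y\<bar> = (x - y)/\<bar>x\<bar> + (1/\<bar>x\<bar> - 1/\<bar>y\<bar>) y\<close>.\<close>

lemma sgn_diff_le:
  fixes x y :: "'a::real_inner"
  assumes "x \<noteq> 0" "y \<noteq> 0" shows "norm (sgn x - sgn y) \<le> 2 * norm (x - y) / norm x"
proof -
  have "sgn x - sgn y = inverse (norm x) *\<^sub>R (x - y) + (inverse (norm x) - inverse (norm y)) *\<^sub>R y"
    by (simp add: sgn_div_norm algebra_simps)
  also have "norm \<dots> \<le> norm (inverse (norm x) *\<^sub>R (x - y)) + norm ((inverse (norm x) - inverse (norm y)) *\<^sub>R y)"
    by (rule norm_triangle_ineq)
  also have "norm ((inverse (norm x) - inverse (norm y)) *\<^sub>R y) = \<bar>norm y - norm x\<bar> / norm x"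
  proof -
    have "(inverse (norm x) - inverse (norm y)) * norm y = (norm y - norm x) / norm x"
      using assms by (simp add: field_simps)
    then have "\<bar>inverse (norm x) - inverse (norm y)\<bar> * norm y = \<bar>(norm y - norm x) / norm x\<bar>"
      by (metis abs_mult abs_norm_cancel)
    then show ?thesis by simp
  qed
  also have "\<dots> \<le> norm (x - y) / norm x"
    using norm_triangle_ineq3[of x y] by (intro divide_right_mono) auto
  also have "norm (inverse (norm x) *\<^sub>R (x - y)) = norm (x - y) / norm x"
    by (simp add: divide_inverse mult.commute)
  finally show ?thesis by simp
qed

lemma energy_gradient_diff_le:
  assumes K: "continuous_on UNIV K" and M: "\<And>z. \<bar>K z\<bar> \<le> M"
    and d: "\<And>t. t \<in> {0..1} \<Longrightarrow> \<bar>K (h1_fun u t) - K (h1_fun w t)\<bar> \<le> d"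
    and u: "0 < length_h1 u" "0 < length_h1 w"
  shows "norm (energy_gradient K lam u - energy_gradient K lam w) \<le>
    2 * length_h1 (u - w) / length_h1 u + \<bar>lam\<bar> * (2 * (d * length_h1 u + M * length_h1 (u - w)))"
proof -
  have nz: "h1_centre u \<noteq> 0" "h1_centre w \<noteq> 0"
    using u norm_h1_centre by (metis norm_zero order_less_irrefl)+
  have "energy_gradient K lam u - energy_gradient K lam w = (sgn (h1_centre u) - sgn (h1_centre w)) +
     lam *\<^sub>R h1_riesz (\<lambda>t. h1_force K u t - h1_force K w t)"
    by (simp add: energy_gradient_def h1_riesz_diff h1_force_sq_int[OF K] algebra_simps)
  also have "norm \<dots> \<le> norm (sgn (h1_centre u) - sgn (h1_centre w)) +
     norm (lam *\<^sub>R h1_riesz (\<lambda>t. h1_force K u t - h1_force K w t))" by (rule norm_triangle_ineq)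
  also have "norm (sgn (h1_centre u) - sgn (h1_centre w)) \<le> 2 * length_h1 (u - w) / length_h1 u"
    using sgn_diff_le[OF nz] by (simp flip: h1_centre_diff)
  also have "norm (lam *\<^sub>R h1_riesz (\<lambda>t. h1_force K u t - h1_force K w t)) \<le>
     \<bar>lam\<bar> * (2 * (d * length_h1 u + M * length_h1 (u - w)))"
    using order_trans[OF norm_h1_riesz_le[OF sq_int_diff[OF h1_force_sq_int[OF K] h1_force_sq_int[OF K]]]
       mult_left_mono[OF h1_force_diff_le[OF K M d], of 2]]
    by (simp add: mult_left_mono)
  finally show ?thesis by simp
qed

text \<open>The estimate is uniform over all positions of the curve in the plane, because \<open>K\<close> is uniformly
  continuous on the whole plane. This is what allows paths to be deformed in a single step.\<close>

lemma energy_gradient_uniformly_continuous: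
  assumes K: "uniformly_continuous_on UNIV K" and M: "\<And>z. \<bar>K z\<bar> \<le> M"
    and l: "0 < l" and e: "0 < e"
  obtains d where "0 < d"
    "\<And>u w. l \<le> length_h1 u \<Longrightarrow> length_h1 u \<le> L \<Longrightarrow> norm (u - w) \<le> d \<Longrightarrow>
      0 < length_h1 w \<and> norm (energy_gradient K lam u - energy_gradient K lam w) \<le> e"
proof -
  have cK: "continuous_on UNIV K" by (rule uniformly_continuous_imp_continuous[OF K])
  have M0: "0 \<le> M" using M[of 0] by linarith
  \<comment> \<open>the constants make each of the three terms in \<open>energy_gradient_diff_le\<close> at most \<open>e / 3\<close>\<close>
  define a where "a = e / (6 * (\<bar>lam\<bar> + 1) * (\<bar>L\<bar> + 1))"
  have a: "0 < a" using e by (auto simp: a_def intro!: divide_pos_pos mult_pos_pos)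
  obtain r where r: "0 < r" "\<And>x y. dist x y < r \<Longrightarrow> dist (K x) (K y) < a"
    using K a unfolding uniformly_continuous_on_def by (metis UNIV_I)
  define d where "d = min (min (l / 2) (r / 4)) (min (l * e / 6) (e / (6 * (\<bar>lam\<bar> + 1) * (M + 1))))"
  have "0 < d" using l r e M0 by (auto simp: d_def intro!: divide_pos_pos mult_pos_pos)
  then show ?thesis
  proof (rule that)
    fix u w assume u: "l \<le> length_h1 u" "length_h1 u \<le> L" and uw: "norm (u - w) \<le> d"
    have dd: "d \<le> l / 2" "d \<le> r / 4" "d \<le> l * e / 6" "d \<le> e / (6 * (\<bar>lam\<bar> + 1) * (M + 1))"
      unfolding d_def by linarith+
    have luw: "length_h1 (u - w) \<le> d" using length_le_norm[of "u - w"] uw by linarith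
    have w: "0 < length_h1 w" using length_h1_diff_le[of u w] luw dd(1) u l by linarith
    have k: "\<bar>K (h1_fun u t) - K (h1_fun w t)\<bar> \<le> a" for t
    proof -
      have "norm (h1_fun (u - w) t) < r" using h1_sup_norm[of "u - w" t] uw dd(2) r(1) by linarith
      then show ?thesis using r(2)[of "h1_fun u t" "h1_fun w t"] by (simp add: dist_norm)
    qed
    have "norm (energy_gradient K lam u - energy_gradient K lam w) \<le>
      2 * length_h1 (u - w) / length_h1 u + \<bar>lam\<bar> * (2 * (a * length_h1 u + M * length_h1 (u - w)))"
      by (rule energy_gradient_diff_le[OF cK M k]) (use u l w in auto)
    moreover have "2 * length_h1 (u - w) / length_h1 u \<le> e / 3"
    proof -
      have "2 * length_h1 (u - w) / length_h1 u \<le> 2 * length_h1 (u - w) / l"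
        using u l by (intro divide_left_mono) auto
      also have "\<dots> \<le> 2 * (l * e / 6) / l"
        using order_trans[OF luw dd(3)] l by (intro divide_right_mono mult_left_mono) auto
      finally show ?thesis using l by simp
    qed
    moreover have "\<bar>lam\<bar> * (2 * (a * length_h1 u)) \<le> e / 3"
    proof -
      have "\<bar>lam\<bar> * (2 * (a * length_h1 u)) \<le> (\<bar>lam\<bar> + 1) * (2 * (a * (\<bar>L\<bar> + 1)))"
        using u a by (intro mult_mono) auto
      also have "\<dots> = 2 * ((\<bar>lam\<bar> + 1) * (\<bar>L\<bar> + 1) * a)" by (simp add: mult_ac)
      also have "(\<bar>lam\<bar> + 1) * (\<bar>L\<bar> + 1) * a = e / 6"
      proof -
        have "\<bar>lam\<bar> + 1 \<noteq> 0" "\<bar>L\<bar> + 1 \<noteq> 0" using abs_ge_zero[of lam] abs_ge_zero[of L] by linarith+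
        then show ?thesis by (simp add: a_def del: distrib_left_numeral)
      qed
      finally show ?thesis by simp
    qed
    moreover have "\<bar>lam\<bar> * (2 * (M * length_h1 (u - w))) \<le> e / 3"
    proof -
      have "\<bar>lam\<bar> * (2 * (M * length_h1 (u - w))) \<le> (\<bar>lam\<bar> + 1) * (2 * ((M + 1) * (e / (6 * (\<bar>lam\<bar> + 1) * (M + 1)))))"
        using luw dd(4) M0 by (intro mult_mono) auto
      also have "\<dots> = e / 3"
      proof -
        have "\<bar>lam\<bar> + 1 \<noteq> 0" "M + 1 \<noteq> 0" using abs_ge_zero[of lam] M0 by linarith+
        then show ?thesis by (simp del: distrib_left_numeral)
      qed
      finally show ?thesis .
    qed
    ultimately show "0 < length_h1 w \<and> norm (energy_gradient K lam u - energy_gradient K lam w) \<le> e"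
      using w by (simp add: distrib_left)
  qed
qed

section \<open>Compactness\<close>

text \<open>Taking the representative integrates twice. The first primitives \<open>\<Phi>\<^sub>n\<close> are bounded and uniformly
  Hoelder continuous, so the theorem of Arzela and Ascoli applies to them; they are minus the derivatives
  of the representatives, and uniform convergence of derivatives (with convergence of the means) implies
  convergence in \<open>H\<^sup>1\<close>.\<close>

lemma h1_riesz_compact:
  assumes f: "\<And>n. sq_int (f n)" and C: "\<And>n::nat. L2n (f n) \<le> C"
  obtains g k where "strict_mono (k :: nat \<Rightarrow> nat)" "(\<lambda>n. h1_riesz (f (k n))) \<longlonglongrightarrow> g"
proof -
  have C0: "0 \<le> C" using order_trans[OF L2n_nonneg C[of 0]] .
  have "\<exists>\<Phi>. l2_deriv (h1_fun \<Phi>) (\<lambda>t. f n t - I01 (f n)) \<and> h1_mean \<Phi> = 0 \<and>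
    l2_deriv (h1_fun (h1_riesz (f n))) (\<lambda>t. - h1_fun \<Phi> t) \<and> h1_mean (h1_riesz (f n)) = I01 (f n)" for n
    by (rule h1_riesz_structure[OF f]) blast
  then obtain \<Phi> where P: "\<And>n. l2_deriv (h1_fun (\<Phi> n)) (\<lambda>t. f n t - I01 (f n))" "\<And>n. h1_mean (\<Phi> n) = 0"
    "\<And>n. l2_deriv (h1_fun (h1_riesz (f n))) (\<lambda>t. - h1_fun (\<Phi> n) t)" "\<And>n. h1_mean (h1_riesz (f n)) = I01 (f n)"
    by metis
  have m: "norm (I01 (f n)) \<le> C" for n
  proof -
    have "norm (I01 (f n)) \<le> I01 (\<lambda>t. norm (f n t))" by (rule set_integral_norm_bound[OF sq_int_int01[OF f]])
    then show ?thesis using L1_le_L2n[OF f, of n] C[of n] by linarith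
  qed
  have LP: "length_h1 (\<Phi> n) \<le> 2 * C" for n
  proof -
    have c: "sq_int (\<lambda>_. - I01 (f n))" by (rule sq_int_bounded[of _ "norm (I01 (f n))"]) auto
    have "length_h1 (\<Phi> n) \<le> L2n (f n) + L2n (\<lambda>_. - I01 (f n))"
      using L2n_add[OF f c, of n] length_h1_eq_L2n[OF P(1), of n] by simp
    also have "L2n (\<lambda>_. - I01 (f n)) \<le> C" by (rule L2n_le_bound[OF c C0]) (simp add: m)
    finally show ?thesis using C[of n] by simp
  qed
  obtain \<phi> k where k: "continuous_on {0..1} \<phi>" "strict_mono (k :: nat \<Rightarrow> nat)"
    "\<And>e. 0 < e \<Longrightarrow> \<exists>N. \<forall>n x. n \<ge> N \<and> x \<in> {0..1} \<longrightarrow> norm (h1_fun (\<Phi> (k n)) x - \<phi> x) < e"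
  proof (rule Arzela_Ascoli[of "{0..1::real}" "\<lambda>n. h1_fun (\<Phi> n)" "2 * C"])
    show "norm (h1_fun (\<Phi> n) x) \<le> 2 * C" for n x
      using h1_sup_norm_mean_zero[OF P(2), of n x] LP[of n] by linarith
    fix x e :: real assume x: "x \<in> {0..1}" "0 < e"
    define d where "d = (e / (2 * C + 1))\<^sup>2"
    have "0 < d" using x C0 by (simp add: d_def)
    moreover have "norm (h1_fun (\<Phi> n) x - h1_fun (\<Phi> n) y) < e" if y: "y \<in> {0..1} \<and> norm (x - y) < d" for n y
    proof -
      have sq: "sqrt \<bar>x - y\<bar> \<le> e / (2 * C + 1)"
        using real_sqrt_le_mono[of "\<bar>x - y\<bar>" d] y x C0 by (simp add: d_def)
      have "norm (h1_fun (\<Phi> n) x - h1_fun (\<Phi> n) y) \<le> sqrt \<bar>x - y\<bar> * length_h1 (\<Phi> n)"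
        using h1_hoelder[of y x "\<Phi> n"] x y by simp
      also have "\<dots> \<le> (e / (2 * C + 1)) * (2 * C)"
        using sq LP[of n] x C0 by (intro mult_mono) auto
      also have "\<dots> < e" using x C0 by (simp add: divide_less_eq)
      finally show ?thesis .
    qed
    ultimately show "\<exists>d>0. \<forall>n y. y \<in> {0..1} \<and> norm (x - y) < d \<longrightarrow> norm (h1_fun (\<Phi> n) x - h1_fun (\<Phi> n) y) < e"
      by blast
  qed auto
  have "bounded (range (\<lambda>n. I01 (f (k n))))" unfolding bounded_iff using m by blast
  then obtain m0 j where j: "strict_mono (j :: nat \<Rightarrow> nat)" "((\<lambda>n. I01 (f (k n))) \<circ> j) \<longlonglongrightarrow> m0"
    using bounded_imp_convergent_subsequence by blast
  define r where "r = k \<circ> j"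
  have r: "strict_mono r" using k(2) j(1) by (simp add: r_def strict_mono_o)
  have um: "\<exists>N. \<forall>n\<ge>N. \<forall>x\<in>{0..1}. norm (h1_fun (\<Phi> (r n)) x - \<phi> x) < e" if e: "0 < e" for e
  proof -
    obtain N where N: "\<And>n x. n \<ge> N \<Longrightarrow> x \<in> {0..1} \<Longrightarrow> norm (h1_fun (\<Phi> (k n)) x - \<phi> x) < e"
      using k(3)[OF e] by blast
    have "j n \<ge> N" if "n \<ge> N" for n using seq_suble[OF j(1), of n] that by linarith
    with N have "\<forall>n\<ge>N. \<forall>x\<in>{0..1}. norm (h1_fun (\<Phi> (r n)) x - \<phi> x) < e"
      unfolding r_def o_def by blast
    then show ?thesis by blast
  qed
  define \<psi> where "\<psi> t = indicat_real {0..1} t *\<^sub>R \<phi> t" for t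
  have meas [measurable]: "\<psi> \<in> borel_measurable borel"
    unfolding \<psi>_def by (rule borel_measurable_continuous_on_indicator[OF _ k(1)]) simp
  have \<psi>: "\<psi> t = \<phi> t" if "t \<in> {0..1}" for t using that by (simp add: \<psi>_def)
  have "compact (\<phi> ` {0..1})" by (intro compact_continuous_image k compact_Icc)
  then obtain B where B: "\<And>t. t \<in> {0..1} \<Longrightarrow> norm (\<phi> t) \<le> B"
    using compact_imp_bounded bounded_iff by (metis imageI)
  have sq: "sq_int \<psi>" by (rule sq_int_bounded[OF meas, of B]) (use B \<psi> in auto)
  have sqn: "sq_int (\<lambda>t. - \<psi> t)" using sq_int_cmult[OF sq, of "-1"] by simp
  have I0: "I01 \<psi> = 0"
  proof -
    have "norm (I01 \<psi>) \<le> e" if e: "0 < e" for e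
    proof -
      obtain N where N: "\<forall>n\<ge>N. \<forall>x\<in>{0..1}. norm (h1_fun (\<Phi> (r n)) x - \<phi> x) < e" using um[OF e] by blast
      have "I01 (\<lambda>t. h1_fun (\<Phi> (r N)) t - \<psi> t) = - I01 \<psi>"
        using set_integral_diff(2)[OF h1_fun_int01[of "\<Phi> (r N)"] sq_int_int01[OF sq]] P(2)[of "r N"]
        by (simp add: h1_mean_def)
      moreover have "norm (I01 (\<lambda>t. h1_fun (\<Phi> (r N)) t - \<psi> t)) \<le> I01 (\<lambda>t. e)"
      proof (rule I01_norm_le)
        show "norm (h1_fun (\<Phi> (r N)) t - \<psi> t) \<le> e" if "t \<in> {0..1}" for t
          using N that \<psi>[OF that] by (auto intro: less_imp_le)
      qed (intro sq_int_int01 sq_int_diff h1_fun_sq_int sq int01_const)+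
      ultimately show ?thesis by simp
    qed
    then have "norm (I01 \<psi>) \<le> 0" by (rule dense_ge)
    then show ?thesis by simp
  qed
  have "I01 (\<lambda>t. - \<psi> t) = 0" using I0 by (simp add: set_lebesgue_integral_def)
  then obtain g where g: "l2_deriv (h1_fun g) (\<lambda>t. - \<psi> t)" "h1_mean g = m0"
    using h1_exists_primitive[OF sqn, where m = m0] by blast
  have "(\<lambda>n. h1_riesz (f (r n))) \<longlonglongrightarrow> g"
    unfolding LIMSEQ_iff
  proof (intro allI impI)
    fix e :: real assume e: "0 < e"
    obtain N where N: "\<forall>n\<ge>N. \<forall>x\<in>{0..1}. norm (h1_fun (\<Phi> (r n)) x - \<phi> x) < e / 2"
      using um[of "e / 2"] e by auto
    obtain N' where N': "\<forall>n\<ge>N'. norm (I01 (f (r n)) - m0) < e / 2"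
      using LIMSEQ_D[OF j(2), of "e / 2"] e by (auto simp: r_def)
    have "norm (h1_riesz (f (r n)) - g) < e" if n: "n \<ge> max N N'" for n
    proof -
      have "length_h1 (h1_riesz (f (r n)) - g) = L2n (\<lambda>t. - h1_fun (\<Phi> (r n)) t - - \<psi> t)"
        by (rule length_h1_eq_L2n[OF h1_l2_deriv_diff[OF P(3) g(1)]])
      also have "\<dots> \<le> e / 2"
      proof (rule L2n_le_bound)
        show "sq_int (\<lambda>t. - h1_fun (\<Phi> (r n)) t - - \<psi> t)"
          using sq_int_diff[OF sq h1_fun_sq_int] by simp
        show "norm (- h1_fun (\<Phi> (r n)) t - - \<psi> t) \<le> e / 2" if "t \<in> {0..1}" for t
          using N n that \<psi>[OF that] by (auto simp: norm_minus_commute intro!: less_imp_le)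
      qed (use e in auto)
      finally have 1: "length_h1 (h1_riesz (f (r n)) - g) \<le> e / 2" .
      have 2: "norm (h1_mean (h1_riesz (f (r n)) - g)) < e / 2"
        using N' n by (simp add: P(4) g(2))
      show ?thesis using 1 2 norm_h1_le[of "h1_riesz (f (r n)) - g"] by linarith
    qed
    then show "\<exists>no. \<forall>n\<ge>no. norm (h1_riesz (f (r n)) - g) < e" by blast
  qed
  with r show ?thesis by (rule that)
qed

section \<open>Critical points are loops of prescribed curvature\<close>

lemma h1_continuous_UNIV: "continuous_on UNIV (h1_fun u)"
proof -
  have per: "h1_fun u (t - of_int n) = h1_fun u t" for t n
    using h1_fun_frac[of u "t - of_int n"] h1_fun_frac[of u t] by (simp add: frac_def)
  have c: "continuous_on {of_int n..of_int n + 1} (h1_fun u)" for n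
  proof -
    have "continuous_on {of_int n..of_int n + 1} (\<lambda>t. h1_fun u (t - of_int n))"
      by (rule continuous_on_compose2[OF h1_continuous]) (auto intro!: continuous_intros)
    then show ?thesis by (simp only: per)
  qed
  have "isCont (h1_fun u) t" for t
  proof -
    define n where "n = \<lfloor>t\<rfloor>"
    have "continuous_on ({of_int (n - 1)..of_int (n - 1) + 1} \<union> {of_int n..of_int n + 1}) (h1_fun u)"
      by (intro continuous_on_closed_Un c closed_atLeastAtMost)
    then have "continuous_on {of_int n - 1<..<of_int n + 1} (h1_fun u)"
      by (rule continuous_on_subset) auto
    moreover have "t \<in> {of_int n - 1<..<of_int n + 1}" unfolding n_def by (simp; linarith)
    ultimately show ?thesis using continuous_on_eq_continuous_at open_greaterThanLessThan by blast
  qed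
  then show ?thesis by (simp add: continuous_at_imp_continuous_on)
qed

text \<open>The interval integral of \<open>v\<close> from 0 is a primitive of \<open>v\<close> on the whole line. It is periodic since its
  increment over one period does not depend on the starting point and is zero at 0.\<close>

lemma h1_C1:
  assumes d: "l2_deriv (h1_fun u) v" and v: "continuous_on UNIV v" and per: "\<And>t. v (t + 1) = v t"
  shows "(h1_fun u has_vector_derivative v t) (at t)"
proof -
  define W where "W t = (LBINT s=0..t. v s)" for t :: real
  have W: "(W has_vector_derivative v t) (at t)" for t
  proof -
    have "(W has_vector_derivative v t) (at t within {- \<bar>t\<bar> - 1..\<bar>t\<bar> + 1})"
      unfolding W_def zero_ereal_def
      by (rule interval_integral_FTC2) (auto intro: continuous_on_subset[OF v])
    then show ?thesis by (simp add: at_within_Icc_at)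
  qed
  have uW: "h1_fun u t = h1_fun u 0 + W t" if "t \<in> {0..1}" for t
  proof -
    have "W t = (LINT s:{0..t}|lborel. v s)"
      unfolding W_def zero_ereal_def by (rule interval_integral_Icc) (use that in auto)
    moreover have "h1_fun u t = h1_fun u 0 + (LINT s:{0..t}|lborel. v s)"
      using d that unfolding l2_deriv_def by blast
    ultimately show ?thesis by simp
  qed
  have "((\<lambda>t. W (t + 1) - W t) has_vector_derivative 0) (at t within UNIV)" for t
  proof -
    have "((\<lambda>t. W (t + 1)) has_vector_derivative 1 *\<^sub>R v (t + 1)) (at t)"
      by (rule vector_diff_chain_at[of "\<lambda>t. t + 1" 1 t W, unfolded o_def])
        (auto intro!: derivative_eq_intros W)
    from has_vector_derivative_diff[OF this W[of t]] show ?thesis by (simp add: per)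
  qed
  then obtain c where c: "\<And>t. W (t + 1) - W t = c"
    using has_vector_derivative_zero_constant[of UNIV "\<lambda>t. W (t + 1) - W t"] by auto
  have "c = 0" using c[of 0] uW[of 1] uW[of 0] h1_fun_1[of u] by simp
  then have Wp: "W (t + 1) = W t" for t using c[of t] by simp
  have "h1_fun u t = h1_fun u 0 + W t" for t
    using uW[of "frac t"] periodic_floor[of W t] Wp h1_fun_frac[of u t] frac_ge_0[of t] frac_lt_1[of t]
    by simp
  then have "h1_fun u = (\<lambda>t. h1_fun u 0 + W t)" by blast
  moreover have "((\<lambda>t. h1_fun u 0 + W t) has_vector_derivative v t) (at t)"
    using has_vector_derivative_add[OF has_vector_derivative_const W] by simp
  ultimately show ?thesis by simp
qed

text \<open>The Euler-Lagrange equation in integrated form. The mean of the gradient shows that the force has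
  mean zero, and then \<open>u' = L \<lambda> \<Phi>\<close> where \<open>\<Phi>\<close> is a primitive of the force.\<close>

lemma critical_point_structure:
  assumes K: "continuous_on UNIV K" and lam: "lam \<noteq> 0" and L: "0 < length_h1 u"
    and crit: "energy_gradient K lam u = 0"
  obtains p where "l2_deriv (h1_fun u) (h1_fun p)"
    "l2_deriv (h1_fun p) (\<lambda>t. of_real (length_h1 u * lam * K (h1_fun u t)) * (\<i> * h1_fun p t))"
proof -
  define L where "L = length_h1 u"
  have f: "sq_int (h1_force K u)" by (rule h1_force_sq_int[OF K])
  obtain \<Phi> where P: "l2_deriv (h1_fun \<Phi>) (\<lambda>t. h1_force K u t - I01 (h1_force K u))"
    "l2_deriv (h1_fun (h1_riesz (h1_force K u))) (\<lambda>t. - h1_fun \<Phi> t)"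
    "h1_mean (h1_riesz (h1_force K u)) = I01 (h1_force K u)"
    by (rule h1_riesz_structure[OF f])
  have c: "h1_centre u = (- (L * lam)) *\<^sub>R h1_riesz (h1_force K u)"
  proof -
    have "h1_centre u = L *\<^sub>R sgn (h1_centre u)" using L by (simp add: L_def sgn_div_norm)
    also have "sgn (h1_centre u) = - (lam *\<^sub>R h1_riesz (h1_force K u))"
      using crit by (simp add: energy_gradient_def add_eq_0_iff2)
    finally show ?thesis by simp
  qed
  have "h1_mean (h1_centre u) = (- (L * lam)) *\<^sub>R I01 (h1_force K u)"
    unfolding c h1_mean_scaleR P(3) ..
  then have z: "I01 (h1_force K u) = 0" using L lam by (simp add: L_def)
  define p where "p = (L * lam) *\<^sub>R \<Phi>"
  have "l2_deriv (h1_fun (h1_centre u)) (\<lambda>t. (- (L * lam)) *\<^sub>R - h1_fun \<Phi> t)"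
    unfolding c by (rule h1_l2_deriv_scaleR[OF P(2)])
  then have "l2_deriv (h1_fun (h1_centre u)) (h1_fun p)" by (simp add: p_def h1_fun_scaleR[abs_def])
  then have "l2_deriv (h1_fun (h1_const (h1_mean u) + h1_centre u)) (\<lambda>t. 0 + h1_fun p t)"
    by (intro h1_l2_deriv_add) (simp_all add: h1_const.rep_eq l2_deriv_const)
  then have up: "l2_deriv (h1_fun u) (h1_fun p)" using h1_centre_plus_mean[of u] by simp
  have "l2_deriv (h1_fun p) (\<lambda>t. (L * lam) *\<^sub>R h1_force K u t)"
    using h1_l2_deriv_scaleR[OF P(1), of "L * lam"] by (simp add: p_def z)
  then have "l2_deriv (h1_fun p) (\<lambda>t. of_real (length_h1 u * lam * K (h1_fun u t)) * (\<i> * h1_fun p t))"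
  proof (rule l2_deriv_cong_AE)
    have [measurable]: "K \<in> borel_measurable borel" by (rule borel_measurable_continuous_onI[OF K])
    show "(\<lambda>t. of_real (length_h1 u * lam * K (h1_fun u t)) * (\<i> * h1_fun p t)) \<in> borel_measurable borel"
      by measurable
    show "AE t\<in>{0..1} in lborel. (L * lam) *\<^sub>R h1_force K u t =
        of_real (length_h1 u * lam * K (h1_fun u t)) * (\<i> * h1_fun p t)"
      using h1_deriv_AE[OF up]
      by eventually_elim (simp add: h1_force_def L_def scaleR_conv_of_real)
  qed
  with up show ?thesis by (rule that)
qed

text \<open>The derivative \<open>p\<close> of a critical point has a continuous representative, so the equation for \<open>p'\<close>
  has a continuous right-hand side. That side is orthogonal to \<open>p\<close>, hence the speed is constant.\<close>

lemma critical_point_C2: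
  assumes K: "continuous_on UNIV K" and lam: "lam \<noteq> 0" and L: "0 < length_h1 u"
    and crit: "energy_gradient K lam u = 0"
  obtains p where "l2_deriv (h1_fun u) (h1_fun p)"
    "\<And>t. (h1_fun u has_vector_derivative h1_fun p t) (at t)"
    "\<And>t. (h1_fun p has_vector_derivative of_real (length_h1 u * lam * K (h1_fun u t)) * (\<i> * h1_fun p t)) (at t)"
    "\<And>t. norm (h1_fun p t) = length_h1 u"
proof -
  obtain p where p: "l2_deriv (h1_fun u) (h1_fun p)"
    "l2_deriv (h1_fun p) (\<lambda>t. of_real (length_h1 u * lam * K (h1_fun u t)) * (\<i> * h1_fun p t))"
    by (rule critical_point_structure[OF assms])
  have 1: "(h1_fun u has_vector_derivative h1_fun p t) (at t)" for t
    by (rule h1_C1[OF p(1) h1_continuous_UNIV h1_periodic])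
  have cK: "continuous_on UNIV (\<lambda>t. K (h1_fun u t))"
    by (rule continuous_on_compose2[OF K h1_continuous_UNIV]) auto
  have 2: "(h1_fun p has_vector_derivative of_real (length_h1 u * lam * K (h1_fun u t)) * (\<i> * h1_fun p t)) (at t)" for t
    by (rule h1_C1[OF p(2)]) (auto intro!: continuous_intros cK h1_continuous_UNIV simp: h1_periodic)
  have "((\<lambda>t. h1_fun p t \<bullet> h1_fun p t) has_vector_derivative 0) (at t within UNIV)" for t
  proof -
    have "((\<lambda>t. h1_fun p t \<bullet> h1_fun p t) has_derivative (\<lambda>s. h1_fun p t \<bullet> (s *\<^sub>R (of_real (length_h1 u * lam * K (h1_fun u t)) * (\<i> * h1_fun p t))) +
        (s *\<^sub>R (of_real (length_h1 u * lam * K (h1_fun u t)) * (\<i> * h1_fun p t))) \<bullet> h1_fun p t)) (at t)"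
      using 2[of t] unfolding has_vector_derivative_def by (intro has_derivative_inner)
    moreover have "h1_fun p t \<bullet> (s *\<^sub>R (of_real r * (\<i> * h1_fun p t))) = 0"
      "(s *\<^sub>R (of_real r * (\<i> * h1_fun p t))) \<bullet> h1_fun p t = 0" for s r
      by (simp_all add: inner_complex_def)
    ultimately have "((\<lambda>t. h1_fun p t \<bullet> h1_fun p t) has_derivative (\<lambda>s. 0 + 0)) (at t)"
      by (simp only:)
    then show ?thesis by (simp add: has_vector_derivative_def)
  qed
  then obtain c where c: "\<And>t. h1_fun p t \<bullet> h1_fun p t = c"
    using has_vector_derivative_zero_constant[of UNIV "\<lambda>t. h1_fun p t \<bullet> h1_fun p t"] by auto
  have c': "(norm (h1_fun p t))\<^sup>2 = c" for t using c[of t] by (simp add: power2_norm_eq_inner)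
  have "(length_h1 u)\<^sup>2 = c" unfolding length_h1_eq_L2n[OF p(1)] L2n_sq c' by simp
  then have "norm (h1_fun p t) = length_h1 u" for t
    using c'[of t] by (metis length_h1_nonneg norm_ge_zero power2_eq_imp_eq)
  with p(1) 1 2 show ?thesis by (rule that)
qed

lemma critical_point_F_loop:
  assumes K: "continuous_on UNIV K" and lam: "lam \<noteq> 0" and L: "0 < length_h1 u"
    and crit: "energy_gradient K lam u = 0"
  shows "F_loop (\<lambda>z. lam * K z) (range (h1_fun u))"
proof -
  obtain p where p:
    "\<And>t. (h1_fun u has_vector_derivative h1_fun p t) (at t)"
    "\<And>t. (h1_fun p has_vector_derivative of_real (length_h1 u * lam * K (h1_fun u t)) * (\<i> * h1_fun p t)) (at t)"
    "\<And>t. norm (h1_fun p t) = length_h1 u"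
    by (rule critical_point_C2[OF assms]) blast
  have cK: "continuous_on UNIV (\<lambda>t. K (h1_fun u t))"
    by (rule continuous_on_compose2[OF K h1_continuous_UNIV]) auto
  have curv: "h1_fun p t \<noteq> 0 \<and> ((of_real (length_h1 u * lam * K (h1_fun u t)) * (\<i> * h1_fun p t)) \<bullet> (\<i> * h1_fun p t))
     / norm (h1_fun p t) ^ 3 = lam * K (h1_fun u t)" for t
  proof -
    have "(of_real (length_h1 u * lam * K (h1_fun u t)) * (\<i> * h1_fun p t)) \<bullet> (\<i> * h1_fun p t)
      = length_h1 u * lam * K (h1_fun u t) * (norm (\<i> * h1_fun p t))\<^sup>2"
      by (simp add: power2_norm_eq_inner flip: scaleR_conv_of_real)
    also have "norm (\<i> * h1_fun p t) = length_h1 u" by (simp add: norm_mult p(3))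
    finally show ?thesis using L p(3)[of t]
      by (auto simp: power2_eq_square power3_eq_cube)
  qed
  show ?thesis
    unfolding F_loop_def
    by (rule exI[of _ "h1_fun u"], rule exI[of _ "h1_fun p"],
        rule exI[of _ "\<lambda>t. of_real (length_h1 u * lam * K (h1_fun u t)) * (\<i> * h1_fun p t)"], rule exI[of _ 1])
      (use p(1,2) curv in \<open>auto simp: h1_periodic intro!: continuous_intros cK h1_continuous_UNIV\<close>)
qed

lemma G_h1_const_curvature:
  "G_h1 (\<lambda>_. k) u = k / 2 * I01 (\<lambda>t. h1_fun u t \<bullet> (\<i> * h1_deriv u t))"
proof -
  have "Q_field (\<lambda>_. k) z = (k / 2) *\<^sub>R z" for z
    using Q_field_monomial[of k 0 0 z] by (simp add: complex_eq_iff)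
  then show ?thesis by (simp add: G_h1_def)
qed

text \<open>With \<open>\<omega> = L \<lambda> k\<close> the equation for the velocity reads \<open>p' = i \<omega> p\<close>. Periodicity forces \<open>\<omega>\<close> to be a
  nonzero multiple of \<open>2 \<pi>\<close>, which bounds \<open>L\<close> below by the length of a circle of curvature \<open>\<lambda> k\<close>. The
  same equation gives \<open>\<lambda> G = - L / 2\<close>, and so the energy is \<open>L / 2\<close>.\<close>

lemma constant_curvature_critical_level:
  assumes k: "k \<noteq> 0" and lam: "lam \<noteq> 0" and L: "0 < length_h1 u"
    and crit: "energy_gradient (\<lambda>_. k) lam u = 0"
  shows "pi / \<bar>lam * k\<bar> \<le> energy (\<lambda>_. k) lam u"
proof -
  define \<omega> where "\<omega> = length_h1 u * lam * k"
  have w0: "\<omega> \<noteq> 0" using assms by (simp add: \<omega>_def)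
  obtain p where p: "l2_deriv (h1_fun u) (h1_fun p)"
    "\<And>t. (h1_fun p has_vector_derivative of_real (length_h1 u * lam * k) * (\<i> * h1_fun p t)) (at t)"
    "\<And>t. norm (h1_fun p t) = length_h1 u"
    by (rule critical_point_C2[OF continuous_on_const lam L crit]) blast
  have p2: "(h1_fun p has_vector_derivative of_real \<omega> * (\<i> * h1_fun p t)) (at t)" for t
    using p(2)[of t] by (simp add: \<omega>_def)
  \<comment> \<open>uniqueness for the linear equation: the quotient by the exponential solution is constant\<close>
  have "((\<lambda>t. exp (- \<i> * of_real \<omega> * of_real t) * h1_fun p t) has_vector_derivative 0) (at t within UNIV)" for t
  proof -
    have e: "((\<lambda>t. exp (- \<i> * of_real \<omega> * of_real t)) has_vector_derivative
        (- \<i> * of_real \<omega>) * exp (- \<i> * of_real \<omega> * of_real t)) (at t)"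
      by (rule has_vector_derivative_real_field) (auto intro!: derivative_eq_intros)
    show ?thesis
      using has_vector_derivative_mult[OF e p2[of t]] by (simp add: algebra_simps)
  qed
  then obtain c where c: "\<And>t. exp (- \<i> * of_real \<omega> * of_real t) * h1_fun p t = c"
    using has_vector_derivative_zero_constant[of UNIV "\<lambda>t. exp (- \<i> * of_real \<omega> * of_real t) * h1_fun p t"] by auto
  have "exp (- \<i> * of_real \<omega>) * h1_fun p 1 = h1_fun p 0" using c[of 1] c[of 0] by simp
  moreover have "h1_fun p 0 \<noteq> 0" using p(3)[of 0] L by auto
  ultimately have "exp (- \<i> * of_real \<omega>) = 1" by (simp add: h1_fun_1)
  then obtain n :: int where n: "- \<omega> = of_int (2 * n) * pi" by (auto simp: exp_eq_1)
  have "n \<noteq> 0" using n w0 by auto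
  have "\<bar>\<omega>\<bar> = \<bar>of_int (2 * n) * pi\<bar>" using n by (metis abs_minus_cancel)
  also have "\<dots> = 2 * pi * \<bar>of_int n\<bar>" by (simp add: abs_mult)
  also have "\<dots> \<ge> 2 * pi * 1" using \<open>n \<noteq> 0\<close> by (intro mult_left_mono) auto
  finally have w: "2 * pi \<le> length_h1 u * \<bar>lam * k\<bar>" by (simp add: \<omega>_def abs_mult mult.assoc)
  have "l2_deriv (h1_fun p) (\<lambda>t. of_real \<omega> * (\<i> * h1_fun p t))"
    by (rule l2_deriv_C1[OF p2]) (intro continuous_intros h1_continuous_UNIV)
  note ibp = h1_integration_by_parts[OF p(1), of p]
  note [measurable] = l2_deriv_measurable[OF p(1)]
  have "I01 (\<lambda>t. h1_fun u t \<bullet> h1_deriv p t) = I01 (\<lambda>t. h1_fun u t \<bullet> (of_real \<omega> * (\<i> * h1_deriv u t)))"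
  proof (rule I01_cong_AE)
    show "AE t\<in>{0..1} in lborel. h1_fun u t \<bullet> h1_deriv p t = h1_fun u t \<bullet> (of_real \<omega> * (\<i> * h1_deriv u t))"
      using h1_deriv_AE[OF p(1)] h1_deriv_AE[OF \<open>l2_deriv (h1_fun p) (\<lambda>t. of_real \<omega> * (\<i> * h1_fun p t))\<close>]
      by eventually_elim auto
  qed measurable
  also have "\<dots> = \<omega> * I01 (\<lambda>t. h1_fun u t \<bullet> (\<i> * h1_deriv u t))"
    by (simp flip: scaleR_conv_of_real)
  finally have "\<omega> * I01 (\<lambda>t. h1_fun u t \<bullet> (\<i> * h1_deriv u t)) = - I01 (\<lambda>t. (norm (h1_fun p t))\<^sup>2)"
    using ibp by (simp add: power2_norm_eq_inner)
  also have "\<dots> = - (length_h1 u)\<^sup>2" unfolding p(3) by simp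
  finally have "I01 (\<lambda>t. h1_fun u t \<bullet> (\<i> * h1_deriv u t)) = - (length_h1 u)\<^sup>2 / \<omega>"
    using w0 by (simp add: field_simps)
  then have "energy (\<lambda>_. k) lam u = length_h1 u / 2"
    using k lam L by (simp add: energy_def G_h1_const_curvature \<omega>_def power2_eq_square field_simps)
  moreover have "pi / \<bar>lam * k\<bar> \<le> length_h1 u / 2"
    using w k lam by (simp add: divide_le_eq)
  ultimately show ?thesis by (simp only:)
qed

section \<open>The Palais-Smale condition below the level of circles\<close>

lemma uniformly_continuous_if_limit_at_infinity:
  fixes K :: "complex \<Rightarrow> real"
  assumes K: "continuous_on UNIV K" and lim: "(K \<longlongrightarrow> K0) at_infinity"
  shows "uniformly_continuous_on UNIV K"
  unfolding uniformly_continuous_on_def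
proof (intro allI impI)
  fix e :: real assume e: "0 < e"
  obtain R where R: "\<And>z. R \<le> norm z \<Longrightarrow> dist (K z) K0 < e / 2"
    using tendstoD[OF lim, of "e / 2"] e by (auto simp: eventually_at_infinity)
  have "uniformly_continuous_on (cball 0 (R + 1)) K"
    by (intro compact_uniformly_continuous continuous_on_subset[OF K]) auto
  then obtain d where d: "0 < d"
    "\<And>x y. x \<in> cball 0 (R + 1) \<Longrightarrow> y \<in> cball 0 (R + 1) \<Longrightarrow> dist y x < d \<Longrightarrow> dist (K y) (K x) < e"
    using e unfolding uniformly_continuous_on_def by metis
  have "dist (K y) (K x) < e" if xy: "dist y x < min d 1" for x y
  proof (cases "R \<le> norm x \<and> R \<le> norm y")
    case True
    then show ?thesis using R[of x] R[of y] by (metis dist_triangle_half_l)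
  next
    case False
    have "\<bar>norm y - norm x\<bar> < 1" using norm_triangle_ineq3[of y x] xy by (simp add: dist_norm)
    then have "x \<in> cball 0 (R + 1)" "y \<in> cball 0 (R + 1)" using False by auto
    then show ?thesis using d(2) xy by simp
  qed
  then show "\<exists>d>0. \<forall>x\<in>UNIV. \<forall>x'\<in>UNIV. dist x' x < d \<longrightarrow> dist (K x') (K x) < e"
    using d(1) by (intro exI[of _ "min d 1"]) auto
qed

lemma bounded_if_limit_at_infinity:
  fixes K :: "complex \<Rightarrow> real"
  assumes K: "continuous_on UNIV K" and lim: "(K \<longlongrightarrow> K0) at_infinity"
  obtains M where "0 < M" "\<And>z. \<bar>K z\<bar> \<le> M"
proof -
  obtain R where R: "\<And>z. R \<le> norm z \<Longrightarrow> dist (K z) K0 < 1"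
    using tendstoD[OF lim, of 1] by (auto simp: eventually_at_infinity)
  obtain C where C: "0 \<le> C" "\<And>z. norm z \<le> R \<Longrightarrow> norm (K z) \<le> C"
    by (rule continuous_on_cball_bounded[OF K, of R]) blast
  show ?thesis
  proof (rule that[of "C + \<bar>K0\<bar> + 1"])
    show "\<bar>K z\<bar> \<le> C + \<bar>K0\<bar> + 1" for z
      using R[of z] C(2)[of z] C(1) by (cases "R \<le> norm z") (auto simp: dist_real_def)
  qed (use C(1) in linarith)
qed

lemma energy_gradient_limit:
  assumes K: "uniformly_continuous_on UNIV K" and M: "\<And>z. \<bar>K z\<bar> \<le> M"
    and w: "w \<longlonglongrightarrow> v" and v: "0 < length_h1 v"
  shows "(\<lambda>n. energy_gradient K lam (w n)) \<longlonglongrightarrow> energy_gradient K lam v"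
proof (rule LIMSEQ_I)
  fix e :: real assume e: "0 < e"
  obtain d where d: "0 < d"
    "\<And>u x. length_h1 v \<le> length_h1 u \<Longrightarrow> length_h1 u \<le> length_h1 v \<Longrightarrow> norm (u - x) \<le> d \<Longrightarrow>
      0 < length_h1 x \<and> norm (energy_gradient K lam u - energy_gradient K lam x) \<le> e / 2"
    by (rule energy_gradient_uniformly_continuous[OF K M v, of "e / 2" "length_h1 v" lam]) (use e in auto)
  obtain N where N: "\<forall>n\<ge>N. norm (w n - v) < d" using LIMSEQ_D[OF w d(1)] by blast
  have "norm (energy_gradient K lam (w n) - energy_gradient K lam v) < e" if "n \<ge> N" for n
    using d(2)[of v "w n"] N that e by (force simp: norm_minus_commute)
  then show "\<exists>N. \<forall>n\<ge>N. norm (energy_gradient K lam (w n) - energy_gradient K lam v) < e" by blast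
qed

lemma h1_deriv_centre: "AE t\<in>{0..1} in lborel. h1_deriv (h1_centre u) t = h1_deriv u t"
  using h1_deriv_diff[of u "h1_const (h1_mean u)"] h1_deriv_const[of "h1_mean u"]
  unfolding h1_centre_def by eventually_elim auto

text \<open>For constant curvature the energy is invariant under translations of the plane.\<close>

lemma energy_gradient_constant_centre:
  "energy_gradient (\<lambda>_. k) lam (h1_centre u) = energy_gradient (\<lambda>_. k) lam u"
proof -
  have s: "sq_int (h1_force (\<lambda>_. k) w)" for w by (rule h1_force_sq_int) (rule continuous_on_const)
  have "h1_riesz (h1_force (\<lambda>_. k) (h1_centre u)) = h1_riesz (h1_force (\<lambda>_. k) u)"
  proof (rule h1_riesz_eqI[OF s])
    fix h
    have "I01 (\<lambda>t. h1_force (\<lambda>_. k) u t \<bullet> h1_fun h t) = I01 (\<lambda>t. h1_force (\<lambda>_. k) (h1_centre u) t \<bullet> h1_fun h t)"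
    proof (rule I01_cong_AE)
      show "AE t\<in>{0..1} in lborel. h1_force (\<lambda>_. k) u t \<bullet> h1_fun h t = h1_force (\<lambda>_. k) (h1_centre u) t \<bullet> h1_fun h t"
        using h1_deriv_centre[of u] by eventually_elim (auto simp: h1_force_def)
    qed (use sq_int_measurable[OF s] in measurable)
    then show "inner (h1_riesz (h1_force (\<lambda>_. k) u)) h = I01 (\<lambda>t. h1_force (\<lambda>_. k) (h1_centre u) t \<bullet> h1_fun h t)"
      by (simp add: inner_h1_riesz[OF s])
  qed
  moreover have "h1_centre (h1_centre u) = h1_centre u" by (simp add: h1_centre_def[of "h1_centre u"])
  ultimately show ?thesis by (simp add: energy_gradient_def)
qed

lemma energy_constant_centre:
  "energy (\<lambda>_. k) lam (h1_centre u) = energy (\<lambda>_. k) lam u"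
proof -
  have inner_const: "inner g (h1_const m) = h1_mean g \<bullet> m" for g m
  proof -
    have "inner g (h1_const m) = inner (h1_const (h1_mean g) + h1_centre g) (h1_const m)"
      using h1_centre_plus_mean[of g] by simp
    also have "\<dots> = inner (h1_const (h1_mean g)) (h1_const m)" by (simp add: inner_add_left)
    also have "\<dots> = h1_mean g \<bullet> m"
    proof -
      have d: "l2_deriv (h1_fun (h1_const z)) (\<lambda>_. 0)" for z by (simp add: h1_const.rep_eq l2_deriv_const)
      show ?thesis using inner_h1_eq[OF d d, of "h1_mean g" m] by simp
    qed
    finally show ?thesis .
  qed
  have s: "sq_int (h1_force (\<lambda>_. k) w)" for w by (rule h1_force_sq_int) (rule continuous_on_const)
  have "\<bar>G_h1 (\<lambda>_. k) (h1_centre u + h1_const (h1_mean u)) - G_h1 (\<lambda>_. k) (h1_centre u) - 0\<bar> \<le> 0"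
  proof (rule G_h1_increment)
    fix r :: real
    define w where "w = h1_centre u + r *\<^sub>R h1_const (h1_mean u)"
    have "I01 (h1_force (\<lambda>_. k) w) = of_real k * \<i> * I01 (h1_deriv w)"
      unfolding h1_force_def set_integral_mult_right[symmetric] by (simp add: mult.assoc)
    then have "I01 (h1_force (\<lambda>_. k) w) = 0" by (simp add: I01_h1_deriv)
    moreover have "h1_mean (h1_riesz (h1_force (\<lambda>_. k) w)) = I01 (h1_force (\<lambda>_. k) w)"
      by (rule h1_riesz_structure[OF s]) blast
    ultimately have "inner (h1_riesz (h1_force (\<lambda>_. k) w)) (h1_const (h1_mean u)) = 0"
      by (simp add: inner_const)
    then show "\<bar>h1_variation (\<lambda>_. k) (h1_centre u + r *\<^sub>R h1_const (h1_mean u)) (h1_const (h1_mean u)) - 0\<bar> \<le> 0"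
      using inner_h1_riesz[OF s, of w "h1_const (h1_mean u)"] by (simp add: h1_variation_def w_def)
  qed (rule continuous_on_const)
  then have "G_h1 (\<lambda>_. k) u = G_h1 (\<lambda>_. k) (h1_centre u)"
    using h1_centre_plus_mean[of u] by (simp add: add.commute)
  then show ?thesis by (simp add: energy_def)
qed

text \<open>The definition of the gradient expresses the centred map through the gradient, which tends to
  zero, and a representative from a compact set. Hence the centred maps have a convergent subsequence, and
  only the means can escape.\<close>

lemma palais_smale:
  fixes u :: "nat \<Rightarrow> h1"
  assumes K: "continuous_on UNIV K" and lim: "(K \<longlongrightarrow> K0) at_infinity" and K0: "K0 \<noteq> 0" and lam: "lam \<noteq> 0"
    and E: "(\<lambda>n. energy K lam (u n)) \<longlonglongrightarrow> c"
    and g: "(\<lambda>n. energy_gradient K lam (u n)) \<longlonglongrightarrow> 0"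
    and l: "0 < l" "\<And>n. l \<le> length_h1 (u n)" and L: "\<And>n. length_h1 (u n) \<le> L"
    and c: "c < pi / \<bar>lam * K0\<bar>"
  obtains w where "0 < length_h1 w" "energy K lam w = c" "energy_gradient K lam w = 0"
proof -
  have uK: "uniformly_continuous_on UNIV K" by (rule uniformly_continuous_if_limit_at_infinity[OF K lim])
  obtain M where M: "0 < M" "\<And>z. \<bar>K z\<bar> \<le> M" by (rule bounded_if_limit_at_infinity[OF K lim]) blast
  have f: "sq_int (h1_force K (u n))" for n by (rule h1_force_sq_int[OF K])
  have fb: "L2n (h1_force K (u n)) \<le> M * L" for n
    using order_trans[OF L2n_h1_force_le[OF K less_imp_le[OF M(1)] M(2)] mult_left_mono[OF L less_imp_le[OF M(1)]]] .
  obtain G k where k: "strict_mono (k :: nat \<Rightarrow> nat)" "(\<lambda>n. h1_riesz (h1_force K (u (k n)))) \<longlonglongrightarrow> G"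
    by (rule h1_riesz_compact[of "\<lambda>n. h1_force K (u n)", OF f fb])
  have "bounded (range (\<lambda>n. length_h1 (u (k n))))"
    unfolding bounded_iff using L by (intro exI[of _ L]) auto
  then obtain l0 j where j: "strict_mono (j :: nat \<Rightarrow> nat)" "((\<lambda>n. length_h1 (u (k n))) \<circ> j) \<longlonglongrightarrow> l0"
    using bounded_imp_convergent_subsequence by blast
  define x where "x n = u (k (j n))" for n
  have kj: "strict_mono (k \<circ> j)" using k(1) j(1) by (rule strict_mono_o)
  have xE: "(\<lambda>n. energy K lam (x n)) \<longlonglongrightarrow> c"
    using LIMSEQ_subseq_LIMSEQ[OF E kj] by (simp add: x_def o_def)
  have xg: "(\<lambda>n. energy_gradient K lam (x n)) \<longlonglongrightarrow> 0"
    using LIMSEQ_subseq_LIMSEQ[OF g kj] by (simp add: x_def o_def)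
  have xr: "(\<lambda>n. h1_riesz (h1_force K (x n))) \<longlonglongrightarrow> G"
    using LIMSEQ_subseq_LIMSEQ[OF k(2) j(1)] by (simp add: x_def o_def)
  have xl: "(\<lambda>n. length_h1 (x n)) \<longlonglongrightarrow> l0" using j(2) by (simp add: x_def o_def)
  have lx: "l \<le> length_h1 (x n)" "length_h1 (x n) \<le> L" for n unfolding x_def by (rule l L)+
  have "l \<le> l0" by (rule LIMSEQ_le_const[OF xl]) (use lx in blast)
  then have l0: "0 < l0" using l(1) by linarith
  define v where "v = l0 *\<^sub>R (0 - lam *\<^sub>R G)"
  have ce: "h1_centre (x n) = length_h1 (x n) *\<^sub>R (energy_gradient K lam (x n) - lam *\<^sub>R h1_riesz (h1_force K (x n)))" for n
    using lx(1)[of n] l(1) by (simp add: energy_gradient_def sgn_div_norm)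
  have xc: "(\<lambda>n. h1_centre (x n)) \<longlonglongrightarrow> v"
    unfolding v_def ce by (intro tendsto_intros xl xg xr)
  have "(\<lambda>n. length_h1 (h1_centre (x n))) \<longlonglongrightarrow> length_h1 v" by (intro tendsto_intros xc)
  then have lv: "length_h1 v = l0" using LIMSEQ_unique[OF xl] by simp
  show ?thesis
  \<comment> \<open>either a subsequence of the means is bounded, or the means tend to infinity\<close>
  proof (cases "\<exists>R. \<exists>\<^sub>F n in sequentially. norm (h1_mean (x n)) \<le> R")
    case True
    then obtain R where R: "\<exists>\<^sub>F n in sequentially. norm (h1_mean (x n)) \<le> R" by blast
    then have "infinite {n. norm (h1_mean (x n)) \<le> R}"
      by (simp add: cofinite_eq_sequentially[symmetric] frequently_cofinite)
    then obtain r :: "nat \<Rightarrow> nat" where r: "strict_mono r" "\<And>n. norm (h1_mean (x (r n))) \<le> R"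
      by (metis infinite_enumerate mem_Collect_eq)
    have "bounded (range (\<lambda>n. h1_mean (x (r n))))" unfolding bounded_iff using r(2) by blast
    then obtain p i where i: "strict_mono (i :: nat \<Rightarrow> nat)" "((\<lambda>n. h1_mean (x (r n))) \<circ> i) \<longlonglongrightarrow> p"
      using bounded_imp_convergent_subsequence by blast
    define y where "y n = x (r (i n))" for n
    have ri: "strict_mono (r \<circ> i)" using r(1) i(1) by (rule strict_mono_o)
    define w where "w = h1_const p + v"
    have bl: "bounded_linear h1_const"
      by (rule bounded_linear_intro[where K = 1]) (auto simp: h1_const_add h1_const_scaleR)
    have "(\<lambda>n. h1_const (h1_mean (y n)) + h1_centre (y n)) \<longlonglongrightarrow> w"
      unfolding w_def
    proof (intro tendsto_add bounded_linear.tendsto[OF bl])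
      show "(\<lambda>n. h1_mean (y n)) \<longlonglongrightarrow> p" using i(2) by (simp add: y_def o_def)
      show "(\<lambda>n. h1_centre (y n)) \<longlonglongrightarrow> v"
        using LIMSEQ_subseq_LIMSEQ[OF xc ri] by (simp add: y_def o_def)
    qed
    then have yw: "y \<longlonglongrightarrow> w" by (simp flip: h1_centre_plus_mean)
    have lw: "0 < length_h1 w" using l0 lv length_h1_add_const[of v p] by (simp add: w_def add.commute)
    have "isCont (energy K lam) w"
      using energy_continuous[OF uK M(2), of UNIV lam] by (simp add: continuous_on_eq_continuous_at)
    then have "(\<lambda>n. energy K lam (y n)) \<longlonglongrightarrow> energy K lam w" by (rule isCont_tendsto_compose[OF _ yw])
    moreover have "(\<lambda>n. energy K lam (y n)) \<longlonglongrightarrow> c"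
      using LIMSEQ_subseq_LIMSEQ[OF xE ri] by (simp add: y_def o_def)
    ultimately have "energy K lam w = c" by (rule LIMSEQ_unique)
    moreover have "(\<lambda>n. energy_gradient K lam (y n)) \<longlonglongrightarrow> 0"
      using LIMSEQ_subseq_LIMSEQ[OF xg ri] by (simp add: y_def o_def)
    then have "energy_gradient K lam w = 0"
      by (rule LIMSEQ_unique[OF energy_gradient_limit[OF uK M(2) yw lw]])
    ultimately show ?thesis using that lw by blast
  next
    case False
    then have far: "\<forall>\<^sub>F n in sequentially. R < norm (h1_mean (x n))" for R
      by (simp add: frequently_def not_le)
    have c1: "continuous_on UNIV (\<lambda>z. K z - K0)" by (intro continuous_intros K)
    have L0: "0 \<le> L" using order_trans[OF length_h1_nonneg lx(2)] .
    have ev: "\<forall>\<^sub>F n in sequentially. \<forall>z. norm (z - h1_mean (x n)) \<le> length_h1 (x n) \<longrightarrow> \<bar>K z - K0\<bar> \<le> e"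
      if e: "0 < e" for e
    proof -
      obtain R where R: "\<And>z. R \<le> norm z \<Longrightarrow> dist (K z) K0 < e"
        using tendstoD[OF lim e] by (auto simp: eventually_at_infinity)
      show ?thesis using far[of "R + L"]
      proof eventually_elim
        case (elim n)
        have "\<bar>K z - K0\<bar> \<le> e" if z: "norm (z - h1_mean (x n)) \<le> length_h1 (x n)" for z
        proof -
          have "norm (h1_mean (x n)) \<le> norm z + norm (z - h1_mean (x n))"
            using norm_triangle_ineq4[of z "z - h1_mean (x n)"] by simp
          then have "R \<le> norm z" using elim z lx(2)[of n] by linarith
          from R[OF this] show ?thesis by (simp add: dist_real_def)
        qed
        then show ?case by blast
      qed
    qed
    have G1: "(\<lambda>n. G_h1 (\<lambda>z. K z - K0) (x n)) \<longlonglongrightarrow> 0"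
    proof (rule tendstoI)
      fix e :: real assume e: "0 < e"
      have d: "0 < e / (L\<^sup>2 + 1)" using e by (intro divide_pos_pos add_nonneg_pos) auto
      show "\<forall>\<^sub>F n in sequentially. dist (G_h1 (\<lambda>z. K z - K0) (x n)) 0 < e"
        using ev[OF d]
      proof eventually_elim
        case (elim n)
        have "\<bar>G_h1 (\<lambda>z. K z - K0) (x n)\<bar> \<le> (e / (L\<^sup>2 + 1)) * (length_h1 (x n))\<^sup>2"
          by (rule G_h1_isoperimetric[OF c1]) (use elim in blast)
        also have "\<dots> \<le> (e / (L\<^sup>2 + 1)) * L\<^sup>2"
          using lx(2)[of n] d by (intro mult_left_mono power_mono) auto
        also have "\<dots> < e" using e by (simp add: divide_less_eq add_nonneg_pos)
        finally show ?case by simp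
      qed
    qed
    have F1: "(\<lambda>n. h1_riesz (h1_force (\<lambda>z. K z - K0) (x n))) \<longlonglongrightarrow> 0"
    proof (rule tendstoI)
      fix e :: real assume e: "0 < e"
      have d: "0 < e / (2 * L + 1)" using e L0 by simp
      show "\<forall>\<^sub>F n in sequentially. dist (h1_riesz (h1_force (\<lambda>z. K z - K0) (x n))) 0 < e"
        using ev[OF d]
      proof eventually_elim
        case (elim n)
        have "L2n (h1_force (\<lambda>z. K z - K0) (x n)) \<le> (e / (2 * L + 1)) * length_h1 (x n)"
          by (rule L2n_h1_force_le[OF c1]) (use elim h1_near_mean d in auto)
        also have "\<dots> \<le> (e / (2 * L + 1)) * L" using lx(2)[of n] d by (intro mult_left_mono) auto
        finally have "norm (h1_riesz (h1_force (\<lambda>z. K z - K0) (x n))) \<le> 2 * ((e / (2 * L + 1)) * L)"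
          using norm_h1_riesz_le[OF h1_force_sq_int[OF c1, of "x n"]] by linarith
        also have "\<dots> < e" using e L0 by (simp add: divide_less_eq)
        finally show ?case by simp
      qed
    qed
    have gx: "energy_gradient (\<lambda>_. K0) lam (h1_centre (x n)) =
       energy_gradient K lam (x n) - lam *\<^sub>R h1_riesz (h1_force (\<lambda>z. K z - K0) (x n))" for n
    proof -
      have "h1_force (\<lambda>z. K z - K0) (x n) = (\<lambda>t. h1_force K (x n) t - h1_force (\<lambda>_. K0) (x n) t)"
        by (simp add: fun_eq_iff h1_force_def left_diff_distrib)
      then have eq: "h1_riesz (h1_force (\<lambda>z. K z - K0) (x n)) = h1_riesz (h1_force K (x n)) - h1_riesz (h1_force (\<lambda>_. K0) (x n))"
        by (simp add: h1_riesz_diff h1_force_sq_int K)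
      show ?thesis
        unfolding energy_gradient_constant_centre unfolding energy_gradient_def eq by (simp add: scaleR_diff_right)
    qed
    have Ex: "energy (\<lambda>_. K0) lam (h1_centre (x n)) = energy K lam (x n) - lam * G_h1 (\<lambda>z. K z - K0) (x n)" for n
    proof -
      have "G_h1 K (x n) = G_h1 (\<lambda>z. K z - K0) (x n) + G_h1 (\<lambda>_. K0) (x n)"
        using G_h1_add[OF c1 continuous_on_const, of K0 "x n"] by simp
      then show ?thesis unfolding energy_constant_centre by (simp add: energy_def algebra_simps)
    qed
    have uc: "uniformly_continuous_on UNIV (\<lambda>_::complex. K0)" by (intro uniformly_continuous_on_const)
    have b0: "\<bar>K0\<bar> \<le> \<bar>K0\<bar>" by simp
    have lv0: "0 < length_h1 v" using l0 lv by simp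
    have "(\<lambda>n. energy_gradient (\<lambda>_. K0) lam (h1_centre (x n))) \<longlonglongrightarrow> 0 - lam *\<^sub>R 0"
      unfolding gx by (intro tendsto_intros xg F1)
    then have "energy_gradient (\<lambda>_. K0) lam v = 0"
      using LIMSEQ_unique[OF energy_gradient_limit[OF uc b0 xc lv0, of lam]] by simp
    then have "pi / \<bar>lam * K0\<bar> \<le> energy (\<lambda>_. K0) lam v"
      by (rule constant_curvature_critical_level[OF K0 lam lv0])
    moreover have "(\<lambda>n. energy (\<lambda>_. K0) lam (h1_centre (x n))) \<longlonglongrightarrow> c - lam * 0"
      unfolding Ex by (intro tendsto_intros xE G1)
    moreover have "isCont (energy (\<lambda>_. K0) lam) v"
      using energy_continuous[OF uc b0, of UNIV lam] by (simp add: continuous_on_eq_continuous_at)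
    then have "(\<lambda>n. energy (\<lambda>_. K0) lam (h1_centre (x n))) \<longlonglongrightarrow> energy (\<lambda>_. K0) lam v"
      by (rule isCont_tendsto_compose[OF _ xc])
    ultimately have "pi / \<bar>lam * K0\<bar> \<le> c" using LIMSEQ_unique by fastforce
    then show ?thesis using c by linarith
  qed
qed

section \<open>The mountain pass level\<close>

lemma mp_path_energy_bdd:
  assumes K: "uniformly_continuous_on UNIV K" and M: "\<And>z. \<bar>K z\<bar> \<le> M" and g: "\<gamma> \<in> mp_paths w"
  shows "bdd_above ((\<lambda>s. energy K lam (\<gamma> s)) ` {0..1})"
proof -
  have "continuous_on {0..1} (\<lambda>s. energy K lam (\<gamma> s))"
    using g by (intro continuous_on_compose2[OF energy_continuous[OF K M, of UNIV]]) (auto simp: mp_paths_def)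
  then have "compact ((\<lambda>s. energy K lam (\<gamma> s)) ` {0..1})" by (intro compact_continuous_image) auto
  then show ?thesis by (rule bounded_imp_bdd_above[OF compact_imp_bounded])
qed

lemma mp_paths_nonempty: "linepath 0 w \<in> mp_paths w"
  by (auto simp: mp_paths_def linepath_def intro!: continuous_intros)

lemma energy_0 [simp]: "energy K lam 0 = 0"
  using G_h1_const[of K 0] by (simp add: energy_def)

lemma mp_sup_nonneg:
  assumes K: "uniformly_continuous_on UNIV K" and M: "\<And>z. \<bar>K z\<bar> \<le> M" and g: "\<gamma> \<in> mp_paths w"
  shows "0 \<le> (SUP s\<in>{0..1}. energy K lam (\<gamma> s))"
  by (rule cSUP_upper2[OF mp_path_energy_bdd[OF K M g], of 0]) (use g in \<open>auto simp: mp_paths_def\<close>)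

lemma mp_inf_max_le:
  assumes K: "uniformly_continuous_on UNIV K" and M: "\<And>z. \<bar>K z\<bar> \<le> M" and g: "\<gamma> \<in> mp_paths w"
    and C: "\<And>s. s \<in> {0..1} \<Longrightarrow> energy K lam (\<gamma> s) \<le> C"
  shows "mp_inf_max (energy K lam) w \<le> C"
  unfolding mp_inf_max_def
proof (rule cINF_lower2[OF _ g])
  show "bdd_below ((\<lambda>\<gamma>. SUP s\<in>{0..1}. energy K lam (\<gamma> s)) ` mp_paths w)"
    using mp_sup_nonneg[OF K M] by (intro bdd_belowI2) auto
  show "(SUP s\<in>{0..1}. energy K lam (\<gamma> s)) \<le> C" by (rule cSUP_least) (use C in auto)
qed

lemma mp_inf_max_approx:
  assumes e: "mp_inf_max (energy K lam) w < C"
    and K: "uniformly_continuous_on UNIV K" and M: "\<And>z. \<bar>K z\<bar> \<le> M"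
  obtains \<gamma> where "\<gamma> \<in> mp_paths w" "\<And>s. s \<in> {0..1} \<Longrightarrow> energy K lam (\<gamma> s) \<le> C"
proof -
  have "bdd_below ((\<lambda>\<gamma>. SUP s\<in>{0..1}. energy K lam (\<gamma> s)) ` mp_paths w)"
    using mp_sup_nonneg[OF K M] by (intro bdd_belowI2) auto
  then obtain \<gamma> where g: "\<gamma> \<in> mp_paths w" "(SUP s\<in>{0..1}. energy K lam (\<gamma> s)) < C"
    using e mp_paths_nonempty[of w] unfolding mp_inf_max_def by (subst (asm) cINF_less_iff) auto
  show ?thesis
  proof (rule that[OF g(1)])
    fix s :: real assume s: "s \<in> {0..1}"
    have "energy K lam (\<gamma> s) \<le> (SUP s\<in>{0..1}. energy K lam (\<gamma> s))"
      by (rule cSUP_upper[OF s mp_path_energy_bdd[OF K M g(1)]])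
    then show "energy K lam (\<gamma> s) \<le> C" using g(2) by linarith
  qed
qed

lemma G_h1_le:
  assumes "continuous_on UNIV K" "\<And>z. \<bar>K z\<bar> \<le> M" shows "\<bar>G_h1 K u\<bar> \<le> M * (length_h1 u)\<^sup>2"
  by (rule G_h1_isoperimetric) (use assms in auto)

text \<open>Every path has to cross the set of maps of a fixed small length, where the length
  dominates the area term.\<close>

lemma mp_inf_max_pos:
  assumes K: "uniformly_continuous_on UNIV K" and M: "\<And>z. \<bar>K z\<bar> \<le> M" "0 < M" and lam: "0 < lam"
    and w: "0 < length_h1 w"
  shows "0 < mp_inf_max (energy K lam) w"
proof -
  \<comment> \<open>at lengths up to \<open>1 / (2 \<lambda> M)\<close> the area term takes at most half of the length\<close>
  define l where "l = min (length_h1 w) (1 / (2 * lam * M))"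
  have l: "0 < l" using w lam M(2) by (simp add: l_def)
  have "l / 2 \<le> (SUP s\<in>{0..1}. energy K lam (\<gamma> s))" if g: "\<gamma> \<in> mp_paths w" for \<gamma>
  proof -
    have cl: "continuous_on {0..1} (\<lambda>s. length_h1 (\<gamma> s))"
      using g unfolding mp_paths_def continuous_on_def by (auto intro!: tendsto_intros)
    have "\<exists>s\<ge>0. s \<le> 1 \<and> length_h1 (\<gamma> s) = l"
      by (rule IVT'[OF _ _ _ cl]) (use g l in \<open>auto simp: mp_paths_def l_def\<close>)
    then obtain s where s: "s \<in> {0..1}" "length_h1 (\<gamma> s) = l" by auto
    have "\<bar>G_h1 K (\<gamma> s)\<bar> \<le> M * l\<^sup>2"
      using G_h1_le[OF uniformly_continuous_imp_continuous[OF K] M(1), of "\<gamma> s"] s(2) by simp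
    then have "- (M * l\<^sup>2) \<le> G_h1 K (\<gamma> s)" by linarith
    from mult_left_mono[OF this less_imp_le[OF lam]]
    have "l - lam * (M * l\<^sup>2) \<le> energy K lam (\<gamma> s)" by (simp add: energy_def s(2))
    moreover have "lam * (M * l\<^sup>2) \<le> l / 2"
    proof -
      have "l \<le> 1 / (2 * lam * M)" by (simp add: l_def)
      then have "l * (lam * M * l) \<le> l * (1 / 2)"
        using lam M(2) l by (intro mult_left_mono) (auto simp: field_simps)
      then show ?thesis by (simp add: power2_eq_square mult_ac)
    qed
    ultimately have "l / 2 \<le> energy K lam (\<gamma> s)" by linarith
    then show ?thesis by (rule cSUP_upper2[OF mp_path_energy_bdd[OF K M(1) g] s(1)])
  qed
  then have "l / 2 \<le> mp_inf_max (energy K lam) w"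
    unfolding mp_inf_max_def using mp_paths_nonempty[of w] by (intro cINF_greatest) auto
  then show ?thesis using l by linarith
qed

subsection \<open>The level of circles bounds the mountain pass level\<close>

lemma h1_circle_scale: "h1_circle r k = r *\<^sub>R h1_circle 1 k"
  by (rule h1_eqI) (simp add: h1_circle.rep_eq scaleR_conv_of_real)

lemma h1_circle_l2_deriv:
  fixes k :: real
  defines "c \<equiv> (if 0 < k then 2 * pi else - (2 * pi))"
  shows "l2_deriv (h1_fun (h1_circle r k)) (\<lambda>t. of_real (r * c) * (\<i> * cis (c * t)))"
    and "h1_fun (h1_circle r k) t = of_real r * cis (c * t)"
proof -
  have e: "h1_fun (h1_circle r k) = (\<lambda>t. of_real r * cis (c * t))"
    by (simp add: fun_eq_iff h1_circle.rep_eq c_def)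
  have "((\<lambda>t. of_real r * cis (c * t)) has_vector_derivative of_real (r * c) * (\<i> * cis (c * t))) (at t)" for t
  proof -
    have "((\<lambda>t. c * t) has_derivative (\<lambda>h. c * h)) (at t)"
      by (rule has_derivative_mult_right[OF has_derivative_ident])
    from has_derivative_cis[OF this]
    have "((\<lambda>t. cis (c * t)) has_vector_derivative c *\<^sub>R (\<i> * cis (c * t))) (at t)"
      unfolding has_vector_derivative_def scaleR_scaleR by (simp only: mult.commute)
    then have "((\<lambda>t. of_real r * cis (c * t)) has_vector_derivative
        of_real r * (c *\<^sub>R (\<i> * cis (c * t)))) (at t)"
      by (rule has_vector_derivative_mult_right)
    then show ?thesis by (simp add: scaleR_conv_of_real mult_ac)
  qed
  then show "l2_deriv (h1_fun (h1_circle r k)) (\<lambda>t. of_real (r * c) * (\<i> * cis (c * t)))"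
    unfolding e by (rule l2_deriv_C1) (intro continuous_intros)
  show "h1_fun (h1_circle r k) t = of_real r * cis (c * t)" by (simp add: e)
qed

lemma length_h1_circle: "length_h1 (h1_circle r k) = 2 * pi * \<bar>r\<bar>"
  by (simp add: length_h1_eq_L2n[OF h1_circle_l2_deriv(1)] L2n_def norm_mult abs_mult)

lemma G_h1_circle: "G_h1 (\<lambda>_. k) (h1_circle r k) = - (pi * \<bar>k\<bar> * r\<^sup>2)"
proof -
  define c where "c = (if 0 < k then 2 * pi else - (2 * pi))"
  note d = h1_circle_l2_deriv[of r k, folded c_def]
  note [measurable] = l2_deriv_measurable[OF d(1)]
  have "I01 (\<lambda>t. h1_fun (h1_circle r k) t \<bullet> (\<i> * h1_deriv (h1_circle r k) t)) =
     I01 (\<lambda>t. h1_fun (h1_circle r k) t \<bullet> (\<i> * (of_real (r * c) * (\<i> * cis (c * t)))))"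
  proof (rule I01_cong_AE)
    show "AE t\<in>{0..1} in lborel. h1_fun (h1_circle r k) t \<bullet> (\<i> * h1_deriv (h1_circle r k) t) =
        h1_fun (h1_circle r k) t \<bullet> (\<i> * (of_real (r * c) * (\<i> * cis (c * t))))"
      using h1_deriv_AE[OF d(1)] by eventually_elim simp
  qed measurable
  also have "\<dots> = I01 (\<lambda>_. - (c * r\<^sup>2))"
  proof (rule I01_cong)
    fix t :: real
    have "h1_fun (h1_circle r k) t \<bullet> (\<i> * (of_real (r * c) * (\<i> * cis (c * t)))) =
      - (c * r\<^sup>2) * ((cos (c * t))\<^sup>2 + (sin (c * t))\<^sup>2)"
      unfolding d(2)
      by (simp add: inner_complex_def power2_eq_square algebra_simps
          del: sin_cos_squared_add sin_cos_squared_add2 sin_cos_squared_add3)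
    then show "h1_fun (h1_circle r k) t \<bullet> (\<i> * (of_real (r * c) * (\<i> * cis (c * t)))) = - (c * r\<^sup>2)" by simp
  qed
  finally show ?thesis unfolding G_h1_const_curvature by (auto simp: c_def)
qed

text \<open>Three segments form the path: constant maps from the origin to a far point \<open>z\<^sub>1\<close>, circles about \<open>z\<^sub>1\<close>
  with radius growing to \<open>r\<^sub>0\<close>, and circles of radius \<open>r\<^sub>0\<close> whose centre returns from \<open>z\<^sub>1\<close> to \<open>z\<^sub>0\<close> along the
  ray through \<open>z\<^sub>0\<close>. The energy vanishes on the first segment and is negative on the last one.\<close>

lemma mp_level_le_circle_level:
  assumes K: "continuous_on UNIV K" and lim: "(K \<longlongrightarrow> K0) at_infinity" and K0: "K0 \<noteq> 0" and lam: "0 < lam"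
    and r0: "0 < r0" and R: "0 < R" "R \<le> norm z0"
    and neg: "\<And>z. R \<le> norm z \<Longrightarrow> energy K lam (h1_circle r0 K0 + h1_const z) < 0"
  shows "mp_inf_max (energy K lam) (h1_circle r0 K0 + h1_const z0) \<le> pi / \<bar>lam * K0\<bar>"
proof (rule field_le_epsilon)
  fix \<epsilon> :: real assume \<epsilon>: "0 < \<epsilon>"
  have uK: "uniformly_continuous_on UNIV K" by (rule uniformly_continuous_if_limit_at_infinity[OF K lim])
  obtain M where M: "0 < M" "\<And>z. \<bar>K z\<bar> \<le> M" by (rule bounded_if_limit_at_infinity[OF K lim]) blast
  have c1: "continuous_on UNIV (\<lambda>z. K z - K0)" by (intro continuous_intros K)
  define q where "q = h1_circle r0 K0"
  define B where "B = length_h1 q + norm (h1_mean q)"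
  define d where "d = \<epsilon> / (lam * (B\<^sup>2 + 1))"
  have B: "0 \<le> B" by (simp add: B_def)
  have d: "0 < d" using \<epsilon> lam by (auto simp: d_def intro!: divide_pos_pos mult_pos_pos add_nonneg_pos)
  obtain R' where R': "\<And>z. R' \<le> norm z \<Longrightarrow> dist (K z) K0 < d"
    using tendstoD[OF lim d] by (auto simp: eventually_at_infinity)
  \<comment> \<open>so far out that \<open>K\<close> is within \<open>d\<close> of \<open>K0\<close> on every circle of the second segment\<close>
  define \<tau> where "\<tau> = 1 + (\<bar>R'\<bar> + B) / norm z0"
  have nz: "0 < norm z0" using R by linarith
  have \<tau>: "1 \<le> \<tau>" using nz B by (simp add: \<tau>_def)
  define z1 where "z1 = \<tau> *\<^sub>R z0"
  have z1: "R' + B \<le> norm z1"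
  proof -
    have "norm z1 = \<tau> * norm z0" using \<tau> by (simp add: z1_def)
    also have "\<dots> = norm z0 + (\<bar>R'\<bar> + B) / norm z0 * norm z0" by (simp only: \<tau>_def distrib_right mult_1)
    also have "(\<bar>R'\<bar> + B) / norm z0 * norm z0 = \<bar>R'\<bar> + B" using nz by simp
    finally have "norm z1 = norm z0 + (\<bar>R'\<bar> + B)" .
    then show ?thesis using nz by linarith
  qed
  define \<gamma> where "\<gamma> = linepath 0 (h1_const z1) +++
     (linepath (h1_const z1) (q + h1_const z1) +++ linepath (q + h1_const z1) (q + h1_const z0))"
  have pg: "path \<gamma>" unfolding \<gamma>_def by (intro path_join_imp path_linepath) auto
  have mem: "\<gamma> \<in> mp_paths (q + h1_const z0)"
    using pg pathstart_join[of "linepath 0 (h1_const z1)"]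
    unfolding mp_paths_def path_def
    by (simp add: \<gamma>_def joinpaths_def linepath_def)
  have bound: "energy K lam x \<le> pi / \<bar>lam * K0\<bar> + \<epsilon>" if x: "x \<in> path_image \<gamma>" for x
  proof -
    have pos: "0 \<le> pi / \<bar>lam * K0\<bar>" by simp
    have "path_image \<gamma> \<subseteq> closed_segment 0 (h1_const z1) \<union> (closed_segment (h1_const z1) (q + h1_const z1)
        \<union> closed_segment (q + h1_const z1) (q + h1_const z0))"
      unfolding \<gamma>_def using path_image_join_subset[of "linepath 0 (h1_const z1)"]
        path_image_join_subset[of "linepath (h1_const z1) (q + h1_const z1)"] by fastforce
    then consider "x \<in> closed_segment 0 (h1_const z1)" | "x \<in> closed_segment (h1_const z1) (q + h1_const z1)"
      | "x \<in> closed_segment (q + h1_const z1) (q + h1_const z0)" using x by blast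
    then show ?thesis
    proof cases
      case 1
      then obtain s where "x = h1_const (s *\<^sub>R z1)"
        by (auto simp: in_segment h1_const_scaleR)
      then show ?thesis using pos \<epsilon> by (simp add: energy_def)
    next
      case 2
      then obtain s where s: "0 \<le> s" "s \<le> 1" "x = s *\<^sub>R q + h1_const z1"
        by (auto simp: in_segment algebra_simps)
      have lq: "length_h1 x = s * (2 * pi * r0)" using s r0 by (simp add: q_def length_h1_circle)
      have "G_h1 (\<lambda>_. K0) x = G_h1 (\<lambda>_. K0) (s *\<^sub>R q)"
      proof -
        have "h1_centre x = h1_centre (s *\<^sub>R q)" unfolding s(3) by (simp add: h1_centre_add)
        then have "energy (\<lambda>_. K0) 1 x = energy (\<lambda>_. K0) 1 (s *\<^sub>R q)"
          by (metis energy_constant_centre)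
        then show ?thesis by (simp add: energy_def s(3))
      qed
      also have "s *\<^sub>R q = h1_circle (s * r0) K0"
        unfolding q_def h1_circle_scale[of r0] h1_circle_scale[of "s * r0"] by simp
      also have "G_h1 (\<lambda>_. K0) \<dots> = - (pi * \<bar>K0\<bar> * (s * r0)\<^sup>2)" by (rule G_h1_circle)
      finally have Gc: "G_h1 (\<lambda>_. K0) x = - (pi * \<bar>K0\<bar> * (s * r0)\<^sup>2)" .
      have "\<bar>G_h1 (\<lambda>z. K z - K0) x\<bar> \<le> d * (length_h1 x)\<^sup>2"
      proof (rule G_h1_isoperimetric[OF c1])
        fix z assume z: "norm (z - h1_mean x) \<le> length_h1 x"
        have lx: "length_h1 x \<le> length_h1 q" using s mult_right_mono[of s 1 "length_h1 q"] by simp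
        have mx: "norm (s *\<^sub>R h1_mean q) \<le> norm (h1_mean q)"
          using s mult_right_mono[of s 1 "norm (h1_mean q)"] by simp
        have "z1 = z - (z - h1_mean x) - s *\<^sub>R h1_mean q" using s(3) by simp
        then have "norm z1 \<le> norm z + norm (z - h1_mean x) + norm (s *\<^sub>R h1_mean q)"
          using norm_triangle_ineq4[of "z - (z - h1_mean x)" "s *\<^sub>R h1_mean q"]
            norm_triangle_ineq4[of z "z - h1_mean x"] by simp
        then have "R' \<le> norm z" using z lx mx z1 unfolding B_def by linarith
        then show "\<bar>K z - K0\<bar> \<le> d" using R'[of z] by (simp add: dist_real_def)
      qed
      also have "\<dots> \<le> d * B\<^sup>2"
      proof (intro mult_left_mono power_mono)
        show "length_h1 x \<le> B" using s mult_right_mono[of s 1 "length_h1 q"] unfolding B_def s(3)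
          by (simp add: add_increasing2)
      qed (use d in auto)
      finally have "G_h1 (\<lambda>z. K z - K0) x \<le> d * B\<^sup>2" by linarith
      then have "lam * G_h1 (\<lambda>z. K z - K0) x \<le> lam * (d * B\<^sup>2)" using lam by simp
      also have "\<dots> = \<epsilon> * (B\<^sup>2 / (B\<^sup>2 + 1))" using lam by (simp add: d_def)
      also have "\<dots> \<le> \<epsilon> * 1" using \<epsilon> by (intro mult_left_mono) (auto simp: divide_le_eq add_nonneg_pos)
      finally have G1: "lam * G_h1 (\<lambda>z. K z - K0) x \<le> \<epsilon>" by simp
      have GG: "G_h1 K x = G_h1 (\<lambda>z. K z - K0) x + G_h1 (\<lambda>_. K0) x"
        using G_h1_add[OF c1 continuous_on_const, of K0 x] by simp
      define A where "A = lam * \<bar>K0\<bar>"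
      have A: "0 < A" using lam K0 by (simp add: A_def)
      define y where "y = s * r0"
      have "energy K lam x \<le> 2 * pi * y - pi * A * y\<^sup>2 + \<epsilon>"
        using G1 unfolding energy_def GG Gc lq by (simp add: A_def y_def algebra_simps)
      also have "2 * pi * y - pi * A * y\<^sup>2 \<le> pi / A"
      proof -
        \<comment> \<open>completing the square\<close>
        have "2 * y * A - (A * y)\<^sup>2 \<le> 1"
          using zero_le_power2[of "1 - A * y"] by (simp add: power2_eq_square algebra_simps)
        then have "pi * (2 * y * A - (A * y)\<^sup>2) \<le> pi * 1" by (intro mult_left_mono) auto
        then show ?thesis using A by (simp add: field_simps power2_eq_square)
      qed
      finally show ?thesis using lam by (simp add: A_def abs_mult)
    next
      case 3
      then obtain s where s: "0 \<le> s" "s \<le> 1" "x = (1 - s) *\<^sub>R (q + h1_const z1) + s *\<^sub>R (q + h1_const z0)"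
        by (auto simp: in_segment)
      have x: "x = q + h1_const (((1 - s) * \<tau> + s) *\<^sub>R z0)"
        unfolding s(3) by (rule h1_eqI) (simp add: z1_def algebra_simps)
      have "1 \<le> (1 - s) * \<tau> + s"
        using mult_left_mono[OF \<tau>, of "1 - s"] s by simp
      then have "1 * norm z0 \<le> \<bar>(1 - s) * \<tau> + s\<bar> * norm z0" by (intro mult_right_mono) auto
      then have "R \<le> norm (((1 - s) * \<tau> + s) *\<^sub>R z0)" using R(2) by simp
      from neg[OF this] have "energy K lam x < 0" by (simp add: x q_def)
      then show ?thesis using pos \<epsilon> by linarith
    qed
  qed
  show "mp_inf_max (energy K lam) (h1_circle r0 K0 + h1_const z0) \<le> pi / \<bar>lam * K0\<bar> + \<epsilon>"
    using mp_inf_max_le[OF uK M(2) mem] bound by (auto simp: path_image_def q_def)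
qed

subsection \<open>Monotonicity in the parameter\<close>

lemma energy_parameter_le:
  assumes "0 < \<mu>" "\<mu> \<le> lam" shows "energy K lam u \<le> lam / \<mu> * energy K \<mu> u"
proof -
  have "length_h1 u * 1 \<le> length_h1 u * (lam / \<mu>)" using assms by (intro mult_left_mono) auto
  moreover have "lam / \<mu> * energy K \<mu> u = length_h1 u * (lam / \<mu>) + lam * G_h1 K u"
    using assms by (simp add: energy_def field_simps)
  ultimately show ?thesis by (simp add: energy_def)
qed

lemma mp_level_antimono:
  assumes K: "uniformly_continuous_on UNIV K" and M: "\<And>z. \<bar>K z\<bar> \<le> M" and "0 < \<mu>" "\<mu> \<le> lam"
  shows "mp_inf_max (energy K lam) w / lam \<le> mp_inf_max (energy K \<mu>) w / \<mu>"
proof -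
  have "mp_inf_max (energy K lam) w * \<mu> / lam \<le> C" if lev: "mp_inf_max (energy K \<mu>) w < C" for C
  proof -
    obtain \<gamma> where g: "\<gamma> \<in> mp_paths w" "\<And>s. s \<in> {0..1} \<Longrightarrow> energy K \<mu> (\<gamma> s) \<le> C"
      by (rule mp_inf_max_approx[OF lev K M]) blast
    have "mp_inf_max (energy K lam) w \<le> lam / \<mu> * C"
    proof (rule mp_inf_max_le[OF K M g(1)])
      fix s :: real assume "s \<in> {0..1}"
      then have "lam / \<mu> * energy K \<mu> (\<gamma> s) \<le> lam / \<mu> * C" using assms g(2) by (intro mult_left_mono) auto
      then show "energy K lam (\<gamma> s) \<le> lam / \<mu> * C"
        using energy_parameter_le[OF assms(3,4), of K "\<gamma> s"] by linarith
    qed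
    then show ?thesis using assms by (simp add: field_simps)
  qed
  then have "mp_inf_max (energy K lam) w * \<mu> / lam \<le> mp_inf_max (energy K \<mu>) w" by (rule dense_ge)
  then show ?thesis using assms by (simp add: field_simps)
qed

text \<open>Part of Lebesgue's theorem on the differentiability of monotone functions. The integral of a
  difference quotient telescopes, by translation, to at most the total decrease of \<open>f\<close>; by Fatou's lemma
  the lower limit of the quotients is then integrable and thus finite almost everywhere.\<close>

lemma antimono_difference_quotients:
  fixes f :: "real \<Rightarrow> real"
  assumes ab: "a < b" and f: "\<And>x y. a \<le> x \<Longrightarrow> x \<le> y \<Longrightarrow> y \<le> b \<Longrightarrow> f y \<le> f x"
  shows "AE x in lborel. x \<in> {a<..b} \<longrightarrow>
    (\<exists>C. \<exists>\<^sub>F n in sequentially. f (x - 1 / real (Suc n)) - f x \<le> C / real (Suc n))"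
proof -
  \<comment> \<open>extension by constants, so that translates make sense; nonnegative and increasing\<close>
  define F where "F x = f a - f (max a (min b x))" for x
  define B where "B = f a - f b"
  have mF: "mono F" unfolding F_def by (intro monoI diff_left_mono f) (use ab in auto)
  have [measurable]: "F \<in> borel_measurable borel" by (rule borel_measurable_mono[OF mF])
  have F0: "0 \<le> F x" and FB: "F x \<le> B" for x
    unfolding F_def B_def using f[of a "max a (min b x)"] f[of "max a (min b x)" b] ab by auto
  define g where "g n x = real (Suc n) * (F x - F (x - 1 / real (Suc n)))" for n x
  have g0: "0 \<le> g n x" for n x unfolding g_def using monoD[OF mF, of "x - 1 / real (Suc n)" x] by simp
  have [measurable]: "g n \<in> borel_measurable borel" for n unfolding g_def by measurable
  have ii: "integrable lborel (\<lambda>x. indicat_real {c..d} x * F (x - e))" for c d e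
  proof (rule Bochner_Integration.integrable_bound[where f = "\<lambda>x. B * indicat_real {c..d} x"])
    show "AE x in lborel. norm (indicat_real {c..d} x * F (x - e)) \<le> norm (B * indicat_real {c..d} x)"
      using F0 FB order_trans[OF F0 FB] by (auto simp: indicator_def)
    show "integrable lborel (\<lambda>x. B * indicat_real {c..d} x)"
      by (intro integrable_mult_right integrable_real_indicator) (auto simp: emeasure_lborel_Icc_eq)
  qed auto
  have int: "(\<integral>\<^sup>+x. ennreal (indicat_real {a..b} x * g n x) \<partial>lborel) \<le> ennreal B" for n
  proof -
    define h where "h = 1 / real (Suc n)"
    have h: "0 < h" by (simp add: h_def)
    have e: "indicat_real {a..b} x * g n x = (1 / h) * (indicat_real {a..b} x * F (x - 0) - indicat_real {a..b} x * F (x - h))" for x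
      by (simp add: g_def h_def algebra_simps)
    have ig: "integrable lborel (\<lambda>x. indicat_real {a..b} x * g n x)"
      unfolding e by (intro integrable_mult_right Bochner_Integration.integrable_diff ii)
    have "(\<integral>x. indicat_real {a..b} x * F (x - h) \<partial>lborel) = (\<integral>x. indicat_real {a - h..b - h} x * F (x - 0) \<partial>lborel)"
      using lborel_integral_real_affine[of 1 "\<lambda>x. indicat_real {a - h..b - h} x * F (x - 0)" "- h"]
      by (simp add: indicator_def algebra_simps)
    then have "(\<integral>x. indicat_real {a..b} x * g n x \<partial>lborel) =
      (1 / h) * ((\<integral>x. indicat_real {a..b} x * F (x - 0) \<partial>lborel) - (\<integral>x. indicat_real {a - h..b - h} x * F (x - 0) \<partial>lborel))"
      unfolding e using ii[of a b 0] ii[of a b h] by (simp add: Bochner_Integration.integral_diff)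
    also have "\<dots> = (1 / h) * (\<integral>x. indicat_real {a..b} x * F (x - 0) - indicat_real {a - h..b - h} x * F (x - 0) \<partial>lborel)"
      using ii[of a b 0] ii[of "a - h" "b - h" 0] by (simp add: Bochner_Integration.integral_diff)
    also have "\<dots> \<le> (1 / h) * (\<integral>x. B * indicat_real {b - h..b} x \<partial>lborel)"
    proof (intro mult_left_mono integral_mono Bochner_Integration.integrable_diff ii)
      show "indicat_real {a..b} x * F (x - 0) - indicat_real {a - h..b - h} x * F (x - 0) \<le> B * indicat_real {b - h..b} x" for x
        using F0[of x] FB[of x] h by (auto simp: indicator_def)
    qed (use h in auto)
    also have "\<dots> = B" using h by simp
    finally have "(\<integral>x. indicat_real {a..b} x * g n x \<partial>lborel) \<le> B" .
    then show ?thesis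
      by (subst nn_integral_eq_integral[OF ig]) (auto simp: g0 intro: ennreal_leI)
  qed
  have "(\<integral>\<^sup>+x. liminf (\<lambda>n. ennreal (indicat_real {a..b} x * g n x)) \<partial>lborel) \<le>
     liminf (\<lambda>n. \<integral>\<^sup>+x. ennreal (indicat_real {a..b} x * g n x) \<partial>lborel)"
    by (rule nn_integral_liminf) measurable
  also have "\<dots> \<le> limsup (\<lambda>n. \<integral>\<^sup>+x. ennreal (indicat_real {a..b} x * g n x) \<partial>lborel)"
    by (rule Liminf_le_Limsup) simp
  also have "\<dots> \<le> ennreal B" by (rule Limsup_bounded) (simp add: int)
  finally have "(\<integral>\<^sup>+x. liminf (\<lambda>n. ennreal (indicat_real {a..b} x * g n x)) \<partial>lborel) \<noteq> \<infinity>"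
    using ennreal_less_top[of B] by (auto simp: top_unique)
  then have "AE x in lborel. liminf (\<lambda>n. ennreal (indicat_real {a..b} x * g n x)) \<noteq> \<infinity>"
    by (intro nn_integral_PInf_AE) measurable
  then show ?thesis
  proof eventually_elim
    case (elim x)
    show ?case
    proof
      assume x: "x \<in> {a<..b}"
      obtain C where C: "liminf (\<lambda>n. ennreal (indicat_real {a..b} x * g n x)) < ennreal C"
      proof (cases "liminf (\<lambda>n. ennreal (indicat_real {a..b} x * g n x))" rule: ennreal_cases)
        case (real r)
        then have "liminf (\<lambda>n. ennreal (indicat_real {a..b} x * g n x)) < ennreal (r + 1)"
          by (simp add: ennreal_lessI)
        then show ?thesis by (rule that)
      next
        case top
        then show ?thesis using elim by simp
      qed
      have fr: "\<exists>\<^sub>F n in sequentially. g n x < C"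
      proof (rule ccontr)
        assume "\<not> ?thesis"
        then have "\<forall>\<^sub>F n in sequentially. C \<le> g n x" by (simp add: frequently_def not_less)
        then have "\<forall>\<^sub>F n in sequentially. ennreal C \<le> ennreal (indicat_real {a..b} x * g n x)"
          by eventually_elim (use x in \<open>auto intro: ennreal_leI\<close>)
        then have "ennreal C \<le> liminf (\<lambda>n. ennreal (indicat_real {a..b} x * g n x))" by (rule Liminf_bounded)
        then show False using C by simp
      qed
      have ev: "\<forall>\<^sub>F n in sequentially. 1 / real (Suc n) < x - a"
        using x LIMSEQ_Suc[OF lim_1_over_n[where 'a = real]] by (auto simp: order_tendsto_iff)
      have "\<exists>\<^sub>F n in sequentially. f (x - 1 / real (Suc n)) - f x \<le> C / real (Suc n)"
        using frequently_eventually_frequently[OF fr ev]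
      proof (rule frequently_elim1)
        fix n assume n: "g n x < C \<and> 1 / real (Suc n) < x - a"
        have "F x = f a - f x" using x by (simp add: F_def)
        moreover have "F (x - 1 / real (Suc n)) = f a - f (x - 1 / real (Suc n))"
        proof -
          have "0 < 1 / real (Suc n)" by simp
          then have "a \<le> x - 1 / real (Suc n)" "x - 1 / real (Suc n) \<le> b"
            using n x unfolding greaterThanAtMost_iff by linarith+
          then have "max a (min b (x - 1 / real (Suc n))) = x - 1 / real (Suc n)" by simp
          then show ?thesis by (simp add: F_def)
        qed
        ultimately have "real (Suc n) * (f (x - 1 / real (Suc n)) - f x) < C" using n by (simp add: g_def)
        then show "f (x - 1 / real (Suc n)) - f x \<le> C / real (Suc n)"
          by (simp add: pos_le_divide_eq mult.commute del: of_nat_Suc)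
      qed
      then show "\<exists>C. \<exists>\<^sub>F n in sequentially. f (x - 1 / real (Suc n)) - f x \<le> C / real (Suc n)" by blast
    qed
  qed
qed

subsection \<open>Deforming paths along the gradient\<close>

lemma energy_gradient_continuous_on:
  assumes K: "uniformly_continuous_on UNIV K" and M: "\<And>z. \<bar>K z\<bar> \<le> M"
  shows "continuous_on {u. 0 < length_h1 u} (energy_gradient K lam)"
  unfolding continuous_on_sequentially
  by (auto simp: o_def intro!: energy_gradient_limit[OF K M])

lemma norm_energy_gradient_le:
  assumes K: "continuous_on UNIV K" and M: "\<And>z. \<bar>K z\<bar> \<le> M"
  shows "norm (energy_gradient K lam u) \<le> 1 + \<bar>lam\<bar> * (2 * (M * length_h1 u))"
proof -
  have M0: "0 \<le> M" using M[of 0] by linarith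
  have "norm (h1_riesz (h1_force K u)) \<le> 2 * (M * length_h1 u)"
    using norm_h1_riesz_le[OF h1_force_sq_int[OF K], of u] L2n_h1_force_le[OF K M0 M, of u] by linarith
  then have "norm (lam *\<^sub>R h1_riesz (h1_force K u)) \<le> \<bar>lam\<bar> * (2 * (M * length_h1 u))"
    by (simp add: mult_left_mono)
  moreover have "norm (sgn (h1_centre u)) \<le> 1" by (simp add: norm_sgn)
  ultimately show ?thesis
    unfolding energy_gradient_def
    using norm_triangle_ineq[of "sgn (h1_centre u)" "lam *\<^sub>R h1_riesz (h1_force K u)"] by linarith
qed

text \<open>Along the segment the gradient stays within \<open>\<delta> / 2\<close> of its initial value, which has norm at least
  \<open>\<delta>\<close>; so the energy decreases at least at the rate \<open>\<delta>\<^sup>2 / 2\<close>.\<close>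

lemma energy_descent:
  assumes K: "uniformly_continuous_on UNIV K" and M: "\<And>z. \<bar>K z\<bar> \<le> M"
    and near: "\<And>x. norm (u - x) \<le> d \<Longrightarrow>
      0 < length_h1 x \<and> norm (energy_gradient K lam u - energy_gradient K lam x) \<le> \<delta> / 2"
    and \<delta>: "0 < \<delta>" "\<delta> \<le> norm (energy_gradient K lam u)"
    and \<sigma>: "0 \<le> \<sigma>" "\<sigma> * norm (energy_gradient K lam u) \<le> d"
  shows "energy K lam (u - \<sigma> *\<^sub>R energy_gradient K lam u) \<le> energy K lam u - \<sigma> * (\<delta>\<^sup>2 / 2)"
proof -
  define g where "g = energy_gradient K lam u"
  define \<psi> where "\<psi> r = energy K lam (u - r *\<^sub>R g) + r * (\<delta>\<^sup>2 / 2)" for r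
  have "\<psi> \<sigma> \<le> \<psi> 0"
  proof (rule DERIV_nonpos_imp_nonincreasing[OF \<sigma>(1)])
    fix r assume r: "0 \<le> r" "r \<le> \<sigma>"
    define x where "x = u - r *\<^sub>R g"
    have "r * norm g \<le> d" using r(2) \<sigma>(2) mult_right_mono[of r \<sigma> "norm g"] unfolding g_def by auto
    then have n: "norm (u - x) \<le> d" using r by (simp add: x_def)
    note nx = near[OF n]
    have l: "((\<lambda>r. u - r *\<^sub>R g) has_derivative (\<lambda>h. - (h *\<^sub>R g))) (at r)"
      by (auto intro!: derivative_eq_intros)
    have e: "(energy K lam has_derivative (\<lambda>h. inner (energy_gradient K lam x) h)) (at x)"
      by (rule energy_has_derivative[OF K M]) (use nx in blast)
    have "((\<lambda>r. energy K lam (u - r *\<^sub>R g)) has_derivative (\<lambda>h. inner (energy_gradient K lam x) (- (h *\<^sub>R g)))) (at r)"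
      using has_derivative_compose[OF l e[unfolded x_def]] by (simp add: x_def)
    moreover have "(\<lambda>h. inner (energy_gradient K lam x) (- (h *\<^sub>R g))) = (*) (- inner (energy_gradient K lam x) g)"
      by (simp add: fun_eq_iff)
    ultimately have "((\<lambda>r. energy K lam (u - r *\<^sub>R g)) has_real_derivative - inner (energy_gradient K lam x) g) (at r)"
      by (simp add: has_field_derivative_def)
    then have "(\<psi> has_real_derivative - inner (energy_gradient K lam x) g + \<delta>\<^sup>2 / 2) (at r)"
      unfolding \<psi>_def by (auto intro!: derivative_eq_intros)
    moreover have "- inner (energy_gradient K lam x) g + \<delta>\<^sup>2 / 2 \<le> 0"
    proof -
      have "inner (g - energy_gradient K lam x) g \<le> \<delta> / 2 * norm g"
        using norm_cauchy_schwarz[of "g - energy_gradient K lam x" g] nx mult_right_mono[of "norm (g - energy_gradient K lam x)" "\<delta> / 2" "norm g"]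
        unfolding g_def by auto
      also have "\<dots> \<le> norm g / 2 * norm g" using \<delta> unfolding g_def by (intro mult_right_mono) auto
      finally have "inner g g - inner (energy_gradient K lam x) g \<le> (norm g)\<^sup>2 / 2"
        by (simp add: inner_diff_left power2_eq_square)
      moreover have "inner g g = (norm g)\<^sup>2" by (simp add: power2_norm_eq_inner)
      moreover have "\<delta>\<^sup>2 \<le> (norm g)\<^sup>2" using \<delta> unfolding g_def by (intro power_mono) auto
      ultimately show ?thesis by linarith
    qed
    ultimately show "\<exists>y. (\<psi> has_real_derivative y) (at r) \<and> y \<le> 0" by blast
  qed
  then show ?thesis by (simp add: \<psi>_def g_def)
qed

text \<open>Moving each point of the path by a multiple of its gradient, cut off where the energy is at most
  \<open>c - \<eta>\<close>, would give a path below the level \<open>c - \<eta> / 2\<close>. Both end points have energy at most \<open>0 < c - \<eta>\<close> and are kept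
  fixed by the cut-off, which also avoids the constant maps, where there is no gradient.\<close>

lemma no_deformable_path:
  assumes K: "uniformly_continuous_on UNIV K" and M: "\<And>z. \<bar>K z\<bar> \<le> M"
    and c: "c = mp_inf_max (energy K lam) w" and w: "energy K lam w \<le> 0"
    and g: "\<gamma> \<in> mp_paths w"
    and A: "\<And>s. s \<in> {0..1} \<Longrightarrow> energy K lam (\<gamma> s) \<le> c + A"
    and B: "\<And>s. s \<in> {0..1} \<Longrightarrow> c - \<eta> \<le> energy K lam (\<gamma> s) \<Longrightarrow>
      l \<le> length_h1 (\<gamma> s) \<and> length_h1 (\<gamma> s) \<le> L \<and> \<delta> \<le> norm (energy_gradient K lam (\<gamma> s))"
    and near: "\<And>u x. l \<le> length_h1 u \<Longrightarrow> length_h1 u \<le> L \<Longrightarrow> norm (u - x) \<le> d \<Longrightarrow>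
      0 < length_h1 x \<and> norm (energy_gradient K lam u - energy_gradient K lam x) \<le> \<delta> / 2"
    and \<Gamma>: "\<And>u. length_h1 u \<le> L \<Longrightarrow> norm (energy_gradient K lam u) \<le> \<Gamma>"
    and pos: "0 < \<eta>" "\<eta> < c" "0 < l" "0 < \<delta>" "0 \<le> \<tau>" "\<tau> * \<Gamma> \<le> d" "A + \<eta> / 2 < \<tau> * (\<delta>\<^sup>2 / 2)"
  shows False
proof -
  \<comment> \<open>0 up to the level \<open>c - \<eta>\<close>, 1 from the level \<open>c - \<eta> / 2\<close> on\<close>
  define cut where "cut s = max 0 (min 1 ((energy K lam (\<gamma> s) - (c - \<eta>)) / (\<eta> / 2)))" for s
  define \<gamma>' where "\<gamma>' s = \<gamma> s - (\<tau> * cut s) *\<^sub>R energy_gradient K lam (\<gamma> s)" for s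
  have cut01: "0 \<le> cut s" "cut s \<le> 1" for s by (auto simp: cut_def)
  have cut0: "cut s = 0" if "energy K lam (\<gamma> s) \<le> c - \<eta>" for s
  proof -
    have "(energy K lam (\<gamma> s) - (c - \<eta>)) / (\<eta> / 2) \<le> 0"
      using that pos(1) by (intro divide_nonpos_pos) auto
    then show ?thesis unfolding cut_def by linarith
  qed
  have cut1: "cut s = 1" if "c - \<eta> / 2 \<le> energy K lam (\<gamma> s)" for s
  proof -
    have "1 \<le> (energy K lam (\<gamma> s) - (c - \<eta>)) / (\<eta> / 2)" using that pos(1) by (simp add: pos_le_divide_eq)
    then show ?thesis by (simp add: cut_def)
  qed
  have cg: "continuous_on {0..1} \<gamma>" using g by (simp add: mp_paths_def)
  have cE: "continuous_on {0..1} (\<lambda>s. energy K lam (\<gamma> s))"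
    by (rule continuous_on_compose2[OF energy_continuous[OF K M, of UNIV] cg]) auto
  have ccut: "continuous_on {0..1} cut" unfolding cut_def by (intro continuous_intros cE) (use pos in auto)
  define S1 where "S1 = {s \<in> {0..1}. energy K lam (\<gamma> s) \<le> c - \<eta>}"
  define S2 where "S2 = {s \<in> {0..1}. c - \<eta> \<le> energy K lam (\<gamma> s)}"
  have "{0..1} = S1 \<union> S2" by (auto simp: S1_def S2_def)
  moreover have "continuous_on (S1 \<union> S2) \<gamma>'"
  proof (rule continuous_on_closed_Un)
    show "closed S1" unfolding S1_def
      using continuous_closed_preimage[OF cE closed_atLeastAtMost closed_atMost[of "c - \<eta>"]]
      by (simp add: vimage_def Int_def)
    show "closed S2" unfolding S2_def
      using continuous_closed_preimage[OF cE closed_atLeastAtMost closed_atLeast[of "c - \<eta>"]]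
      by (simp add: vimage_def Int_def)
    show "continuous_on S1 \<gamma>'"
    proof (rule continuous_on_eq)
      show "continuous_on S1 \<gamma>" by (rule continuous_on_subset[OF cg]) (auto simp: S1_def)
    qed (simp add: \<gamma>'_def S1_def cut0)
    show "continuous_on S2 \<gamma>'"
    proof -
      have s: "S2 \<subseteq> {0..1}" by (auto simp: S2_def)
      have "continuous_on S2 (\<lambda>s. energy_gradient K lam (\<gamma> s))"
      proof (rule continuous_on_compose2[OF energy_gradient_continuous_on[OF K M]])
        show "\<gamma> ` S2 \<subseteq> {u. 0 < length_h1 u}" using B pos(3) by (fastforce simp: S2_def)
      qed (rule continuous_on_subset[OF cg s])
      then show ?thesis
        unfolding \<gamma>'_def
        by (intro continuous_intros continuous_on_subset[OF cg s] continuous_on_subset[OF ccut s])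
    qed
  qed
  ultimately have "continuous_on {0..1} \<gamma>'" by simp
  moreover have "\<gamma>' 0 = 0" "\<gamma>' 1 = w"
    using g pos(1,2) w cut0[of 0] cut0[of 1] by (auto simp: \<gamma>'_def mp_paths_def)
  ultimately have mem: "\<gamma>' \<in> mp_paths w" by (simp add: mp_paths_def)
  have "energy K lam (\<gamma>' s) \<le> c - \<eta> / 2" if s: "s \<in> {0..1}" for s
  proof (cases "energy K lam (\<gamma> s) \<le> c - \<eta>")
    case True
    then show ?thesis using cut0[OF True] pos(1) by (simp add: \<gamma>'_def)
  next
    case False
    then have b: "l \<le> length_h1 (\<gamma> s)" "length_h1 (\<gamma> s) \<le> L" "\<delta> \<le> norm (energy_gradient K lam (\<gamma> s))"
      using B[OF s] by auto
    have n0: "0 \<le> \<tau> * cut s" using pos cut01 by simp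
    have "\<tau> * cut s * norm (energy_gradient K lam (\<gamma> s)) \<le> \<tau> * 1 * \<Gamma>"
      using pos cut01 \<Gamma>[OF b(2)] by (intro mult_mono) auto
    then have "\<tau> * cut s * norm (energy_gradient K lam (\<gamma> s)) \<le> d" using pos by simp
    from energy_descent[OF K M near[OF b(1,2)] pos(4) b(3) n0 this]
    have e: "energy K lam (\<gamma>' s) \<le> energy K lam (\<gamma> s) - \<tau> * cut s * (\<delta>\<^sup>2 / 2)" by (simp add: \<gamma>'_def)
    show ?thesis
    proof (cases "energy K lam (\<gamma> s) \<le> c - \<eta> / 2")
      case True
      have "0 \<le> \<tau> * cut s * (\<delta>\<^sup>2 / 2)" using n0 by simp
      then show ?thesis using e True by linarith
    next
      case False
      then have "cut s = 1" by (intro cut1) simp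
      then have "energy K lam (\<gamma>' s) \<le> energy K lam (\<gamma> s) - \<tau> * (\<delta>\<^sup>2 / 2)" using e by simp
      then show ?thesis using A[OF s] pos(7) by linarith
    qed
  qed
  then have "c \<le> c - \<eta> / 2" unfolding c by (intro mp_inf_max_le[OF K M mem]) auto
  then show False using pos(1) by linarith
qed

text \<open>Let \<open>\<mu> = \<lambda> - h\<close> for a small \<open>h\<close> at which the difference quotient is at most \<open>C\<close>, and take a path that
  is optimal for \<open>E\<^sub>\<mu>\<close> up to \<open>h \<mu>\<close>. Where \<open>E\<^sub>\<lambda> \<ge> c - \<lambda> h\<close> on this path, the length is controlled by
  \<open>L (1/\<mu> - 1/\<lambda>) = E\<^sub>\<mu>/\<mu> - E\<^sub>\<lambda>/\<lambda> \<le> (\<bar>C\<bar> + 2) h\<close>; the factor \<open>1/\<mu> - 1/\<lambda> = h / (\<mu> \<lambda>)\<close> cancels \<open>h\<close>.\<close>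

lemma bounded_palais_smale_sequence:
  assumes K: "uniformly_continuous_on UNIV K" and M: "\<And>z. \<bar>K z\<bar> \<le> M" "0 < M"
    and lam: "0 < lam" and w: "0 < length_h1 w" "energy K lam w \<le> 0"
    and C: "\<exists>\<^sub>F n in sequentially. mp_inf_max (energy K (lam - 1 / real (Suc n))) w / (lam - 1 / real (Suc n))
      - mp_inf_max (energy K lam) w / lam \<le> C / real (Suc n)"
  obtains L where "\<And>e. 0 < e \<Longrightarrow> \<exists>u. \<bar>energy K lam u - mp_inf_max (energy K lam) w\<bar> \<le> e \<and>
    length_h1 u \<le> L \<and> norm (energy_gradient K lam u) \<le> e"
proof -
  have cK: "continuous_on UNIV K" by (rule uniformly_continuous_imp_continuous[OF K])
  define c where "c = mp_inf_max (energy K lam) w"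
  have c: "0 < c" unfolding c_def by (rule mp_inf_max_pos[OF K M lam w(1)])
  define L where "L = (\<bar>C\<bar> + 2) * lam\<^sup>2"
  have L0: "0 \<le> L" by (simp add: L_def)
  show ?thesis
  proof (rule that[of L], rule ccontr)
    fix e :: real assume e: "0 < e"
      and "\<not> (\<exists>u. \<bar>energy K lam u - mp_inf_max (energy K lam) w\<bar> \<le> e \<and> length_h1 u \<le> L \<and> norm (energy_gradient K lam u) \<le> e)"
    then have no: "e \<le> norm (energy_gradient K lam u)" if "\<bar>energy K lam u - c\<bar> \<le> e" "length_h1 u \<le> L" for u
      using that unfolding c_def by force
    \<comment> \<open>maps with at least half the energy \<open>c\<close> cannot be shorter than this\<close>
    define l where "l = min 1 (c / (2 * (1 + lam * M)))"
    have p1: "0 < 1 + lam * M" using lam M(2) by (simp add: add_pos_pos)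
    have l: "0 < l" using c p1 by (simp add: l_def)
    have low: "l \<le> length_h1 u" if "c / 2 \<le> energy K lam u" for u
    proof (rule ccontr)
      assume "\<not> ?thesis"
      then have u: "length_h1 u < 1" "length_h1 u < c / (2 * (1 + lam * M))" by (auto simp: l_def)
      have "lam * G_h1 K u \<le> lam * (M * (length_h1 u)\<^sup>2)"
        using G_h1_le[OF cK M(1), of u] lam by (intro mult_left_mono) auto
      also have "\<dots> \<le> lam * (M * length_h1 u)"
        using u lam M(2) mult_right_mono[of "length_h1 u" 1 "length_h1 u"]
        by (intro mult_left_mono) (auto simp: power2_eq_square)
      finally have "energy K lam u \<le> length_h1 u * (1 + lam * M)" by (simp add: energy_def algebra_simps)
      also have "\<dots> < c / (2 * (1 + lam * M)) * (1 + lam * M)" using u(2) p1 by (intro mult_strict_right_mono)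
      also have "\<dots> = c / 2" using p1 by (simp del: distrib_left_numeral)
      finally show False using that by simp
    qed
    obtain d where d: "0 < d" "\<And>u x. l \<le> length_h1 u \<Longrightarrow> length_h1 u \<le> L \<Longrightarrow> norm (u - x) \<le> d \<Longrightarrow>
      0 < length_h1 x \<and> norm (energy_gradient K lam u - energy_gradient K lam x) \<le> e / 2"
      by (rule energy_gradient_uniformly_continuous[OF K M(1) l, of "e / 2" L lam]) (use e in auto)
    define \<Gamma> where "\<Gamma> = 1 + lam * (2 * (M * L))"
    have \<Gamma>0: "0 < \<Gamma>" unfolding \<Gamma>_def using lam M(2) L0 by (intro add_pos_nonneg) auto
    have \<Gamma>: "norm (energy_gradient K lam u) \<le> \<Gamma>" if "length_h1 u \<le> L" for u
    proof -
      have "\<bar>lam\<bar> * (2 * (M * length_h1 u)) \<le> lam * (2 * (M * L))"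
        using that lam M(2) by (intro mult_mono) auto
      then show ?thesis using norm_energy_gradient_le[OF cK M(1), of lam u] unfolding \<Gamma>_def by linarith
    qed
    define \<tau> where "\<tau> = d / \<Gamma>"
    have \<tau>: "0 < \<tau>" "\<tau> * \<Gamma> \<le> d" using d(1) \<Gamma>0 by (auto simp: \<tau>_def)
    define m where "m = min (min e (c / 2)) (\<tau> * (e\<^sup>2 / 2))"
    have m: "0 < m" using e c \<tau> by (simp add: m_def)
    \<comment> \<open>\<open>Q h\<close> bounds both the excess of the path over \<open>c\<close> and the width \<open>\<lambda> h\<close> of the band below \<open>c\<close>\<close>
    define Q where "Q = lam * (\<bar>C\<bar> + 2)"
    have "(\<lambda>n. Q * (1 / real (Suc n))) \<longlonglongrightarrow> Q * 0"
      by (intro tendsto_mult tendsto_const LIMSEQ_Suc[OF lim_1_over_n])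
    then have "\<forall>\<^sub>F n in sequentially. Q * (1 / real (Suc n)) < m" using m by (auto simp: order_tendsto_iff)
    moreover have "\<forall>\<^sub>F n in sequentially. 1 / real (Suc n) < lam"
      using lam LIMSEQ_Suc[OF lim_1_over_n[where 'a = real]] by (auto simp: order_tendsto_iff)
    ultimately have "\<forall>\<^sub>F n in sequentially. Q * (1 / real (Suc n)) < m \<and> 1 / real (Suc n) < lam"
      by (rule eventually_conj)
    from frequently_ex[OF frequently_eventually_frequently[OF C this]]
    obtain n where n: "mp_inf_max (energy K (lam - 1 / real (Suc n))) w / (lam - 1 / real (Suc n)) - c / lam \<le> C / real (Suc n)"
      "Q * (1 / real (Suc n)) < m" "1 / real (Suc n) < lam" unfolding c_def by blast
    define h where "h = 1 / real (Suc n)"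
    have h: "0 < h" "h < lam" "Q * h < m" using n by (auto simp: h_def)
    define \<mu> where "\<mu> = lam - h"
    have \<mu>: "0 < \<mu>" "\<mu> < lam" using h by (auto simp: \<mu>_def)
    have Ch: "C / real (Suc n) \<le> \<bar>C\<bar> * h" by (simp add: h_def divide_right_mono)
    have fq: "mp_inf_max (energy K \<mu>) w / \<mu> \<le> c / lam + \<bar>C\<bar> * h"
      using n(1) Ch unfolding \<mu>_def h_def[symmetric] by linarith
    have "mp_inf_max (energy K \<mu>) w < mp_inf_max (energy K \<mu>) w + h * \<mu>" using h \<mu> by simp
    then obtain \<gamma> where g: "\<gamma> \<in> mp_paths w" "\<And>s. s \<in> {0..1} \<Longrightarrow> energy K \<mu> (\<gamma> s) \<le> mp_inf_max (energy K \<mu>) w + h * \<mu>"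
      by (rule mp_inf_max_approx[OF _ K M(1)]) blast
    have em: "energy K \<mu> (\<gamma> s) / \<mu> \<le> c / lam + (\<bar>C\<bar> + 1) * h" if "s \<in> {0..1}" for s
    proof -
      have "energy K \<mu> (\<gamma> s) / \<mu> \<le> (mp_inf_max (energy K \<mu>) w + h * \<mu>) / \<mu>"
        using g(2)[OF that] \<mu> by (intro divide_right_mono) auto
      also have "\<dots> = mp_inf_max (energy K \<mu>) w / \<mu> + h" using \<mu> by (simp add: add_divide_distrib)
      finally show ?thesis using fq by (simp add: algebra_simps)
    qed
    define A where "A = lam * (\<bar>C\<bar> + 1) * h"
    have Q1: "A + lam * h = Q * h" by (simp add: A_def Q_def algebra_simps)
    have A0: "0 \<le> A" using lam h by (simp add: A_def)
    have lh: "0 < lam * h" using lam h by simp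
    have up: "energy K lam (\<gamma> s) \<le> c + A" if "s \<in> {0..1}" for s
    proof -
      have "energy K lam (\<gamma> s) \<le> lam * (energy K \<mu> (\<gamma> s) / \<mu>)"
        using energy_parameter_le[of \<mu> lam K "\<gamma> s"] \<mu> by simp
      also have "\<dots> \<le> lam * (c / lam + (\<bar>C\<bar> + 1) * h)" using em[OF that] lam by (intro mult_left_mono) auto
      also have "\<dots> = c + A" using lam by (simp add: A_def algebra_simps)
      finally show ?thesis .
    qed
    show False
    proof (rule no_deformable_path[OF K M(1) c_def w(2) g(1) up, where \<eta> = "lam * h" and \<delta> = e and d = d
        and l = l and L = L and \<Gamma> = \<Gamma> and \<tau> = \<tau>])
      fix s :: real assume s: "s \<in> {0..1}" and Es: "c - lam * h \<le> energy K lam (\<gamma> s)"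
      have "length_h1 (\<gamma> s) * (h / (\<mu> * lam)) = energy K \<mu> (\<gamma> s) / \<mu> - energy K lam (\<gamma> s) / lam"
        using \<mu> lam by (simp add: energy_def \<mu>_def field_simps)
      also have "\<dots> \<le> (\<bar>C\<bar> + 2) * h"
      proof -
        have "(c - lam * h) / lam \<le> energy K lam (\<gamma> s) / lam" using Es lam by (intro divide_right_mono) auto
        moreover have "(c - lam * h) / lam = c / lam - h" using lam by (simp add: diff_divide_distrib)
        ultimately show ?thesis using em[OF s] by (simp add: algebra_simps)
      qed
      finally have "h * length_h1 (\<gamma> s) \<le> h * ((\<bar>C\<bar> + 2) * (\<mu> * lam))"
        using \<mu> lam by (simp add: pos_divide_le_eq mult_ac)
      then have "length_h1 (\<gamma> s) \<le> (\<bar>C\<bar> + 2) * (\<mu> * lam)" using h(1) by (rule mult_left_le_imp_le)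
      also have "\<dots> \<le> (\<bar>C\<bar> + 2) * (lam * lam)" using \<mu> lam by (intro mult_left_mono mult_right_mono) auto
      finally have lL: "length_h1 (\<gamma> s) \<le> L" by (simp add: L_def power2_eq_square)
      have "\<bar>energy K lam (\<gamma> s) - c\<bar> \<le> e"
        using Es up[OF s] h(3) Q1 A0 lh unfolding m_def by linarith
      from no[OF this lL] have "e \<le> norm (energy_gradient K lam (\<gamma> s))" .
      moreover have "c / 2 \<le> energy K lam (\<gamma> s)" using Es h(3) Q1 A0 unfolding m_def by linarith
      ultimately show "l \<le> length_h1 (\<gamma> s) \<and> length_h1 (\<gamma> s) \<le> L \<and> e \<le> norm (energy_gradient K lam (\<gamma> s))"
        using low lL by blast
    next
      show "lam * h < c" using h(3) Q1 A0 c unfolding m_def by linarith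
      show "A + lam * h / 2 < \<tau> * (e\<^sup>2 / 2)" using h(3) Q1 lh unfolding m_def by linarith
    qed (use lh l e \<tau> d(2) \<Gamma> in auto)
  qed
qed

section \<open>Critical points at almost every mountain pass level\<close>

lemma mountain_pass_positive:
  assumes K: "continuous_on UNIV K" and lim: "(K \<longlongrightarrow> K0) at_infinity" and K0: "K0 \<noteq> 0"
    and ab: "0 < a" "a < b" and adm: "admissible_pos K K0 a b r0 R" and z0: "R \<le> norm z0"
  defines "c \<equiv> \<lambda>lam. mp_inf_max (energy K lam) (h1_circle r0 K0 + h1_const z0)"
  shows "\<forall>lam\<in>{a..b}. c lam \<le> pi / \<bar>lam * K0\<bar>"
    and "AE lam in lborel. lam \<in> {a..b} \<longrightarrow> c lam < pi / \<bar>lam * K0\<bar> \<longrightarrow>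
       critical_value_off_constants (energy K lam) (c lam) \<and> (\<exists>C. F_loop (\<lambda>z. lam * K z) C)"
proof -
  define w where "w = h1_circle r0 K0 + h1_const z0"
  have uK: "uniformly_continuous_on UNIV K" by (rule uniformly_continuous_if_limit_at_infinity[OF K lim])
  obtain M where M: "0 < M" "\<And>z. \<bar>K z\<bar> \<le> M" by (rule bounded_if_limit_at_infinity[OF K lim]) blast
  have r: "0 < r0" "0 < R"
    and neg: "\<And>z lam. R \<le> norm z \<Longrightarrow> lam \<in> {a..b} \<Longrightarrow> energy K lam (h1_circle r0 K0 + h1_const z) < 0"
    using adm unfolding admissible_pos_def by blast+
  have lw: "0 < length_h1 w" using r by (simp add: w_def length_h1_circle)
  show "\<forall>lam\<in>{a..b}. c lam \<le> pi / \<bar>lam * K0\<bar>"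
  proof
    fix lam assume l: "lam \<in> {a..b}"
    then have "0 < lam" using ab by auto
    then show "c lam \<le> pi / \<bar>lam * K0\<bar>" unfolding c_def
      by (rule mp_level_le_circle_level[OF K lim K0 _ r(1,2) z0]) (rule neg[OF _ l])
  qed
  have dq: "AE lam in lborel. lam \<in> {a<..b} \<longrightarrow>
    (\<exists>C. \<exists>\<^sub>F n in sequentially. c (lam - 1 / real (Suc n)) / (lam - 1 / real (Suc n)) - c lam / lam \<le> C / real (Suc n))"
    by (rule antimono_difference_quotients[OF ab(2), of "\<lambda>lam. c lam / lam"])
      (unfold c_def, rule mp_level_antimono[OF uK M(2)], use ab in auto)
  \<comment> \<open>at \<open>a\<close> there is no smaller parameter to compare with\<close>
  have "AE lam in lborel. lam \<noteq> a" by (rule AE_lborel_singleton)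
  with dq show "AE lam in lborel. lam \<in> {a..b} \<longrightarrow> c lam < pi / \<bar>lam * K0\<bar> \<longrightarrow>
       critical_value_off_constants (energy K lam) (c lam) \<and> (\<exists>C. F_loop (\<lambda>z. lam * K z) C)"
  proof eventually_elim
    case (elim lam)
    show ?case
    proof (intro impI)
      assume l: "lam \<in> {a..b}" and cl: "c lam < pi / \<bar>lam * K0\<bar>"
      have lam: "0 < lam" using l ab by auto
      obtain C where C: "\<exists>\<^sub>F n in sequentially. mp_inf_max (energy K (lam - 1 / real (Suc n))) w / (lam - 1 / real (Suc n))
          - mp_inf_max (energy K lam) w / lam \<le> C / real (Suc n)"
        using elim l unfolding c_def w_def by force
      have wn: "energy K lam w \<le> 0" using neg[OF z0 l] by (simp add: w_def)
      have cw: "c lam = mp_inf_max (energy K lam) w" by (simp add: c_def w_def)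
      obtain L where L: "\<And>e. 0 < e \<Longrightarrow> \<exists>u. \<bar>energy K lam u - c lam\<bar> \<le> e \<and> length_h1 u \<le> L \<and> norm (energy_gradient K lam u) \<le> e"
        unfolding cw by (rule bounded_palais_smale_sequence[OF uK M(2,1) lam lw wn C]) blast
      have cp: "0 < c lam" unfolding cw by (rule mp_inf_max_pos[OF uK M(2,1) lam lw])
      have L0: "0 \<le> L" using L[of 1] order_trans[OF length_h1_nonneg] by auto
      \<comment> \<open>the second bound keeps the energies, hence the lengths, away from zero\<close>
      define \<epsilon> where "\<epsilon> n = min (1 / real (Suc n)) (c lam / 2)" for n
      have \<epsilon>: "0 < \<epsilon> n" "\<epsilon> n \<le> 1 / real (Suc n)" "\<epsilon> n \<le> c lam / 2" for n using cp by (auto simp: \<epsilon>_def)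
      have "\<forall>n. \<exists>u. \<bar>energy K lam u - c lam\<bar> \<le> \<epsilon> n \<and> length_h1 u \<le> L \<and> norm (energy_gradient K lam u) \<le> \<epsilon> n"
        using L \<epsilon>(1) by blast
      then obtain u where u: "\<And>n. \<bar>energy K lam (u n) - c lam\<bar> \<le> \<epsilon> n" "\<And>n. length_h1 (u n) \<le> L"
        "\<And>n. norm (energy_gradient K lam (u n)) \<le> \<epsilon> n" by metis
      have lim0: "(\<lambda>n. 1 / real (Suc n)) \<longlonglongrightarrow> 0" by (rule LIMSEQ_Suc[OF lim_1_over_n])
      have "(\<lambda>n. energy K lam (u n) - c lam) \<longlonglongrightarrow> 0"
        by (rule Lim_null_comparison[OF _ lim0]) (use u(1) \<epsilon>(2) order_trans in \<open>fastforce intro!: always_eventually\<close>)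
      then have uE: "(\<lambda>n. energy K lam (u n)) \<longlonglongrightarrow> c lam" by (simp add: LIM_zero_iff)
      have ug: "(\<lambda>n. energy_gradient K lam (u n)) \<longlonglongrightarrow> 0"
        by (rule Lim_null_comparison[OF _ lim0]) (use u(3) \<epsilon>(2) order_trans in \<open>blast intro!: always_eventually\<close>)
      define D where "D = 2 * (1 + lam * (M * L))"
      have D: "0 < D" using lam M(1) L0 by (simp add: D_def add_pos_nonneg)
      have lo: "c lam / D \<le> length_h1 (u n)" for n
      proof -
        have "lam * G_h1 K (u n) \<le> lam * (M * (length_h1 (u n))\<^sup>2)"
          using G_h1_le[OF K M(2), of "u n"] lam by (intro mult_left_mono) auto
        also have "\<dots> \<le> lam * (M * (length_h1 (u n) * L))"
          unfolding power2_eq_square using lam M(1) u(2) by (intro mult_left_mono) auto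
        finally have "energy K lam (u n) \<le> length_h1 (u n) * (D / 2)" by (simp add: energy_def D_def algebra_simps)
        moreover have "c lam / 2 \<le> energy K lam (u n)" using u(1)[of n] \<epsilon>(3)[of n] by linarith
        ultimately show ?thesis using D by (simp add: divide_le_eq)
      qed
      have "0 < c lam / D" using cp D by simp
      then obtain v where v: "0 < length_h1 v" "energy K lam v = c lam" "energy_gradient K lam v = 0"
        using lam by (elim palais_smale[OF K lim K0 _ uE ug _ lo u(2) cl, rotated]) auto
      have "(energy K lam has_derivative (\<lambda>h. 0)) (at v)"
        using energy_has_derivative[OF uK M(2) v(1), of lam] v(3) by simp
      moreover have "v \<notin> range h1_const" using v(1) length_h1_eq_0[of v] by auto
      ultimately have "critical_value_off_constants (energy K lam) (c lam)"
        unfolding critical_value_off_constants_def using v(2) by blast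
      moreover have "F_loop (\<lambda>z. lam * K z) (range (h1_fun v))"
        by (rule critical_point_F_loop[OF K _ v(1,3)]) (use lam in simp)
      ultimately show "critical_value_off_constants (energy K lam) (c lam) \<and> (\<exists>C. F_loop (\<lambda>z. lam * K z) C)" by blast
    qed
  qed
qed

text \<open>The exceptions to \<open>P\<close> form an arbitrary set; what is reflected is a measurable null set that contains
  them.\<close>

lemma AE_lborel_reflect:
  fixes P :: "real \<Rightarrow> bool"
  assumes "AE x in lborel. P x" shows "AE x in lborel. P (- x)"
proof -
  obtain N where N: "{x \<in> space lborel. \<not> P x} \<subseteq> N" "N \<in> sets lborel" "emeasure lborel N = 0"
    using assms by (rule AE_E)
  have [measurable]: "N \<in> sets borel" using N(2) by simp
  have "AE x in lborel. x \<notin> N" using N(2,3) by (intro AE_not_in) (simp add: null_sets_def)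
  then have "AE x in lborel. 0 + (- 1) * x \<notin> N" by (intro AE_borel_affine) auto
  then show ?thesis by eventually_elim (use N(1) in auto)
qed

lemma energy_reflect: "energy (\<lambda>x. - K x) (- lam) = energy K lam"
  using G_h1_scale[of "-1" K] by (simp add: fun_eq_iff energy_def)

theorem theorem5p6:
  fixes K K1 :: "complex \<Rightarrow> real" and K0 a b r0 R :: real and z0 :: complex
  assumes "continuous_on UNIV K"
    and "K0 \<noteq> 0"
    and "\<And>z. K z = K0 + K1 z"
    and "(K1 \<longlongrightarrow> 0) at_infinity"
    and "a < b"
    and "{a..b} \<subseteq> - {0}"
    and "admissible K K0 a b r0 R"
    and "R \<le> norm z0"
  shows "(\<forall>lam\<in>{a..b}. mp_level K K0 r0 z0 lam \<le> pi / \<bar>lam * K0\<bar>) \<and>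
    (AE lam in lborel. lam \<in> {a..b} \<longrightarrow> mp_level K K0 r0 z0 lam < pi / \<bar>lam * K0\<bar> \<longrightarrow>
       critical_value_off_constants (energy K lam) (mp_level K K0 r0 z0 lam) \<and>
       (\<exists>C. F_loop (\<lambda>z. lam * K z) C))"
proof -
  have lim: "(K \<longlongrightarrow> K0) at_infinity"
  proof -
    have "((\<lambda>z. K0 + K1 z) \<longlongrightarrow> K0 + 0) at_infinity" by (intro tendsto_intros assms(4))
    moreover have "K = (\<lambda>z. K0 + K1 z)" using assms(3) by blast
    ultimately show ?thesis by simp
  qed
  show ?thesis
  proof (cases "0 < a")
    case True
    have adm: "admissible_pos K K0 a b r0 R" using assms(7) True by (simp add: admissible_def)
    note main = mountain_pass_positive[OF assms(1) lim assms(2) True assms(5) adm assms(8)]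
    have lev: "mp_level K K0 r0 z0 lam = mp_inf_max (energy K lam) (h1_circle r0 K0 + h1_const z0)"
      if "lam \<in> {a..b}" for lam using that True by (simp add: mp_level_def)
    show ?thesis
    proof
      show "\<forall>lam\<in>{a..b}. mp_level K K0 r0 z0 lam \<le> pi / \<bar>lam * K0\<bar>" using main(1) lev by simp
      show "AE lam in lborel. lam \<in> {a..b} \<longrightarrow> mp_level K K0 r0 z0 lam < pi / \<bar>lam * K0\<bar> \<longrightarrow>
         critical_value_off_constants (energy K lam) (mp_level K K0 r0 z0 lam) \<and> (\<exists>C. F_loop (\<lambda>z. lam * K z) C)"
        using main(2) by eventually_elim (simp add: lev)
    qed
  next
    case False
    have b: "b < 0"
    proof (rule ccontr)
      assume "\<not> b < 0"
      then have "0 \<in> {a..b}" using False by simp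
      then show False using assms(6) by auto
    qed
    have adm: "admissible_pos (\<lambda>x. - K x) (- K0) (- b) (- a) r0 R" using assms(7) False by (simp add: admissible_def)
    have mK: "continuous_on UNIV (\<lambda>x. - K x)" "((\<lambda>x. - K x) \<longlongrightarrow> - K0) at_infinity" "- K0 \<noteq> 0"
      using assms(1,2) lim by (auto intro!: continuous_intros tendsto_intros)
    note main = mountain_pass_positive[OF mK _ _ adm assms(8)]
    have lev: "mp_level K K0 r0 z0 lam = mp_inf_max (energy (\<lambda>x. - K x) (- lam)) (h1_circle r0 (- K0) + h1_const z0)"
      if "lam \<in> {a..b}" for lam using that b by (simp add: mp_level_def)
    show ?thesis
    proof
      show "\<forall>lam\<in>{a..b}. mp_level K K0 r0 z0 lam \<le> pi / \<bar>lam * K0\<bar>"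
      proof
        fix lam assume l: "lam \<in> {a..b}"
        have "- lam \<in> {- b..- a}" using l by simp
        from bspec[OF main(1) this] show "mp_level K K0 r0 z0 lam \<le> pi / \<bar>lam * K0\<bar>"
          using b assms(5) by (simp add: lev[OF l])
      qed
      have "AE lam in lborel. - lam \<in> {- b..- a} \<longrightarrow>
         mp_inf_max (energy (\<lambda>x. - K x) (- lam)) (h1_circle r0 (- K0) + h1_const z0) < pi / \<bar>- lam * - K0\<bar> \<longrightarrow>
         critical_value_off_constants (energy (\<lambda>x. - K x) (- lam))
           (mp_inf_max (energy (\<lambda>x. - K x) (- lam)) (h1_circle r0 (- K0) + h1_const z0)) \<and>
         (\<exists>C. F_loop (\<lambda>z. - lam * - K z) C)"
        using AE_lborel_reflect[OF main(2)] b assms(5) by simp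
      then show "AE lam in lborel. lam \<in> {a..b} \<longrightarrow> mp_level K K0 r0 z0 lam < pi / \<bar>lam * K0\<bar> \<longrightarrow>
         critical_value_off_constants (energy K lam) (mp_level K K0 r0 z0 lam) \<and> (\<exists>C. F_loop (\<lambda>z. lam * K z) C)"
        by eventually_elim (auto simp: lev energy_reflect)
    qed
  qed
qed

end
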